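(* Let $n>1$ be an integer prime to $\operatorname{char}(\Bbbk)$ and let $\mathbf{t}\in\mathbb{A}_X$ be a parameter vector. Then $\mathbb{A}_X\{\mathbf{t}^{1/n}\} = \mathbb{A}_X[T]/(T^n-\mathbf{t})$ is separable as an $\mathbb{A}_X$-algebra if and only if $\mathbf{t}\in\mathbb{I}_X$.
   Context: $\Bbbk$ is an algebraically closed field and $X$ is a projective, irreducible, non-singular curve over $\Bbbk$ with function field $\Sigma$. "$x\in X$" always means a closed point. For $x \in X$, $\upsilon_x$ is the corresponding discrete valuation of $\Sigma$, $A_x$ is the completion of the local ring of $X$ at $x$, $K_x$ is the fraction field of $A_x$, and $\upsilon_x$ also denotes the extended valuation on $K_x$. The adele ring is $\mathbb{A}_X=\{(\alpha_x)_x\in\prod_{x\in X}K_x : \alpha_x\in A_x \text{ for all but finitely many } x\}$, and $\mathbb{I}_X=\mathbb{A}_X^*$ is the idele group. A parameter vector is an adele $\mathbf{t}=(t_x)_x\in\mathbb{A}_X$ such that $t_x\neq 0$ for all $x\in X$ and the set $\operatorname{Ram}(\mathbf{t})=\{x\in X : \upsilon_x(t_x)\not\equiv 0 \bmod n\}$ is finite. A commutative algebra $A$ over a commutative ring $R$ is separable if $A$ is projective as an $A\otimes_R A$-module. *)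

theory Defs
  imports
    "HOL-Computational_Algebra.Polynomial"
    "HOL-Analysis.Abstract_Topology"
    "HOL-Library.Poly_Mapping"
    "HOL-Library.Extended_Nat"
    "HOL-Number_Theory.Cong"
    "HOL-Algebra.QuotRing"
    "HOL-Algebra.Ideal_Product"
    "HOL-Algebra.UnivPoly"
    "HOL-Algebra.Free_Abelian_Groups"
begin

section \<open>Projective varieties\<close>

text \<open>
  The finite type \<open>'i\<close> indexes the homogeneous coordinates, so the ambient space is the
  projective space of dimension \<open>CARD('i) - 1\<close> over \<open>'k\<close>. A point is a line through
  the origin with the origin removed, i.e. the set of all its homogeneous coordinate vectors.
\<close>

type_synonym 'i expo = "'i \<Rightarrow>\<^sub>0 nat"
type_synonym ('i, 'k) mpoly = "'i expo \<Rightarrow>\<^sub>0 'k"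
type_synonym ('i, 'k) point = "('i \<Rightarrow> 'k) set"

definition mpoly_eval :: "('i::finite, 'k::field) mpoly \<Rightarrow> ('i \<Rightarrow> 'k) \<Rightarrow> 'k" where
  "mpoly_eval f v =
     (\<Sum>m\<in>Poly_Mapping.keys f. Poly_Mapping.lookup f m * (\<Prod>i\<in>UNIV. v i ^ Poly_Mapping.lookup m i))"

definition homogeneous :: "nat \<Rightarrow> ('i::finite, 'k::field) mpoly \<Rightarrow> bool" where
  "homogeneous d f \<longleftrightarrow>
     (\<forall>m\<in>Poly_Mapping.keys f. (\<Sum>i\<in>UNIV. Poly_Mapping.lookup m i) = d)"

definition projective_space :: "('i::finite, 'k::field) point set" where
  "projective_space = {{w. \<exists>c. c \<noteq> 0 \<and> w = (\<lambda>i. c * v i)} | v. v \<noteq> (\<lambda>_. 0)}"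

definition zero_locus :: "('i::finite, 'k::field) mpoly set \<Rightarrow> ('i, 'k) point set" where
  "zero_locus F = {P \<in> projective_space. \<forall>f\<in>F. \<forall>v\<in>P. mpoly_eval f v = 0}"

definition zariski :: "('i::finite, 'k::field) point topology" where
  "zariski = topology (\<lambda>U. \<exists>F. (\<forall>f\<in>F. \<exists>d. homogeneous d f) \<and> U = projective_space - zero_locus F)"

lemma mpoly_eval_superset:
  assumes "finite K" "Poly_Mapping.keys f \<subseteq> K"
  shows "mpoly_eval f v =
    (\<Sum>m\<in>K. Poly_Mapping.lookup f m * (\<Prod>i\<in>UNIV. v i ^ Poly_Mapping.lookup m i))"
  unfolding mpoly_eval_def
  by (rule sum.mono_neutral_left) (use assms in \<open>auto simp: in_keys_iff\<close>)

lemma mpoly_eval_zero [simp]: "mpoly_eval 0 v = 0"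
  by (simp add: mpoly_eval_def)

lemma mpoly_eval_one [simp]: "mpoly_eval 1 v = 1"
  by (simp add: mpoly_eval_def)

lemma mpoly_eval_add: "mpoly_eval (f + g) v = mpoly_eval f v + mpoly_eval g v"
proof -
  let ?K = "Poly_Mapping.keys f \<union> Poly_Mapping.keys g"
  have K: "finite ?K" by simp
  show ?thesis
    using mpoly_eval_superset[OF K, of f v] mpoly_eval_superset[OF K, of g v]
      mpoly_eval_superset[OF K Poly_Mapping.keys_add, of v]
    by (simp add: lookup_add distrib_right sum.distrib)
qed

lemma mpoly_eval_single:
  "mpoly_eval (Poly_Mapping.single m c) v = c * (\<Prod>i\<in>UNIV. v i ^ Poly_Mapping.lookup m i)"
  by (cases "c = 0") (simp_all add: mpoly_eval_def)

lemma poly_mapping_monom_induct [case_names single sum]: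
  fixes f :: "'a \<Rightarrow>\<^sub>0 'b::comm_monoid_add"
  assumes single: "\<And>m c. P (Poly_Mapping.single m c)"
    and sum: "\<And>f g. P f \<Longrightarrow> P g \<Longrightarrow> P (f + g)"
  shows "P f"
proof -
  have "P (\<Sum>m\<in>K. Poly_Mapping.single m (Poly_Mapping.lookup f m))" if "finite K" for K
    using that
  proof induction
    case empty
    show ?case using single[of undefined 0] by simp
  next
    case (insert m K)
    then show ?case using single sum by simp
  qed
  moreover have "f = (\<Sum>m\<in>Poly_Mapping.keys f. Poly_Mapping.single m (Poly_Mapping.lookup f m))"
  proof (rule poly_mapping_eqI)
    fix k
    have "(\<Sum>m\<in>Poly_Mapping.keys f. Poly_Mapping.lookup f m when m = k) = Poly_Mapping.lookup f k"
      by (cases "k \<in> Poly_Mapping.keys f") (auto simp: when_def in_keys_iff)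
    then show "Poly_Mapping.lookup f k =
        Poly_Mapping.lookup (\<Sum>m\<in>Poly_Mapping.keys f. Poly_Mapping.single m (Poly_Mapping.lookup f m)) k"
      by (simp add: lookup_sum lookup_single)
  qed
  ultimately show ?thesis by (metis finite_keys)
qed

lemma mpoly_eval_single_mult:
  "mpoly_eval (Poly_Mapping.single m c * g) v = mpoly_eval (Poly_Mapping.single m c) v * mpoly_eval g v"
proof (induction g rule: poly_mapping_monom_induct)
  case (single n d)
  show ?case
    by (simp add: mult_single mpoly_eval_single lookup_add power_add prod.distrib)
next
  case (sum f g)
  then show ?case by (simp add: distrib_left mpoly_eval_add)
qed

lemma mpoly_eval_mult: "mpoly_eval (f * g) v = mpoly_eval f v * mpoly_eval g v"
proof (induction f rule: poly_mapping_monom_induct)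
  case (single m c)
  show ?case by (rule mpoly_eval_single_mult)
next
  case (sum f h)
  then show ?case by (simp add: distrib_right mpoly_eval_add)
qed

lemma homogeneous_mult:
  assumes "homogeneous d f" "homogeneous e g"
  shows "homogeneous (d + e) (f * g)"
  unfolding homogeneous_def
proof
  fix m assume "m \<in> Poly_Mapping.keys (f * g)"
  then obtain a b where "m = a + b" "a \<in> Poly_Mapping.keys f" "b \<in> Poly_Mapping.keys g"
    using keys_mult[of f g] by blast
  then show "(\<Sum>i\<in>UNIV. Poly_Mapping.lookup m i) = d + e"
    using assms by (simp add: homogeneous_def lookup_add sum.distrib)
qed

lemma mpoly_eval_scale:
  assumes "homogeneous d f"
  shows "mpoly_eval f (\<lambda>i. c * v i) = c ^ d * mpoly_eval f v"
proof -
  have "(\<Prod>i\<in>UNIV. (c * v i) ^ Poly_Mapping.lookup m i) =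
      c ^ d * (\<Prod>i\<in>UNIV. v i ^ Poly_Mapping.lookup m i)" if "m \<in> Poly_Mapping.keys f" for m
    using assms that
    by (simp add: homogeneous_def power_mult_distrib prod.distrib flip: power_sum)
  then show ?thesis
    unfolding mpoly_eval_def sum_distrib_left by (intro sum.cong) auto
qed

lemma homogeneous_vanish_iff:
  assumes "homogeneous d f" "P \<in> projective_space" "v \<in> P" "w \<in> P"
  shows "mpoly_eval f v = 0 \<longleftrightarrow> mpoly_eval f w = 0"
  using assms by (auto simp: projective_space_def mpoly_eval_scale)

lemma istopology_zariski:
  "istopology (\<lambda>U::('i::finite, 'k::field) point set.
     \<exists>F. (\<forall>f\<in>F. \<exists>d. homogeneous d f) \<and> U = projective_space - zero_locus F)"
  unfolding istopology_def
proof (intro conjI allI impI)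
  fix S T :: "('i, 'k) point set"
  assume "\<exists>F. (\<forall>f\<in>F. \<exists>d. homogeneous d f) \<and> S = projective_space - zero_locus F"
    and "\<exists>F. (\<forall>f\<in>F. \<exists>d. homogeneous d f) \<and> T = projective_space - zero_locus F"
  then obtain F G
    where F: "\<forall>f\<in>F. \<exists>d. homogeneous d f" "S = projective_space - zero_locus F"
      and G: "\<forall>f\<in>G. \<exists>d. homogeneous d f" "T = projective_space - zero_locus G"
    by blast
  let ?H = "{f * g | f g. f \<in> F \<and> g \<in> G}"
  have hom: "\<forall>h\<in>?H. \<exists>d. homogeneous d h"
    using F(1) G(1) homogeneous_mult by blast
  have "P \<in> S \<inter> T \<longleftrightarrow> P \<in> projective_space - zero_locus ?H" for P
  proof
    assume "P \<in> S \<inter> T"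
    then obtain f v g w where P: "P \<in> projective_space" and
      *: "f \<in> F" "v \<in> P" "mpoly_eval f v \<noteq> 0" "g \<in> G" "w \<in> P" "mpoly_eval g w \<noteq> 0"
      using F(2) G(2) by (auto simp: zero_locus_def)
    then have "mpoly_eval g v \<noteq> 0"
      using G(1) homogeneous_vanish_iff by metis
    then have "mpoly_eval (f * g) v \<noteq> 0"
      using * by (simp add: mpoly_eval_mult)
    then show "P \<in> projective_space - zero_locus ?H"
      using P * by (auto simp: zero_locus_def)
  next
    assume "P \<in> projective_space - zero_locus ?H"
    then show "P \<in> S \<inter> T"
      using F(2) G(2) by (auto simp: zero_locus_def mpoly_eval_mult)
  qed
  then show "\<exists>F. (\<forall>f\<in>F. \<exists>d. homogeneous d f) \<and> S \<inter> T = projective_space - zero_locus F"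
    using hom by blast
next
  fix \<K> :: "('i, 'k) point set set"
  assume "\<forall>K\<in>\<K>. \<exists>F. (\<forall>f\<in>F. \<exists>d. homogeneous d f) \<and> K = projective_space - zero_locus F"
  then obtain F where F: "\<And>K. K \<in> \<K> \<Longrightarrow>
      (\<forall>f\<in>F K. \<exists>d. homogeneous d f) \<and> K = projective_space - zero_locus (F K)"
    by metis
  have "\<Union>\<K> = (\<Union>K\<in>\<K>. projective_space - zero_locus (F K))"
    using F by blast
  also have "\<dots> = projective_space - zero_locus (\<Union>K\<in>\<K>. F K)"
    by (auto simp: zero_locus_def)
  finally have "\<Union>\<K> = projective_space - zero_locus (\<Union>K\<in>\<K>. F K)" .
  then show "\<exists>F. (\<forall>f\<in>F. \<exists>d. homogeneous d f) \<and> \<Union>\<K> = projective_space - zero_locus F"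
    using F by (intro exI[of _ "\<Union>K\<in>\<K>. F K"] conjI) blast+
qed

lemma openin_zariski:
  "openin zariski U \<longleftrightarrow>
     (\<exists>F. (\<forall>f\<in>F. \<exists>d. homogeneous d f) \<and> U = projective_space - zero_locus F)"
  unfolding zariski_def by (simp add: topology_inverse'[OF istopology_zariski])

definition irreducible_closed :: "('i::finite, 'k::field) point set \<Rightarrow> bool" where
  "irreducible_closed Z \<longleftrightarrow> closedin zariski Z \<and> Z \<noteq> {} \<and>
     (\<forall>Z1 Z2. closedin zariski Z1 \<longrightarrow> closedin zariski Z2 \<longrightarrow> Z \<subseteq> Z1 \<union> Z2 \<longrightarrow> Z \<subseteq> Z1 \<or> Z \<subseteq> Z2)"

text \<open>The supremum of the lengths \<open>n\<close> of strictly increasing chains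
  \<open>C\<^sub>0 \<subset> C\<^sub>1 \<subset> \<dots> \<subset> C\<^sub>n\<close> of members of a family of sets.\<close>

definition chain_dim :: "'a set set \<Rightarrow> enat" where
  "chain_dim \<F> = Sup {enat n | n. \<exists>C. (\<forall>i\<le>n. C i \<in> \<F>) \<and> (\<forall>i<n. C i \<subset> C (Suc i))}"

definition projective_curve :: "('i::finite, 'k::field) point set \<Rightarrow> bool" where
  "projective_curve X \<longleftrightarrow> irreducible_closed X \<and> chain_dim {Z. irreducible_closed Z \<and> Z \<subseteq> X} = 1"


section \<open>Local rings and non-singularity\<close>

definition regular_fun_at ::
  "('i::finite, 'k::field) point set \<Rightarrow> ('i, 'k) point \<Rightarrow> (('i, 'k) point \<Rightarrow> 'k) \<Rightarrow> bool" where
  "regular_fun_at X x f \<longleftrightarrow>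
     (\<exists>U d p q. openin (subtopology zariski X) U \<and> x \<in> U \<and> homogeneous d p \<and> homogeneous d q \<and>
        (\<forall>y\<in>U. \<forall>v\<in>y. mpoly_eval q v \<noteq> 0 \<and> f y = mpoly_eval p v / mpoly_eval q v))"

definition regular_fun_ring ::
  "('i::finite, 'k::field) point set \<Rightarrow> ('i, 'k) point \<Rightarrow> (('i, 'k) point \<Rightarrow> 'k) ring" where
  "regular_fun_ring X x =
     \<lparr>carrier = {f. regular_fun_at X x f}, monoid.mult = (\<lambda>f g y. f y * g y), monoid.one = (\<lambda>_. 1),
      ring.zero = (\<lambda>_. 0), ring.add = (\<lambda>f g y. f y + g y)\<rparr>"

definition locally_zero ::
  "('i::finite, 'k::field) point set \<Rightarrow> ('i, 'k) point \<Rightarrow> (('i, 'k) point \<Rightarrow> 'k) set" where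
  "locally_zero X x =
     {f \<in> carrier (regular_fun_ring X x).
        \<exists>U. openin (subtopology zariski X) U \<and> x \<in> U \<and> (\<forall>y\<in>U. f y = 0)}"

type_synonym ('i, 'k) germ = "(('i, 'k) point \<Rightarrow> 'k) set"

text \<open>Germs at \<open>x\<close> of regular functions on \<open>X\<close>. The functions are total on the type of
  points; their values away from \<open>X\<close>, or from a neighbourhood of \<open>x\<close>, are irrelevant modulo
  \<^const>\<open>locally_zero\<close>.\<close>

definition local_ring ::
  "('i::finite, 'k::field) point set \<Rightarrow> ('i, 'k) point \<Rightarrow> ('i, 'k) germ ring" where
  "local_ring X x = regular_fun_ring X x Quot locally_zero X x"

definition local_max_ideal ::
  "('i::finite, 'k::field) point set \<Rightarrow> ('i, 'k) point \<Rightarrow> ('i, 'k) germ set" where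
  "local_max_ideal X x = {a \<in> carrier (local_ring X x). \<exists>f\<in>a. f x = 0}"

definition krull_dim :: "('a, 'b) ring_scheme \<Rightarrow> enat" where
  "krull_dim R = chain_dim {P. primeideal P R}"

text \<open>Regularity of the (Noetherian) local rings: the maximal ideal is generated by as many
  elements as the Krull dimension of the ring.\<close>

definition nonsingular :: "('i::finite, 'k::field) point set \<Rightarrow> bool" where
  "nonsingular X \<longleftrightarrow>
     (\<forall>x\<in>X. \<exists>B. B \<subseteq> carrier (local_ring X x) \<and> finite B \<and>
        enat (card B) = krull_dim (local_ring X x) \<and>
        genideal (local_ring X x) B = local_max_ideal X x)"


section \<open>Completions and fraction fields\<close>

primrec ideal_pow :: "('a, 'b) ring_scheme \<Rightarrow> 'a set \<Rightarrow> nat \<Rightarrow> 'a set" where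
  "ideal_pow R I 0 = carrier R"
| "ideal_pow R I (Suc k) = ideal_prod R I (ideal_pow R I k)"

text \<open>The inverse limit of the rings \<open>R / I\<^sup>k\<close>. The image of a coset of \<open>I\<^bsup>k+1\<^esup>\<close> in
  \<open>R / I\<^sup>k\<close> is the coset containing it, so compatibility is inclusion.\<close>

definition adic_completion :: "('a, 'b) ring_scheme \<Rightarrow> 'a set \<Rightarrow> (nat \<Rightarrow> 'a set) ring" where
  "adic_completion R I =
     \<lparr>carrier = {\<alpha>. \<forall>k. \<alpha> k \<in> carrier (R Quot ideal_pow R I k) \<and> \<alpha> (Suc k) \<subseteq> \<alpha> k},
      monoid.mult = (\<lambda>\<alpha> \<beta> k. \<alpha> k \<otimes>\<^bsub>R Quot ideal_pow R I k\<^esub> \<beta> k),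
      monoid.one = (\<lambda>k. \<one>\<^bsub>R Quot ideal_pow R I k\<^esub>),
      ring.zero = (\<lambda>k. \<zero>\<^bsub>R Quot ideal_pow R I k\<^esub>),
      ring.add = (\<lambda>\<alpha> \<beta> k. \<alpha> k \<oplus>\<^bsub>R Quot ideal_pow R I k\<^esub> \<beta> k)\<rparr>"

text \<open>For \<open>\<alpha> \<noteq> 0\<close>: the largest \<open>k\<close> such that elements of \<open>R\<close> approximating
  \<open>\<alpha>\<close> sufficiently well lie in \<open>I\<^sup>k\<close>. If \<open>R\<close> is a discrete valuation ring with maximal ideal
  \<open>I\<close>, this is the extension of its valuation to the completion.\<close>

definition adic_order :: "('a, 'b) ring_scheme \<Rightarrow> 'a set \<Rightarrow> (nat \<Rightarrow> 'a set) \<Rightarrow> nat" where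
  "adic_order R I \<alpha> = (GREATEST k. \<alpha> k = \<zero>\<^bsub>R Quot ideal_pow R I k\<^esub>)"

definition non_zero_divisors :: "('a, 'b) ring_scheme \<Rightarrow> 'a set" where
  "non_zero_divisors R = {s \<in> carrier R. \<forall>a\<in>carrier R. a \<otimes>\<^bsub>R\<^esub> s = \<zero>\<^bsub>R\<^esub> \<longrightarrow> a = \<zero>\<^bsub>R\<^esub>}"

definition fraction :: "('a, 'b) ring_scheme \<Rightarrow> 'a \<Rightarrow> 'a \<Rightarrow> ('a \<times> 'a) set" where
  "fraction R a s = {(b, u). b \<in> carrier R \<and> u \<in> non_zero_divisors R \<and> a \<otimes>\<^bsub>R\<^esub> u = b \<otimes>\<^bsub>R\<^esub> s}"

text \<open>The total ring of fractions. In a domain the non-zero-divisors are the non-zero elements,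
  so this is the fraction field.\<close>

definition fraction_ring :: "('a, 'b) ring_scheme \<Rightarrow> ('a \<times> 'a) set ring" where
  "fraction_ring R =
     \<lparr>carrier = {fraction R a s | a s. a \<in> carrier R \<and> s \<in> non_zero_divisors R},
      monoid.mult = (\<lambda>Y Z. \<Union>(a, s)\<in>Y. \<Union>(b, u)\<in>Z. fraction R (a \<otimes>\<^bsub>R\<^esub> b) (s \<otimes>\<^bsub>R\<^esub> u)),
      monoid.one = fraction R \<one>\<^bsub>R\<^esub> \<one>\<^bsub>R\<^esub>,
      ring.zero = fraction R \<zero>\<^bsub>R\<^esub> \<one>\<^bsub>R\<^esub>,
      ring.add = (\<lambda>Y Z. \<Union>(a, s)\<in>Y. \<Union>(b, u)\<in>Z.
               fraction R ((a \<otimes>\<^bsub>R\<^esub> u) \<oplus>\<^bsub>R\<^esub> (b \<otimes>\<^bsub>R\<^esub> s)) (s \<otimes>\<^bsub>R\<^esub> u))\<rparr>"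

type_synonym ('i, 'k) germ_lim = "nat \<Rightarrow> ('i, 'k) germ set"
type_synonym ('i, 'k) germ_frac = "(('i, 'k) germ_lim \<times> ('i, 'k) germ_lim) set"

definition completed_local_ring ::
  "('i::finite, 'k::field) point set \<Rightarrow> ('i, 'k) point \<Rightarrow> ('i, 'k) germ_lim ring" where
  "completed_local_ring X x = adic_completion (local_ring X x) (local_max_ideal X x)"

definition local_field ::
  "('i::finite, 'k::field) point set \<Rightarrow> ('i, 'k) point \<Rightarrow> ('i, 'k) germ_frac ring" where
  "local_field X x = fraction_ring (completed_local_ring X x)"

definition local_integers ::
  "('i::finite, 'k::field) point set \<Rightarrow> ('i, 'k) point \<Rightarrow> ('i, 'k) germ_frac set" where
  "local_integers X x =
     (\<lambda>a. fraction (completed_local_ring X x) a \<one>\<^bsub>completed_local_ring X x\<^esub>)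
       ` carrier (completed_local_ring X x)"

text \<open>The valuation \<open>\<upsilon>\<^sub>x\<close> on non-zero elements of \<^const>\<open>local_field\<close>:
  \<open>\<upsilon>\<^sub>x(a/s) = \<upsilon>\<^sub>x(a) - \<upsilon>\<^sub>x(s)\<close>.\<close>

definition valuation ::
  "('i::finite, 'k::field) point set \<Rightarrow> ('i, 'k) point \<Rightarrow> ('i, 'k) germ_frac \<Rightarrow> int" where
  "valuation X x z =
     (THE k. \<exists>(a, s)\<in>z. k = int (adic_order (local_ring X x) (local_max_ideal X x) a)
                           - int (adic_order (local_ring X x) (local_max_ideal X x) s))"


section \<open>Adeles\<close>

type_synonym ('i, 'k) adele = "('i, 'k) point \<Rightarrow> ('i, 'k) germ_frac"

definition adele_ring :: "('i::finite, 'k::field) point set \<Rightarrow> ('i, 'k) adele ring" where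
  "adele_ring X =
     \<lparr>carrier = {\<alpha> \<in> \<Pi>\<^sub>E x\<in>X. carrier (local_field X x). finite {x \<in> X. \<alpha> x \<notin> local_integers X x}},
      monoid.mult = (\<lambda>\<alpha> \<beta>. \<lambda>x\<in>X. \<alpha> x \<otimes>\<^bsub>local_field X x\<^esub> \<beta> x),
      monoid.one = (\<lambda>x\<in>X. \<one>\<^bsub>local_field X x\<^esub>),
      ring.zero = (\<lambda>x\<in>X. \<zero>\<^bsub>local_field X x\<^esub>),
      ring.add = (\<lambda>\<alpha> \<beta>. \<lambda>x\<in>X. \<alpha> x \<oplus>\<^bsub>local_field X x\<^esub> \<beta> x)\<rparr>"

definition ideles :: "('i::finite, 'k::field) point set \<Rightarrow> ('i, 'k) adele set" where
  "ideles X = Units (adele_ring X)"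

definition Ram :: "('i::finite, 'k::field) point set \<Rightarrow> nat \<Rightarrow> ('i, 'k) adele \<Rightarrow> ('i, 'k) point set" where
  "Ram X n t = {x \<in> X. \<not> [valuation X x (t x) = 0] (mod int n)}"

definition parameter_vector ::
  "('i::finite, 'k::field) point set \<Rightarrow> nat \<Rightarrow> ('i, 'k) adele \<Rightarrow> bool" where
  "parameter_vector X n t \<longleftrightarrow>
     t \<in> carrier (adele_ring X) \<and> (\<forall>x\<in>X. t x \<noteq> \<zero>\<^bsub>local_field X x\<^esub>) \<and> finite (Ram X n t)"


section \<open>Separable algebras\<close>

text \<open>The algebra \<open>R[T]/(T\<^sup>n - t)\<close>.\<close>

definition root_ideal :: "('r, 'x) ring_scheme \<Rightarrow> nat \<Rightarrow> 'r \<Rightarrow> (nat \<Rightarrow> 'r) set" where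
  "root_ideal R n t =
     genideal (UP R) {up_ring.monom (UP R) \<one>\<^bsub>R\<^esub> n \<ominus>\<^bsub>UP R\<^esub> up_ring.monom (UP R) t 0}"

definition root_algebra ::
  "('r, 'x) ring_scheme \<Rightarrow> nat \<Rightarrow> 'r \<Rightarrow> ('r, (nat \<Rightarrow> 'r) set) module" where
  "root_algebra R n t =
     (let Q = UP R Quot root_ideal R n t in
      \<lparr>carrier = carrier Q, monoid.mult = monoid.mult Q, monoid.one = monoid.one Q, ring.zero = ring.zero Q, ring.add = ring.add Q,
       smult = (\<lambda>r C. (root_ideal R n t +>\<^bsub>UP R\<^esub> up_ring.monom (UP R) r 0) \<otimes>\<^bsub>Q\<^esub> C)\<rparr>)"

text \<open>The tensor product \<open>A \<otimes>\<^sub>R B\<close> of commutative algebras: the free abelian group on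
  \<open>A \<times> B\<close>, with \<open>(a, b) \<cdot> (a', b') = (aa', bb')\<close>, modulo the relations of bilinearity and
  \<open>R\<close>-balancedness. The relations are stable under multiplication by basis elements, so the ideal
  they generate is the subgroup they generate.\<close>

definition tensor_free_ring ::
  "('a, 'x) ring_scheme \<Rightarrow> ('b, 'y) ring_scheme \<Rightarrow> ('a \<times> 'b \<Rightarrow>\<^sub>0 int) ring" where
  "tensor_free_ring A B =
     \<lparr>carrier = {c. Poly_Mapping.keys c \<subseteq> carrier A \<times> carrier B},
      monoid.mult = (\<lambda>c d. frag_extend (\<lambda>(a, b). frag_extend (\<lambda>(a', b').
                frag_of (a \<otimes>\<^bsub>A\<^esub> a', b \<otimes>\<^bsub>B\<^esub> b')) d) c),
      monoid.one = frag_of (\<one>\<^bsub>A\<^esub>, \<one>\<^bsub>B\<^esub>), ring.zero = 0, ring.add = (+)\<rparr>"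

definition tensor_relations ::
  "('r, 'z) ring_scheme \<Rightarrow> ('r, 'a, 'x) module_scheme \<Rightarrow> ('r, 'b, 'y) module_scheme
     \<Rightarrow> ('a \<times> 'b \<Rightarrow>\<^sub>0 int) set" where
  "tensor_relations R A B =
     {frag_of (a \<oplus>\<^bsub>A\<^esub> a', b) - frag_of (a, b) - frag_of (a', b) | a a' b.
        a \<in> carrier A \<and> a' \<in> carrier A \<and> b \<in> carrier B} \<union>
     {frag_of (a, b \<oplus>\<^bsub>B\<^esub> b') - frag_of (a, b) - frag_of (a, b') | a b b'.
        a \<in> carrier A \<and> b \<in> carrier B \<and> b' \<in> carrier B} \<union>
     {frag_of (r \<odot>\<^bsub>A\<^esub> a, b) - frag_of (a, r \<odot>\<^bsub>B\<^esub> b) | r a b.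
        r \<in> carrier R \<and> a \<in> carrier A \<and> b \<in> carrier B}"

definition tensor_ring ::
  "('r, 'z) ring_scheme \<Rightarrow> ('r, 'a, 'x) module_scheme \<Rightarrow> ('r, 'b, 'y) module_scheme
     \<Rightarrow> ('a \<times> 'b \<Rightarrow>\<^sub>0 int) set ring" where
  "tensor_ring R A B =
     tensor_free_ring A B Quot genideal (tensor_free_ring A B) (tensor_relations R A B)"

text \<open>The multiplication map \<open>A \<otimes>\<^sub>R A \<rightarrow> A\<close>, \<open>a \<otimes> b \<mapsto> ab\<close>, on cosets.\<close>

definition tensor_mult_map :: "('a, 'x) ring_scheme \<Rightarrow> ('a \<times> 'a \<Rightarrow>\<^sub>0 int) set \<Rightarrow> 'a" where
  "tensor_mult_map A C =
     the_elem ((\<lambda>c. \<Oplus>\<^bsub>A\<^esub>p\<in>Poly_Mapping.keys c.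
                  [Poly_Mapping.lookup c p] \<cdot>\<^bsub>A\<^esub> (fst p \<otimes>\<^bsub>A\<^esub> snd p)) ` C)"

definition enveloping_module ::
  "('a, 'x) ring_scheme \<Rightarrow> (('a \<times> 'a \<Rightarrow>\<^sub>0 int) set, 'a) module" where
  "enveloping_module A =
     \<lparr>carrier = carrier A, monoid.mult = monoid.mult A, monoid.one = monoid.one A, ring.zero = ring.zero A, ring.add = ring.add A,
      smult = (\<lambda>C a. tensor_mult_map A C \<otimes>\<^bsub>A\<^esub> a)\<rparr>"

definition module_maps ::
  "('r, 'z) ring_scheme \<Rightarrow> ('r, 'a, 'x) module_scheme \<Rightarrow> ('r, 'b, 'y) module_scheme
     \<Rightarrow> ('a \<Rightarrow> 'b) set" where
  "module_maps R M N =
     {h \<in> carrier M \<rightarrow> carrier N.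
        (\<forall>x\<in>carrier M. \<forall>y\<in>carrier M. h (x \<oplus>\<^bsub>M\<^esub> y) = h x \<oplus>\<^bsub>N\<^esub> h y) \<and>
        (\<forall>r\<in>carrier R. \<forall>x\<in>carrier M. h (r \<odot>\<^bsub>M\<^esub> x) = r \<odot>\<^bsub>N\<^esub> h x)}"

text \<open>Modules ignore the fields \<^const>\<open>monoid.mult\<close> and \<^const>\<open>monoid.one\<close> of the record.\<close>

definition free_module :: "('r, 'z) ring_scheme \<Rightarrow> 's set \<Rightarrow> ('r, 's \<Rightarrow> 'r) module" where
  "free_module R S =
     \<lparr>carrier = {f \<in> S \<rightarrow>\<^sub>E carrier R. finite {s \<in> S. f s \<noteq> \<zero>\<^bsub>R\<^esub>}},
      monoid.mult = undefined, monoid.one = undefined,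
      ring.zero = (\<lambda>s\<in>S. \<zero>\<^bsub>R\<^esub>), ring.add = (\<lambda>f g. \<lambda>s\<in>S. f s \<oplus>\<^bsub>R\<^esub> g s),
      smult = (\<lambda>r f. \<lambda>s\<in>S. r \<otimes>\<^bsub>R\<^esub> f s)\<rparr>"

text \<open>Projective means being a direct summand of a free module. It is enough to consider the
  free module on the set underlying \<open>M\<close>: if \<open>M\<close> is a direct summand of any free module, then
  the canonical surjection from this one onto \<open>M\<close> splits.\<close>

definition projective_module :: "('r, 'z) ring_scheme \<Rightarrow> ('r, 'm, 'x) module_scheme \<Rightarrow> bool" where
  "projective_module R M \<longleftrightarrow> module R M \<and>
     (\<exists>i\<in>module_maps R M (free_module R (carrier M)).
      \<exists>p\<in>module_maps R (free_module R (carrier M)) M. \<forall>m\<in>carrier M. p (i m) = m)"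

definition separable_algebra :: "('r, 'z) ring_scheme \<Rightarrow> ('r, 'a, 'x) module_scheme \<Rightarrow> bool" where
  "separable_algebra R A \<longleftrightarrow> algebra R A \<and> projective_module (tensor_ring R A A) (enveloping_module A)"

end

theory Submission
  imports Defs
begin

text \<open>
  Nothing about the adele ring matters beyond the fact that it is a commutative ring in which
  \<open>n\<close> is invertible. For any such ring \<open>R\<close> put \<open>A = R[T]/(T\<^sup>n - t)\<close>. Then \<open>A\<close> is separable iff
  there is a separability idempotent, i.e. an \<open>e\<close> in \<open>A \<otimes> A\<close> which is mapped to \<open>1\<close> by the
  multiplication and satisfies \<open>(a \<otimes> 1) e = (1 \<otimes> a) e\<close> for all \<open>a\<close>.
  If \<open>t\<close> is a unit, then \<open>((nT\<^bsup>n-1\<^esup>)\<^bsup>-1\<^esup> \<otimes> 1) \<cdot> (\<Sum>i<n. T\<^sup>i \<otimes> T\<^bsup>n-1-i\<^esup>)\<close> is such an \<open>e\<close>.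
  Conversely, let \<open>C = R[T]/(t, T\<^sup>2)\<close>. The two \<open>R\<close>-algebra homomorphisms \<open>A \<rightarrow> C\<close> with
  \<open>T \<mapsto> 0\<close> and \<open>T \<mapsto> T\<close> induce \<open>\<Phi> : A \<otimes> A \<rightarrow> C\<close>, and applying \<open>\<Phi>\<close> to
  \<open>(T \<otimes> 1) e = (1 \<otimes> T) e\<close> gives \<open>0 = T \<Phi>(e) = T\<close> in \<open>C\<close>, because \<open>\<Phi>(e)\<close> is congruent to
  \<open>1\<close> modulo \<open>T\<close>. Hence \<open>1\<close> lies in \<open>tR\<close>.
\<close>

section \<open>Tensor products of algebras\<close>

text \<open>The ring \<open>C\<close> consists of the dual numbers over R/tR, and the two maps from
  A are two lifts of one and the same map to R/tR along the square-zero ideal generated by T. A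
  separable algebra does not admit two distinct lifts of this kind, which forces T = 0 in
  \<open>C\<close> and so R/tR = 0. Both maps exist because T^n vanishes in \<open>C\<close> for n >
  1, just as t does. For the other implication, the sum in the idempotent is the difference quotient
  of the n-th power at the two copies of T. Multiplied by the difference of the copies it becomes
  the difference of the two images of t, which is zero as tensors are balanced over R. The
  multiplication turns it into the derivative nT^(n-1), a unit because its product with T is nt.
  Projectivity is defined by a retraction of the free module on the whole underlying set of A, not
  by a section of the multiplication, so the idempotent must be extracted from a vector with many
  coordinates. The inverse of n starts as a constant regular function and travels along ring
  homomorphisms to the completed local rings; there it is chosen point by point, so that the
  resulting family is integral.\<close>

definition monoid_ring :: "('g, 'x) monoid_scheme \<Rightarrow> ('g \<Rightarrow>\<^sub>0 int) ring" where
  "monoid_ring G =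
     \<lparr>carrier = {c. Poly_Mapping.keys c \<subseteq> carrier G},
      monoid.mult = (\<lambda>c d. frag_extend (\<lambda>p. frag_extend (\<lambda>q. frag_of (p \<otimes>\<^bsub>G\<^esub> q)) d) c),
      monoid.one = frag_of \<one>\<^bsub>G\<^esub>, ring.zero = 0, ring.add = (+)\<rparr>"

lemma monoid_ring_simps:
  "carrier (monoid_ring G) = {c. Poly_Mapping.keys c \<subseteq> carrier G}"
  "\<one>\<^bsub>monoid_ring G\<^esub> = frag_of \<one>\<^bsub>G\<^esub>" "\<zero>\<^bsub>monoid_ring G\<^esub> = 0" "c \<oplus>\<^bsub>monoid_ring G\<^esub> d = c + d"
  by (simp_all add: monoid_ring_def)

text \<open>This gives distributivity in the second factor of a product, which sits inside the
  function handed to the outer \<open>frag_extend\<close>.\<close>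

lemma frag_extend_fun_diff: "frag_extend (\<lambda>x. f x - g x) c = frag_extend f c - frag_extend g c"
  using subset_UNIV
  by (induction c rule: frag_induction) (auto simp: frag_extend_diff)

lemma monoid_ring_mult_of:
  "frag_of p \<otimes>\<^bsub>monoid_ring G\<^esub> frag_of q = frag_of (p \<otimes>\<^bsub>G\<^esub> q)"
  by (simp add: monoid_ring_def)

lemma monoid_ring_mult_zero:
  "0 \<otimes>\<^bsub>monoid_ring G\<^esub> d = 0" "c \<otimes>\<^bsub>monoid_ring G\<^esub> 0 = 0"
  by (simp_all add: monoid_ring_def frag_extend_eq_0)

text \<open>Differences rather than sums match the generating step of
  \<open>frag_induction\<close>.\<close>

lemma monoid_ring_mult_diff:
  "(c - d) \<otimes>\<^bsub>monoid_ring G\<^esub> e = c \<otimes>\<^bsub>monoid_ring G\<^esub> e - d \<otimes>\<^bsub>monoid_ring G\<^esub> e"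
  "e \<otimes>\<^bsub>monoid_ring G\<^esub> (c - d) = e \<otimes>\<^bsub>monoid_ring G\<^esub> c - e \<otimes>\<^bsub>monoid_ring G\<^esub> d"
  by (simp_all add: monoid_ring_def frag_extend_diff frag_extend_fun_diff)

lemma monoid_ring_mult_add:
  "(c + d) \<otimes>\<^bsub>monoid_ring G\<^esub> e = c \<otimes>\<^bsub>monoid_ring G\<^esub> e + d \<otimes>\<^bsub>monoid_ring G\<^esub> e"
  using monoid_ring_mult_diff(1)[of G "c + d" d e] by simp

lemmas monoid_ring_mult = monoid_ring_mult_of monoid_ring_mult_zero monoid_ring_mult_diff

text \<open>Both sides of each law are additive in every argument, so it suffices to compare them on
  basis elements, one argument at a time, where the law is that of the monoid. The instance of
  interest is the multiplicative monoid of A \<times> B, which yields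
  \<open>tensor_free_ring\<close>; a general monoid keeps the pairs out of sight.\<close>

lemma monoid_ring_cring:
  assumes "comm_monoid G"
  shows "cring (monoid_ring G)"
proof -
  interpret G: comm_monoid G by fact
  let ?F = "monoid_ring G"
  have closed: "c \<otimes>\<^bsub>?F\<^esub> d \<in> carrier ?F" if "c \<in> carrier ?F" "d \<in> carrier ?F" for c d
  proof -
    have "Poly_Mapping.keys (c \<otimes>\<^bsub>?F\<^esub> d)
        \<subseteq> (\<Union>p\<in>Poly_Mapping.keys c. \<Union>q\<in>Poly_Mapping.keys d. {p \<otimes>\<^bsub>G\<^esub> q})"
      unfolding monoid_ring_def
      by simp (rule order_trans[OF keys_frag_extend], rule UN_mono[OF order_refl],
          rule order_trans[OF keys_frag_extend], simp)
    also have "\<dots> \<subseteq> carrier G"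
      using that by (auto simp: monoid_ring_simps)
    finally show ?thesis by (simp add: monoid_ring_simps)
  qed
  have comm: "c \<otimes>\<^bsub>?F\<^esub> d = d \<otimes>\<^bsub>?F\<^esub> c" if "c \<in> carrier ?F" "d \<in> carrier ?F" for c d
  proof -
    have "frag_of p \<otimes>\<^bsub>?F\<^esub> d = d \<otimes>\<^bsub>?F\<^esub> frag_of p" if "p \<in> carrier G" for p
    proof -
      have "Poly_Mapping.keys d \<subseteq> carrier G" using \<open>d \<in> _\<close> by (simp add: monoid_ring_simps)
      then show ?thesis
        by (induction d rule: frag_induction) (use that in \<open>auto simp: monoid_ring_mult G.m_comm\<close>)
    qed
    moreover have "Poly_Mapping.keys c \<subseteq> carrier G" using that by (simp add: monoid_ring_simps)
    ultimately show ?thesis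
      by (rule_tac frag_induction[where c = c]) (simp_all add: monoid_ring_mult)
  qed
  have assoc: "(c \<otimes>\<^bsub>?F\<^esub> d) \<otimes>\<^bsub>?F\<^esub> e = c \<otimes>\<^bsub>?F\<^esub> (d \<otimes>\<^bsub>?F\<^esub> e)"
    if cde: "c \<in> carrier ?F" "d \<in> carrier ?F" "e \<in> carrier ?F" for c d e
  proof -
    have 1: "(frag_of p \<otimes>\<^bsub>?F\<^esub> frag_of q) \<otimes>\<^bsub>?F\<^esub> e = frag_of p \<otimes>\<^bsub>?F\<^esub> (frag_of q \<otimes>\<^bsub>?F\<^esub> e)"
      if "p \<in> carrier G" "q \<in> carrier G" for p q
    proof -
      have "Poly_Mapping.keys e \<subseteq> carrier G" using cde by (simp add: monoid_ring_simps)
      then show ?thesis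
        by (induction e rule: frag_induction) (use that in \<open>auto simp: monoid_ring_mult G.m_assoc\<close>)
    qed
    have 2: "(frag_of p \<otimes>\<^bsub>?F\<^esub> d) \<otimes>\<^bsub>?F\<^esub> e = frag_of p \<otimes>\<^bsub>?F\<^esub> (d \<otimes>\<^bsub>?F\<^esub> e)"
      if "p \<in> carrier G" for p
    proof -
      have "Poly_Mapping.keys d \<subseteq> carrier G" using cde by (simp add: monoid_ring_simps)
      then show ?thesis
      proof (induction d rule: frag_induction)
        case zero show ?case by (simp only: monoid_ring_mult)
      next
        case (one x) then show ?case using 1 that by blast
      next
        case (diff a b) then show ?case by (simp only: monoid_ring_mult)
      qed
    qed
    have "Poly_Mapping.keys c \<subseteq> carrier G" using cde by (simp add: monoid_ring_simps)
    then show ?thesis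
    proof (induction c rule: frag_induction)
      case zero show ?case by (simp only: monoid_ring_mult)
    next
      case (one x) then show ?case using 2 by blast
    next
      case (diff a b) then show ?case by (simp only: monoid_ring_mult)
    qed
  qed
  have one: "\<one>\<^bsub>?F\<^esub> \<otimes>\<^bsub>?F\<^esub> d = d" if "d \<in> carrier ?F" for d
  proof -
    have "Poly_Mapping.keys d \<subseteq> carrier G" using that by (simp add: monoid_ring_simps)
    then show ?thesis
      by (induction d rule: frag_induction) (auto simp: monoid_ring_mult monoid_ring_simps)
  qed
  show ?thesis
  proof (rule cringI)
    show "abelian_group ?F"
    proof (rule abelian_groupI)
      fix c assume "c \<in> carrier ?F"
      then show "\<exists>d\<in>carrier ?F. d \<oplus>\<^bsub>?F\<^esub> c = \<zero>\<^bsub>?F\<^esub>"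
        by (intro bexI[of _ "- c"]) (auto simp: monoid_ring_simps)
    qed (use keys_add in \<open>force simp: monoid_ring_simps\<close>)+
    show "comm_monoid ?F"
      by (rule comm_monoidI) (use closed comm assoc one in \<open>auto simp: monoid_ring_simps(1,2)\<close>)
  qed (auto simp: monoid_ring_simps monoid_ring_mult_add)
qed

section \<open>The universal property of the integral monoid ring\<close>

definition frag_lift :: "('c, 'x) ring_scheme \<Rightarrow> ('g \<Rightarrow> 'c) \<Rightarrow> ('g \<Rightarrow>\<^sub>0 int) \<Rightarrow> 'c" where
  "frag_lift C f c =
     (\<Oplus>\<^bsub>C\<^esub>p\<in>Poly_Mapping.keys c. [Poly_Mapping.lookup c p] \<cdot>\<^bsub>C\<^esub> f p)"

lemma add_pow_int_zero: "add_pow G (0::int) x = \<zero>\<^bsub>G\<^esub>"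
  by (simp add: add_pow_def)

context abelian_group begin

lemma frag_lift_zero: "frag_lift G f 0 = \<zero>"
  by (simp add: frag_lift_def)

lemma frag_lift_of: "f p \<in> carrier G \<Longrightarrow> frag_lift G f (frag_of p) = f p"
  by (simp add: frag_lift_def)

text \<open>The defining sum ranges over the support, which can shrink by cancellation in
  \<open>c + d\<close>. Over a common finite superset the sums can be compared term by term.\<close>

lemma frag_lift_superset:
  assumes "finite K" "Poly_Mapping.keys c \<subseteq> K" "f \<in> K \<rightarrow> carrier G"
  shows "frag_lift G f c = (\<Oplus>p\<in>K. add_pow G (Poly_Mapping.lookup c p) (f p))"
  unfolding frag_lift_def
  by (rule add.finprod_mono_neutral_cong_left)
    (use assms in \<open>auto simp: in_keys_iff add_pow_int_zero\<close>)

lemma frag_lift_closed: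
  assumes "Poly_Mapping.keys c \<subseteq> S" "f \<in> S \<rightarrow> carrier G"
  shows "frag_lift G f c \<in> carrier G"
  unfolding frag_lift_def
  by (rule finsum_closed) (use assms in \<open>blast intro: add.int_pow_closed\<close>)

lemma frag_lift_add:
  assumes "Poly_Mapping.keys c \<subseteq> S" "Poly_Mapping.keys d \<subseteq> S" "f \<in> S \<rightarrow> carrier G"
  shows "frag_lift G f (c + d) = frag_lift G f c \<oplus> frag_lift G f d"
proof -
  let ?K = "Poly_Mapping.keys c \<union> Poly_Mapping.keys d"
  have K: "finite ?K" "f \<in> ?K \<rightarrow> carrier G" using assms by auto
  have fc: "f p \<in> carrier G" if "p \<in> ?K" for p using K that by blast
  have "frag_lift G f (c + d) =
      (\<Oplus>p\<in>?K. add_pow G (Poly_Mapping.lookup c p) (f p) \<oplus> add_pow G (Poly_Mapping.lookup d p) (f p))"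
    unfolding frag_lift_superset[OF K(1) keys_add K(2)]
    by (rule add.finprod_cong') (auto simp: lookup_add fc add.int_pow_mult)
  also have "\<dots> = frag_lift G f c \<oplus> frag_lift G f d"
    unfolding frag_lift_superset[OF K(1) Un_upper1 K(2)] frag_lift_superset[OF K(1) Un_upper2 K(2)]
    by (rule add.finprod_multf) (blast intro: add.int_pow_closed fc)+
  finally show ?thesis .
qed

lemma frag_lift_diff:
  assumes "Poly_Mapping.keys c \<subseteq> S" "Poly_Mapping.keys d \<subseteq> S" "f \<in> S \<rightarrow> carrier G"
  shows "frag_lift G f (c - d) = frag_lift G f c \<ominus> frag_lift G f d"
proof -
  have "Poly_Mapping.keys (c - d) \<subseteq> S" using assms(1,2) keys_diff[of c d] by blast
  then have "frag_lift G f c = frag_lift G f (c - d) \<oplus> frag_lift G f d"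
    using frag_lift_add[of "c - d" S d f] assms(2,3) by simp
  moreover have "frag_lift G f (c - d) \<in> carrier G" "frag_lift G f d \<in> carrier G"
    using \<open>Poly_Mapping.keys (c - d) \<subseteq> S\<close> assms(2,3) by (auto intro: frag_lift_closed)
  ultimately show ?thesis
    by (simp add: minus_eq a_assoc r_neg)
qed

end

text \<open>Multiplicativity on basis elements spreads to all elements because both sides are
  biadditive: first the second factor is generalized, then the first.\<close>

lemma frag_lift_ring_hom:
  assumes G: "comm_monoid G" and C: "cring C" and f: "f \<in> hom G C" and f1: "f \<one>\<^bsub>G\<^esub> = \<one>\<^bsub>C\<^esub>"
  shows "frag_lift C f \<in> ring_hom (monoid_ring G) C"
proof -
  interpret G: comm_monoid G by fact
  interpret C: cring C by fact
  interpret F: cring "monoid_ring G" by (rule monoid_ring_cring[OF G])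
  have fc: "f \<in> carrier G \<rightarrow> carrier C" and fm: "\<And>p q. p \<in> carrier G \<Longrightarrow> q \<in> carrier G \<Longrightarrow> f (p \<otimes>\<^bsub>G\<^esub> q) = f p \<otimes>\<^bsub>C\<^esub> f q"
    using f by (auto simp: hom_def)
  note cl = C.frag_lift_closed[OF _ fc] and df = C.frag_lift_diff[OF _ _ fc]
  have mult_closed: "Poly_Mapping.keys (c \<otimes>\<^bsub>monoid_ring G\<^esub> d) \<subseteq> carrier G"
    if "Poly_Mapping.keys c \<subseteq> carrier G" "Poly_Mapping.keys d \<subseteq> carrier G" for c d
    using F.m_closed[of c d] that by (simp add: monoid_ring_simps)
  have ofcl: "Poly_Mapping.keys (frag_of p) \<subseteq> carrier G" if "p \<in> carrier G" for p :: 'a using that by simp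
  have 1: "frag_lift C f (frag_of p \<otimes>\<^bsub>monoid_ring G\<^esub> d) = f p \<otimes>\<^bsub>C\<^esub> frag_lift C f d"
    if p: "p \<in> carrier G" and d: "Poly_Mapping.keys d \<subseteq> carrier G" for p d
  proof -
    \<comment> \<open>The support condition belongs to the induction predicate, since the difference
      case of \<open>frag_induction\<close> provides nothing but the predicate for both parts, and
      \<open>df\<close> needs their supports.\<close>
    have "Poly_Mapping.keys d \<subseteq> carrier G \<and>
       frag_lift C f (frag_of p \<otimes>\<^bsub>monoid_ring G\<^esub> d) = f p \<otimes>\<^bsub>C\<^esub> frag_lift C f d"
      using d
    proof (induction d rule: frag_induction)
      case zero
      then show ?case using fc p by (simp add: monoid_ring_mult C.frag_lift_zero Pi_iff)
    next
      case (one q)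
      then show ?case using fc p fm[OF p one] by (auto simp: monoid_ring_mult C.frag_lift_of Pi_iff)
    next
      case (diff a b)
      then have ab: "Poly_Mapping.keys a \<subseteq> carrier G" "Poly_Mapping.keys b \<subseteq> carrier G"
        by simp_all
      have "Poly_Mapping.keys (a - b) \<subseteq> carrier G" using ab keys_diff[of a b] by blast
      moreover have "frag_lift C f (frag_of p \<otimes>\<^bsub>monoid_ring G\<^esub> (a - b))
          = f p \<otimes>\<^bsub>C\<^esub> frag_lift C f (a - b)"
      proof -
        have "frag_lift C f (frag_of p \<otimes>\<^bsub>monoid_ring G\<^esub> (a - b))
            = f p \<otimes>\<^bsub>C\<^esub> frag_lift C f a \<ominus>\<^bsub>C\<^esub> f p \<otimes>\<^bsub>C\<^esub> frag_lift C f b"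
          unfolding monoid_ring_mult_diff(2)
          using diff df[OF mult_closed[OF ofcl[OF p] ab(1)] mult_closed[OF ofcl[OF p] ab(2)]] by metis
        also have "\<dots> = f p \<otimes>\<^bsub>C\<^esub> (frag_lift C f a \<ominus>\<^bsub>C\<^esub> frag_lift C f b)"
          using cl[OF ab(1)] cl[OF ab(2)] fc p by (simp add: Pi_iff C.minus_eq C.r_distr C.r_minus)
        finally show ?thesis unfolding df[OF ab] .
      qed
      ultimately show ?case ..
    qed
    then show ?thesis ..
  qed
  have 2: "frag_lift C f (c \<otimes>\<^bsub>monoid_ring G\<^esub> d) = frag_lift C f c \<otimes>\<^bsub>C\<^esub> frag_lift C f d"
    if d: "Poly_Mapping.keys d \<subseteq> carrier G" and c: "Poly_Mapping.keys c \<subseteq> carrier G" for c d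
  proof -
    have "Poly_Mapping.keys c \<subseteq> carrier G \<and>
       frag_lift C f (c \<otimes>\<^bsub>monoid_ring G\<^esub> d) = frag_lift C f c \<otimes>\<^bsub>C\<^esub> frag_lift C f d"
      using c
    proof (induction c rule: frag_induction)
      case zero
      then show ?case using cl[OF d] by (auto simp: monoid_ring_mult C.frag_lift_zero)
    next
      case (one q)
      then show ?case using fc 1[OF one d] by (auto simp: C.frag_lift_of Pi_iff)
    next
      case (diff a b)
      then have ab: "Poly_Mapping.keys a \<subseteq> carrier G" "Poly_Mapping.keys b \<subseteq> carrier G"
        by simp_all
      have "Poly_Mapping.keys (a - b) \<subseteq> carrier G" using ab keys_diff[of a b] by blast
      moreover have "frag_lift C f ((a - b) \<otimes>\<^bsub>monoid_ring G\<^esub> d)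
          = frag_lift C f (a - b) \<otimes>\<^bsub>C\<^esub> frag_lift C f d"
      proof -
        have "frag_lift C f ((a - b) \<otimes>\<^bsub>monoid_ring G\<^esub> d)
            = frag_lift C f a \<otimes>\<^bsub>C\<^esub> frag_lift C f d \<ominus>\<^bsub>C\<^esub> frag_lift C f b \<otimes>\<^bsub>C\<^esub> frag_lift C f d"
          unfolding monoid_ring_mult_diff(1)
          using diff df[OF mult_closed[OF ab(1) d] mult_closed[OF ab(2) d]] by metis
        also have "\<dots> = (frag_lift C f a \<ominus>\<^bsub>C\<^esub> frag_lift C f b) \<otimes>\<^bsub>C\<^esub> frag_lift C f d"
          using cl[OF ab(1)] cl[OF ab(2)] cl[OF d] by (simp add: C.minus_eq C.l_distr C.l_minus)
        finally show ?thesis unfolding df[OF ab] .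
      qed
      ultimately show ?case ..
    qed
    then show ?thesis ..
  qed
  show ?thesis
  proof (rule ring_hom_memI)
    have "f \<one>\<^bsub>G\<^esub> \<in> carrier C" using fc by blast
    then show "frag_lift C f \<one>\<^bsub>monoid_ring G\<^esub> = \<one>\<^bsub>C\<^esub>"
      by (simp add: monoid_ring_simps C.frag_lift_of f1)
  qed (simp_all add: monoid_ring_simps(1,4) cl 2 C.frag_lift_add[OF _ _ fc])
qed

section \<open>Homomorphisms out of quotient rings\<close>

lemma carrier_Quot: "carrier (R Quot I) = (\<lambda>x. I +>\<^bsub>R\<^esub> x) ` carrier R"
  by (auto simp: FactRing_def A_RCOSETS_def')

text \<open>A homomorphism that kills I is constant on each coset, so the image of a coset is a
  singleton and \<open>the_elem\<close> reads off the value. This is the form in which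
  \<open>tensor_mult_map\<close> is defined.\<close>

lemma
  assumes h: "ring_hom_ring R S h" and I: "ideal I R" and ker: "\<And>x. x \<in> I \<Longrightarrow> h x = \<zero>\<^bsub>S\<^esub>"
  shows Quot_lift_coset: "x \<in> carrier R \<Longrightarrow> the_elem (h ` (I +>\<^bsub>R\<^esub> x)) = h x"
    and Quot_lift_hom: "(\<lambda>X. the_elem (h ` X)) \<in> ring_hom (R Quot I) S"
proof -
  interpret h: ring_hom_ring R S h by fact
  interpret I: ideal I R by fact
  have img: "h ` (I +>\<^bsub>R\<^esub> x) = {h x}" if "x \<in> carrier R" for x
  proof -
    have "h y = h x" if "y \<in> I +>\<^bsub>R\<^esub> x" for y
      using that \<open>x \<in> carrier R\<close> by (auto simp: a_r_coset_def' ker I.Icarr)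
    moreover have "x \<in> I +>\<^bsub>R\<^esub> x" using that by (rule I.a_rcos_self)
    ultimately show ?thesis by blast
  qed
  then show coset: "the_elem (h ` (I +>\<^bsub>R\<^esub> x)) = h x" if "x \<in> carrier R" for x
    using that by simp
  have q: "(\<lambda>x. I +>\<^bsub>R\<^esub> x) \<in> ring_hom R (R Quot I)" by (rule I.rcos_ring_hom)
  show "(\<lambda>X. the_elem (h ` X)) \<in> ring_hom (R Quot I) S"
    by (rule ring_hom_memI)
      (auto simp: carrier_Quot coset simp flip: ring_hom_mult[OF q] ring_hom_add[OF q] ring_hom_one[OF q])
qed

section \<open>The tensor product of two algebras and its universal property\<close>

definition tensor_ideal ::
  "('r, 'z) ring_scheme \<Rightarrow> ('r, 'a, 'x) module_scheme \<Rightarrow> ('r, 'b, 'y) module_scheme \<Rightarrow> ('a \<times> 'b \<Rightarrow>\<^sub>0 int) set" where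
  "tensor_ideal R A B = genideal (tensor_free_ring A B) (tensor_relations R A B)"

definition tensor ::
  "('r, 'z) ring_scheme \<Rightarrow> ('r, 'a, 'x) module_scheme \<Rightarrow> ('r, 'b, 'y) module_scheme
     \<Rightarrow> 'a \<Rightarrow> 'b \<Rightarrow> ('a \<times> 'b \<Rightarrow>\<^sub>0 int) set" where
  "tensor R A B a b = tensor_ideal R A B +>\<^bsub>tensor_free_ring A B\<^esub> frag_of (a, b)"

lemma tensor_free_ring_eq: "tensor_free_ring A B = monoid_ring (A \<times>\<times> B)"
  by (simp add: tensor_free_ring_def monoid_ring_def DirProd_def case_prod_beta')

lemma comm_monoid_DirProd:
  assumes "comm_monoid G" "comm_monoid H"
  shows "comm_monoid (G \<times>\<times> H)"
proof -
  interpret G: comm_monoid G by fact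
  interpret H: comm_monoid H by fact
  show ?thesis
    by (rule comm_monoidI) (auto simp: G.m_ac H.m_ac)
qed

locale tensor_algebras = A: algebra R A + B: algebra R B for R (structure) and A and B
begin

abbreviation F where "F \<equiv> tensor_free_ring A B"
abbreviation T where "T \<equiv> tensor_ring R A B"
abbreviation tens (infixl "\<otimes>\<^sub>t" 75) where "a \<otimes>\<^sub>t b \<equiv> tensor R A B a b"

lemma comm_monoid_AB: "comm_monoid (A \<times>\<times> B)"
  by (rule comm_monoid_DirProd) (rule A.comm_monoid_axioms B.comm_monoid_axioms)+

sublocale F: cring F
  unfolding tensor_free_ring_eq by (rule monoid_ring_cring[OF comm_monoid_AB])

lemma F_simps:
  "carrier F = {c. Poly_Mapping.keys c \<subseteq> carrier A \<times> carrier B}"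
  "\<zero>\<^bsub>F\<^esub> = 0" "c \<oplus>\<^bsub>F\<^esub> d = c + d"
  by (simp_all add: tensor_free_ring_def)

text \<open>The relations are written with the subtraction of finitely supported functions, whereas
  ideals speak of the ring subtraction of \<open>F\<close>; the two must be identified before the
  relations can be used in the quotient.\<close>

lemma F_uminus: "c \<in> carrier F \<Longrightarrow> \<ominus>\<^bsub>F\<^esub> c = - c"
  by (rule F.minus_equality) (auto simp: F_simps)

lemma F_minus: "c \<in> carrier F \<Longrightarrow> d \<in> carrier F \<Longrightarrow> c \<ominus>\<^bsub>F\<^esub> d = c - d"
  by (simp add: a_minus_def F_uminus F_simps(3))

lemma frag_of_mem_F: "a \<in> carrier A \<Longrightarrow> b \<in> carrier B \<Longrightarrow> frag_of (a, b) \<in> carrier F"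
  by (simp add: F_simps)

lemma tensor_relations_subset: "tensor_relations R A B \<subseteq> carrier F"
proof -
  have diff: "c - d \<in> carrier F" if "c \<in> carrier F" "d \<in> carrier F" for c d
    using F.minus_closed[OF that] F_minus[OF that] by simp
  show ?thesis
    unfolding tensor_relations_def
    by (auto intro!: diff simp: frag_of_mem_F simp del: mem_Collect_eq simp: F_simps(1)[symmetric])
qed

lemma tensor_ideal: "ideal (tensor_ideal R A B) F"
  unfolding tensor_ideal_def by (rule F.genideal_ideal[OF tensor_relations_subset])

sublocale J: ideal "tensor_ideal R A B" F
  by (rule tensor_ideal)

lemma T_eq: "T = F Quot tensor_ideal R A B"
  by (simp add: tensor_ring_def tensor_ideal_def)

sublocale T: cring T
  unfolding T_eq by (rule J.quotient_is_cring) (rule F.cring_axioms)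

lemma quot_hom: "(\<lambda>c. tensor_ideal R A B +>\<^bsub>F\<^esub> c) \<in> ring_hom F T"
  unfolding T_eq by (rule J.rcos_ring_hom)

lemma tens_closed [simp, intro]: "a \<in> carrier A \<Longrightarrow> b \<in> carrier B \<Longrightarrow> a \<otimes>\<^sub>t b \<in> carrier T"
  unfolding tensor_def by (rule ring_hom_closed[OF quot_hom]) (rule frag_of_mem_F)

lemma tens_mult:
  assumes "a \<in> carrier A" "b \<in> carrier B" "a' \<in> carrier A" "b' \<in> carrier B"
  shows "(a \<otimes>\<^sub>t b) \<otimes>\<^bsub>T\<^esub> (a' \<otimes>\<^sub>t b') = (a \<otimes>\<^bsub>A\<^esub> a') \<otimes>\<^sub>t (b \<otimes>\<^bsub>B\<^esub> b')"
proof -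
  have "frag_of (a, b) \<otimes>\<^bsub>F\<^esub> frag_of (a', b') = frag_of (a \<otimes>\<^bsub>A\<^esub> a', b \<otimes>\<^bsub>B\<^esub> b')"
    by (simp add: tensor_free_ring_def)
  then show ?thesis
    unfolding tensor_def using ring_hom_mult[OF quot_hom] frag_of_mem_F assms by metis
qed

lemma tens_one: "\<one>\<^bsub>A\<^esub> \<otimes>\<^sub>t \<one>\<^bsub>B\<^esub> = \<one>\<^bsub>T\<^esub>"
  unfolding tensor_def ring_hom_one[OF quot_hom, symmetric] by (simp add: tensor_free_ring_def)

lemma coset_eqI:
  assumes "c \<in> carrier F" "d \<in> carrier F" "c - d \<in> tensor_relations R A B"
  shows "tensor_ideal R A B +>\<^bsub>F\<^esub> c = tensor_ideal R A B +>\<^bsub>F\<^esub> d"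
proof -
  have "c \<ominus>\<^bsub>F\<^esub> d \<in> tensor_ideal R A B"
    using assms F.genideal_self[OF tensor_relations_subset]
    by (auto simp: F_minus tensor_ideal_def)
  then show ?thesis
    using F.quotient_eq_iff_same_a_r_cos[OF tensor_ideal assms(1,2)] by simp
qed

lemma tens_add_left:
  assumes "a \<in> carrier A" "a' \<in> carrier A" "b \<in> carrier B"
  shows "(a \<oplus>\<^bsub>A\<^esub> a') \<otimes>\<^sub>t b = (a \<otimes>\<^sub>t b) \<oplus>\<^bsub>T\<^esub> (a' \<otimes>\<^sub>t b)"
proof -
  have "tensor_ideal R A B +>\<^bsub>F\<^esub> frag_of (a \<oplus>\<^bsub>A\<^esub> a', b)
      = tensor_ideal R A B +>\<^bsub>F\<^esub> (frag_of (a, b) \<oplus>\<^bsub>F\<^esub> frag_of (a', b))"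
    by (rule coset_eqI)
      (use assms in \<open>auto simp: frag_of_mem_F F_simps(3) tensor_relations_def algebra_simps
        simp flip: F_simps(3)\<close>, auto simp: F_simps(3) algebra_simps)
  then show ?thesis
    unfolding tensor_def using ring_hom_add[OF quot_hom] frag_of_mem_F assms by metis
qed

lemma tens_add_right:
  assumes "a \<in> carrier A" "b \<in> carrier B" "b' \<in> carrier B"
  shows "a \<otimes>\<^sub>t (b \<oplus>\<^bsub>B\<^esub> b') = (a \<otimes>\<^sub>t b) \<oplus>\<^bsub>T\<^esub> (a \<otimes>\<^sub>t b')"
proof -
  have "tensor_ideal R A B +>\<^bsub>F\<^esub> frag_of (a, b \<oplus>\<^bsub>B\<^esub> b')
      = tensor_ideal R A B +>\<^bsub>F\<^esub> (frag_of (a, b) \<oplus>\<^bsub>F\<^esub> frag_of (a, b'))"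
    by (rule coset_eqI)
      (use assms in \<open>auto simp: frag_of_mem_F F_simps(3) tensor_relations_def algebra_simps
        simp flip: F_simps(3)\<close>, auto simp: F_simps(3) algebra_simps)
  then show ?thesis
    unfolding tensor_def using ring_hom_add[OF quot_hom] frag_of_mem_F assms by metis
qed

lemma tens_smult:
  assumes "r \<in> carrier R" "a \<in> carrier A" "b \<in> carrier B"
  shows "(r \<odot>\<^bsub>A\<^esub> a) \<otimes>\<^sub>t b = a \<otimes>\<^sub>t (r \<odot>\<^bsub>B\<^esub> b)"
  unfolding tensor_def
  by (rule coset_eqI) (use assms in \<open>auto simp: frag_of_mem_F tensor_relations_def\<close>)

text \<open>Pure tensors generate the additive group of \<open>T\<close>, being the images of the
  basis elements of \<open>F\<close>.\<close>

lemma tensor_ring_induct [consumes 1, case_names tens diff]: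
  assumes z: "z \<in> carrier T"
    and tens: "\<And>a b. a \<in> carrier A \<Longrightarrow> b \<in> carrier B \<Longrightarrow> P (a \<otimes>\<^sub>t b)"
    and diff: "\<And>x y. x \<in> carrier T \<Longrightarrow> y \<in> carrier T \<Longrightarrow> P x \<Longrightarrow> P y \<Longrightarrow> P (x \<ominus>\<^bsub>T\<^esub> y)"
  shows "P z"
proof -
  let ?q = "\<lambda>c. tensor_ideal R A B +>\<^bsub>F\<^esub> c"
  interpret q: ring_hom_ring F T ?q
    unfolding T_eq by (rule J.rcos_ring_hom_ring)
  obtain c where c: "z = ?q c" "c \<in> carrier F"
    using z by (auto simp: T_eq carrier_Quot)
  have "c \<in> carrier F \<and> P (?q c)"
    using c(2)[unfolded F_simps, simplified]
  proof (induction c rule: frag_induction)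
    case zero
    \<comment> \<open>Zero is the difference of a pure tensor with itself, so the rule needs no case
      for it.\<close>
    have "P ((\<one>\<^bsub>A\<^esub> \<otimes>\<^sub>t \<one>\<^bsub>B\<^esub>) \<ominus>\<^bsub>T\<^esub> (\<one>\<^bsub>A\<^esub> \<otimes>\<^sub>t \<one>\<^bsub>B\<^esub>))"
      by (rule diff) (simp_all add: tens)
    then have "P \<zero>\<^bsub>T\<^esub>" by (simp add: a_minus_def T.r_neg)
    then show ?case using q.hom_zero F.zero_closed by (simp add: F_simps(2))
  next
    case (one p)
    then show ?case using tens by (cases p) (auto simp: tensor_def[symmetric] frag_of_mem_F)
  next
    case (diff c d)
    then have "?q (c \<ominus>\<^bsub>F\<^esub> d) = ?q c \<ominus>\<^bsub>T\<^esub> ?q d" "c \<ominus>\<^bsub>F\<^esub> d \<in> carrier F"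
      by (simp_all add: a_minus_def)
    then show ?case using diff assms(3)[of "?q c" "?q d"] by (simp add: F_minus)
  qed
  then show ?thesis using c by simp
qed

definition tensor_lift where
  "tensor_lift C \<alpha> \<beta> z =
     the_elem (frag_lift C (\<lambda>p. \<alpha> (fst p) \<otimes>\<^bsub>C\<^esub> \<beta> (snd p)) ` z)"

text \<open>The pair of maps is multiplicative on A \<times> B, hence extends to \<open>F\<close>.
  Bilinearity relations die because \<alpha> and \<beta> are additive, the third kind because of
  \<open>balanced\<close>. The target is a bare ring without an action of R, so
  \<open>balanced\<close> takes the place of R-linearity of the two maps.\<close>

lemma
  assumes C: "cring C" and \<alpha>: "\<alpha> \<in> ring_hom A C" and \<beta>: "\<beta> \<in> ring_hom B C"
    and balanced: "\<And>r a b. r \<in> carrier R \<Longrightarrow> a \<in> carrier A \<Longrightarrow> b \<in> carrier B \<Longrightarrow>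
      \<alpha> (r \<odot>\<^bsub>A\<^esub> a) \<otimes>\<^bsub>C\<^esub> \<beta> b = \<alpha> a \<otimes>\<^bsub>C\<^esub> \<beta> (r \<odot>\<^bsub>B\<^esub> b)"
  shows tensor_lift_hom: "tensor_lift C \<alpha> \<beta> \<in> ring_hom T C"
    and tensor_lift_tens: "a \<in> carrier A \<Longrightarrow> b \<in> carrier B \<Longrightarrow>
      tensor_lift C \<alpha> \<beta> (a \<otimes>\<^sub>t b) = \<alpha> a \<otimes>\<^bsub>C\<^esub> \<beta> b"
proof -
  interpret C: cring C by fact
  let ?f = "\<lambda>p. \<alpha> (fst p) \<otimes>\<^bsub>C\<^esub> \<beta> (snd p)"
  let ?h = "frag_lift C ?f"
  have ac: "\<alpha> a \<in> carrier C" if "a \<in> carrier A" for a using ring_hom_closed[OF \<alpha> that] .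
  have bc: "\<beta> b \<in> carrier C" if "b \<in> carrier B" for b using ring_hom_closed[OF \<beta> that] .
  have f: "?f \<in> hom (A \<times>\<times> B) C"
    by (auto simp: hom_def ac bc ring_hom_mult[OF \<alpha>] ring_hom_mult[OF \<beta>] C.m_ac)
  have "?h \<in> ring_hom F C"
    unfolding tensor_free_ring_eq
    by (rule frag_lift_ring_hom[OF comm_monoid_AB C f])
      (simp add: ring_hom_one[OF \<alpha>] ring_hom_one[OF \<beta>])
  then interpret h: ring_hom_ring F C ?h
    by (rule ring_hom_ringI2[OF F.ring_axioms C.ring_axioms])
  have of: "?h (frag_of (a, b)) = \<alpha> a \<otimes>\<^bsub>C\<^esub> \<beta> b" if "a \<in> carrier A" "b \<in> carrier B" for a b
    using C.frag_lift_of[of ?f "(a, b)"] that ac bc by simp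
  have hdiff: "?h (c - d) = ?h c \<ominus>\<^bsub>C\<^esub> ?h d" if "c \<in> carrier F" "d \<in> carrier F" for c d
    using that by (simp add: F_minus[symmetric] a_minus_def)
  have Fdiff: "c - d \<in> carrier F" if "c \<in> carrier F" "d \<in> carrier F" for c d
    using F.minus_closed[OF that] F_minus[OF that] by simp
  have C0: "(x \<oplus>\<^bsub>C\<^esub> y) \<ominus>\<^bsub>C\<^esub> x \<ominus>\<^bsub>C\<^esub> y = \<zero>\<^bsub>C\<^esub>" if "x \<in> carrier C" "y \<in> carrier C" for x y
    using that by algebra
  have C00: "x \<ominus>\<^bsub>C\<^esub> x = \<zero>\<^bsub>C\<^esub>" if "x \<in> carrier C" for x
    using that by algebra
  have rel3: "?h (frag_of p - frag_of q - frag_of r) = ?h (frag_of p) \<ominus>\<^bsub>C\<^esub> ?h (frag_of q) \<ominus>\<^bsub>C\<^esub> ?h (frag_of r)"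
    if "p \<in> carrier A \<times> carrier B" "q \<in> carrier A \<times> carrier B" "r \<in> carrier A \<times> carrier B" for p q r
  proof -
    have "frag_of p \<in> carrier F" "frag_of q \<in> carrier F" "frag_of r \<in> carrier F"
      using that by (simp_all add: F_simps)
    note pqr = this
    show ?thesis
      unfolding hdiff[OF Fdiff[OF pqr(1,2)] pqr(3)] hdiff[OF pqr(1,2)] by (rule refl)
  qed
  have "?h c = \<zero>\<^bsub>C\<^esub>" if c: "c \<in> tensor_relations R A B" for c
  proof -
    from c consider
      (add_left) a a' b where "a \<in> carrier A" "a' \<in> carrier A" "b \<in> carrier B"
        "c = frag_of (a \<oplus>\<^bsub>A\<^esub> a', b) - frag_of (a, b) - frag_of (a', b)"
    | (add_right) a b b' where "a \<in> carrier A" "b \<in> carrier B" "b' \<in> carrier B"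
        "c = frag_of (a, b \<oplus>\<^bsub>B\<^esub> b') - frag_of (a, b) - frag_of (a, b')"
    | (smult) r a b where "r \<in> carrier R" "a \<in> carrier A" "b \<in> carrier B"
        "c = frag_of (r \<odot>\<^bsub>A\<^esub> a, b) - frag_of (a, r \<odot>\<^bsub>B\<^esub> b)"
      unfolding tensor_relations_def by (elim UnE CollectE exE conjE) (rule that, assumption+)+
    then show ?thesis
    proof cases
      case add_left
      then have "?h c = (\<alpha> a \<oplus>\<^bsub>C\<^esub> \<alpha> a') \<otimes>\<^bsub>C\<^esub> \<beta> b \<ominus>\<^bsub>C\<^esub> \<alpha> a \<otimes>\<^bsub>C\<^esub> \<beta> b \<ominus>\<^bsub>C\<^esub> \<alpha> a' \<otimes>\<^bsub>C\<^esub> \<beta> b"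
        by (simp add: rel3 of ring_hom_add[OF \<alpha>])
      then show ?thesis using add_left ac bc C0 by (simp add: C.l_distr)
    next
      case add_right
      then have "?h c = \<alpha> a \<otimes>\<^bsub>C\<^esub> (\<beta> b \<oplus>\<^bsub>C\<^esub> \<beta> b') \<ominus>\<^bsub>C\<^esub> \<alpha> a \<otimes>\<^bsub>C\<^esub> \<beta> b \<ominus>\<^bsub>C\<^esub> \<alpha> a \<otimes>\<^bsub>C\<^esub> \<beta> b'"
        by (simp add: rel3 of ring_hom_add[OF \<beta>])
      then show ?thesis using add_right ac bc C0 by (simp add: C.r_distr)
    next
      case smult
      then have "?h c = \<alpha> (r \<odot>\<^bsub>A\<^esub> a) \<otimes>\<^bsub>C\<^esub> \<beta> b \<ominus>\<^bsub>C\<^esub> \<alpha> a \<otimes>\<^bsub>C\<^esub> \<beta> (r \<odot>\<^bsub>B\<^esub> b)"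
        by (simp add: hdiff frag_of_mem_F of)
      then show ?thesis using smult ac bc C00 by (simp add: balanced)
    qed
  qed
  then have "tensor_relations R A B \<subseteq> a_kernel F C ?h"
    unfolding a_kernel_def' using tensor_relations_subset by blast
  then have "tensor_ideal R A B \<subseteq> a_kernel F C ?h"
    unfolding tensor_ideal_def by (rule F.genideal_minimal[OF h.kernel_is_ideal])
  then have ker: "?h c = \<zero>\<^bsub>C\<^esub>" if "c \<in> tensor_ideal R A B" for c
    using that unfolding a_kernel_def' by blast
  show "tensor_lift C \<alpha> \<beta> \<in> ring_hom T C"
    unfolding T_eq tensor_lift_def[abs_def]
    by (rule Quot_lift_hom[OF h.ring_hom_ring_axioms tensor_ideal ker])
  show "tensor_lift C \<alpha> \<beta> (a \<otimes>\<^sub>t b) = \<alpha> a \<otimes>\<^bsub>C\<^esub> \<beta> b" if "a \<in> carrier A" "b \<in> carrier B"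
    unfolding tensor_lift_def tensor_def
    by (subst Quot_lift_coset[OF h.ring_hom_ring_axioms tensor_ideal ker])
      (simp_all add: frag_of_mem_F of that)
qed

end


section \<open>Separability idempotents\<close>

lemma free_module_simps:
  "carrier (free_module R S) = {f \<in> S \<rightarrow>\<^sub>E carrier R. finite {s \<in> S. f s \<noteq> \<zero>\<^bsub>R\<^esub>}}"
  "f \<oplus>\<^bsub>free_module R S\<^esub> g = (\<lambda>s\<in>S. f s \<oplus>\<^bsub>R\<^esub> g s)"
  "r \<odot>\<^bsub>free_module R S\<^esub> f = (\<lambda>s\<in>S. r \<otimes>\<^bsub>R\<^esub> f s)"
  by (simp_all add: free_module_def)

lemma enveloping_module_simps:
  "carrier (enveloping_module A) = carrier A"
  "a \<oplus>\<^bsub>enveloping_module A\<^esub> b = a \<oplus>\<^bsub>A\<^esub> b"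
  "c \<odot>\<^bsub>enveloping_module A\<^esub> a = tensor_mult_map A c \<otimes>\<^bsub>A\<^esub> a"
  by (simp_all add: enveloping_module_def)

locale tensor_square = tensor_algebras R A A for R (structure) and A
begin

notation tens (infixl "\<otimes>\<^sub>t" 75)

abbreviation \<mu> where "\<mu> \<equiv> tensor_mult_map A"

text \<open>The sum in \<open>frag_lift\<close> was written to agree with the one inside
  \<open>tensor_mult_map\<close>. The multiplication thereby becomes the lift of two identity maps
  and inherits everything from the universal property.\<close>

lemma tensor_mult_map_eq: "\<mu> = tensor_lift A (\<lambda>x. x) (\<lambda>x. x)"
  by (rule ext) (simp add: tensor_mult_map_def tensor_lift_def frag_lift_def[abs_def])

lemma smult_balanced: "\<lbrakk>r \<in> carrier R; a \<in> carrier A; b \<in> carrier A\<rbrakk> \<Longrightarrow>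
    (r \<odot>\<^bsub>A\<^esub> a) \<otimes>\<^bsub>A\<^esub> b = a \<otimes>\<^bsub>A\<^esub> (r \<odot>\<^bsub>A\<^esub> b)"
  using A.smult_assoc2[of r a b] A.smult_assoc2[of r b a]
  by (simp add: A.m_comm)

lemma mu_hom: "\<mu> \<in> ring_hom T A"
  unfolding tensor_mult_map_eq
  by (rule tensor_lift_hom) (auto simp: A.M_cring ring_hom_def smult_balanced)

lemma mu_tens [simp]: "a \<in> carrier A \<Longrightarrow> b \<in> carrier A \<Longrightarrow> \<mu> (a \<otimes>\<^sub>t b) = a \<otimes>\<^bsub>A\<^esub> b"
  unfolding tensor_mult_map_eq
  by (rule tensor_lift_tens) (auto simp: A.M_cring ring_hom_def smult_balanced)

sublocale mu: ring_hom_cring T A \<mu>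
  by (rule ring_hom_cring.intro[OF T.is_cring A.M_cring]) (simp add: ring_hom_cring_axioms_def mu_hom)

lemma module_enveloping: "module T (enveloping_module A)"
proof (rule moduleI)
  show "abelian_group (enveloping_module A)"
    by (rule abelian_groupI)
      (auto simp: enveloping_module_def A.a_ac intro: A.l_neg A.a_inv_closed)
qed (auto simp: enveloping_module_simps T.is_cring A.l_distr A.r_distr A.m_assoc
      A.M_cring enveloping_module_def mu.hom_closed)

text \<open>A is the quotient of \<open>T\<close> by the kernel of \<mu>, and a T-linear section of
  \<mu> is determined by the image e of \<one>; linearity means that the kernel of \<mu> annihilates
  e. The kernel is generated by the elements a \<otimes> 1 - 1 \<otimes> a, which gives the
  commutation condition.\<close>

theorem separable_iff_idempotent:
  "separable_algebra R A \<longleftrightarrow>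
    (\<exists>e\<in>carrier T. \<mu> e = \<one>\<^bsub>A\<^esub> \<and> (\<forall>a\<in>carrier A. (a \<otimes>\<^sub>t \<one>\<^bsub>A\<^esub>) \<otimes>\<^bsub>T\<^esub> e = (\<one>\<^bsub>A\<^esub> \<otimes>\<^sub>t a) \<otimes>\<^bsub>T\<^esub> e))"
    (is "_ \<longleftrightarrow> (\<exists>e\<in>_. ?P e)")
proof
  let ?E = "enveloping_module A" and ?Fr = "free_module T (carrier A)"
  assume "separable_algebra R A"
  then obtain i p where i: "i \<in> module_maps T ?E ?Fr" and p: "p \<in> module_maps T ?Fr ?E"
    and pi: "\<And>m. m \<in> carrier A \<Longrightarrow> p (i m) = m"
    unfolding separable_algebra_def projective_module_def
    by (auto simp: enveloping_module_simps)
  \<comment> \<open>The annihilator of the kernel of the multiplication. Its image under the multiplication is an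
    ideal containing \<open>p f\<close> for every \<open>f\<close> with coordinates in \<open>\<aa>\<close>, and \<open>i \<one>\<close> is such an \<open>f\<close>.\<close>
  define \<aa> where "\<aa> = {c \<in> carrier T. \<forall>z\<in>carrier T. \<mu> z = \<zero>\<^bsub>A\<^esub> \<longrightarrow> z \<otimes>\<^bsub>T\<^esub> c = \<zero>\<^bsub>T\<^esub>}"
  have p_add: "p (f \<oplus>\<^bsub>?Fr\<^esub> g) = p f \<oplus>\<^bsub>A\<^esub> p g" if "f \<in> carrier ?Fr" "g \<in> carrier ?Fr" for f g
    using p that by (simp add: module_maps_def enveloping_module_simps)
  have p_smult: "p (r \<odot>\<^bsub>?Fr\<^esub> f) = \<mu> r \<otimes>\<^bsub>A\<^esub> p f" if "r \<in> carrier T" "f \<in> carrier ?Fr" for r f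
    using p that by (simp add: module_maps_def enveloping_module_simps)
  have p_closed: "p f \<in> carrier A" if "f \<in> carrier ?Fr" for f
    using p that by (auto simp: module_maps_def enveloping_module_simps)
  have i_smult: "i (r \<odot>\<^bsub>?E\<^esub> x) = r \<odot>\<^bsub>?Fr\<^esub> i x" if "r \<in> carrier T" "x \<in> carrier A" for r x
    using i that by (simp add: module_maps_def enveloping_module_simps(1))
  have i1: "i \<one>\<^bsub>A\<^esub> \<in> carrier ?Fr"
    using i by (auto simp: module_maps_def enveloping_module_simps(1))
  have i1_closed: "i \<one>\<^bsub>A\<^esub> s \<in> carrier T" if "s \<in> carrier A" for s
    using i1 that unfolding free_module_simps by blast
  have i1_aa: "i \<one>\<^bsub>A\<^esub> s \<in> \<aa>" if s: "s \<in> carrier A" for s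
  proof -
    have "z \<otimes>\<^bsub>T\<^esub> i \<one>\<^bsub>A\<^esub> s = \<zero>\<^bsub>T\<^esub>" if z: "z \<in> carrier T" "\<mu> z = \<zero>\<^bsub>A\<^esub>" for z
    proof -
      \<comment> \<open>An element of the kernel of \<mu> acts on A as zero does, so it must
        annihilate \<open>i \<one>\<close> coordinate by coordinate.\<close>
      have "z \<odot>\<^bsub>?Fr\<^esub> i \<one>\<^bsub>A\<^esub> = i (z \<odot>\<^bsub>?E\<^esub> \<one>\<^bsub>A\<^esub>)" using i_smult z by simp
      also have "\<dots> = i (\<zero>\<^bsub>T\<^esub> \<odot>\<^bsub>?E\<^esub> \<one>\<^bsub>A\<^esub>)" using z by (simp add: enveloping_module_simps)
      also have "\<dots> = \<zero>\<^bsub>T\<^esub> \<odot>\<^bsub>?Fr\<^esub> i \<one>\<^bsub>A\<^esub>" using i_smult by simp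
      finally have "(z \<odot>\<^bsub>?Fr\<^esub> i \<one>\<^bsub>A\<^esub>) s = (\<zero>\<^bsub>T\<^esub> \<odot>\<^bsub>?Fr\<^esub> i \<one>\<^bsub>A\<^esub>) s"
        by (rule fun_cong)
      then have "z \<otimes>\<^bsub>T\<^esub> i \<one>\<^bsub>A\<^esub> s = \<zero>\<^bsub>T\<^esub> \<otimes>\<^bsub>T\<^esub> i \<one>\<^bsub>A\<^esub> s"
        using s unfolding free_module_simps restrict_apply by (simp only: if_True)
      then show ?thesis using i1_closed[OF s] by simp
    qed
    then show ?thesis using i1_closed[OF s] by (simp add: \<aa>_def)
  qed
  \<comment> \<open>The set \<open>K\<close> only bounds the support of \<open>g\<close>. Removing
    the coordinate at s writes \<open>g\<close> as a multiple of the basis vector \<delta> at s plus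
    a vector supported in the smaller set.\<close>
  have image: "\<exists>e\<in>\<aa>. \<mu> e = p g"
    if "finite K" "g \<in> carrier ?Fr" "\<And>s. s \<in> carrier A \<Longrightarrow> g s \<in> \<aa>"
      "\<And>s. s \<in> carrier A \<Longrightarrow> g s \<noteq> \<zero>\<^bsub>T\<^esub> \<Longrightarrow> s \<in> K" for K g
    using that
  proof (induction K arbitrary: g rule: finite_induct)
    case empty
    have ext: "g \<in> extensional (carrier A)" using empty.prems(1) by (auto simp: free_module_simps PiE_def)
    \<comment> \<open>\<open>module_maps\<close> does not mention zero, so the zero vector is
      presented as a zero multiple in order to see that \<open>p\<close> kills it.\<close>
    have "g = \<zero>\<^bsub>T\<^esub> \<odot>\<^bsub>?Fr\<^esub> g"
      unfolding free_module_simps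
    proof (rule extensionalityI[OF ext])
      fix s assume s: "s \<in> carrier A"
      then have "g s = \<zero>\<^bsub>T\<^esub>" using empty.prems(3) by blast
      then show "g s = (\<lambda>s\<in>carrier A. \<zero>\<^bsub>T\<^esub> \<otimes>\<^bsub>T\<^esub> g s) s" using s by simp
    qed simp
    then have "p g = p (\<zero>\<^bsub>T\<^esub> \<odot>\<^bsub>?Fr\<^esub> g)" by (rule arg_cong)
    also have "\<dots> = \<mu> \<zero>\<^bsub>T\<^esub> \<otimes>\<^bsub>A\<^esub> p g" by (rule p_smult[OF T.zero_closed empty.prems(1)])
    finally have "p g = \<zero>\<^bsub>A\<^esub>" using p_closed[OF empty.prems(1)] by simp
    then show ?case by (intro bexI[of _ "\<zero>\<^bsub>T\<^esub>"]) (simp_all add: \<aa>_def)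
  next
    case (insert s K)
    show ?case
    proof (cases "s \<in> carrier A")
      case False
      then show ?thesis using insert.prems by (intro insert.IH) auto
    next
      case s: True
      define g' where "g' = (\<lambda>x\<in>carrier A. if x = s then \<zero>\<^bsub>T\<^esub> else g x)"
      define \<delta> where "\<delta> = (\<lambda>x\<in>carrier A. if x = s then \<one>\<^bsub>T\<^esub> else \<zero>\<^bsub>T\<^esub>)"
      have gc: "g x \<in> carrier T" if "x \<in> carrier A" for x
        using insert.prems(2)[OF that] by (simp add: \<aa>_def)
      have gfin: "finite {x \<in> carrier A. g x \<noteq> \<zero>\<^bsub>T\<^esub>}" and gext: "g \<in> extensional (carrier A)"
        using insert.prems(1) by (auto simp: free_module_simps PiE_def)
      have g': "g' \<in> carrier ?Fr"
        unfolding free_module_simps g'_def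
        by (auto simp: gc intro: finite_subset[OF _ gfin])
      have \<delta>: "\<delta> \<in> carrier ?Fr"
        unfolding free_module_simps \<delta>_def
        by (auto intro: finite_subset[of _ "{s}"])
      have g_eq: "g = g s \<odot>\<^bsub>?Fr\<^esub> \<delta> \<oplus>\<^bsub>?Fr\<^esub> g'"
        unfolding free_module_simps
        by (rule extensionalityI[OF gext]) (auto simp: \<delta>_def g'_def gc s)
      have "\<exists>e\<in>\<aa>. \<mu> e = p g'"
      proof (rule insert.IH[OF g'])
        have "\<zero>\<^bsub>T\<^esub> \<in> \<aa>" by (simp add: \<aa>_def)
        then show "g' x \<in> \<aa>" if "x \<in> carrier A" for x
          using insert.prems(2) that by (simp add: g'_def)
        show "x \<in> K" if "x \<in> carrier A" "g' x \<noteq> \<zero>\<^bsub>T\<^esub>" for x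
          using insert.prems(3)[of x] that by (simp add: g'_def split: if_splits)
      qed
      then obtain e' where e': "e' \<in> \<aa>" "\<mu> e' = p g'" ..
      have sm: "g s \<odot>\<^bsub>?Fr\<^esub> \<delta> \<in> carrier ?Fr"
        unfolding free_module_simps \<delta>_def
        by (auto simp: gc s intro: finite_subset[of _ "{s}"])
      \<comment> \<open>The factor \<open>p \<delta> \<otimes>\<^sub>t \<one>\<close> is a preimage
        of \<open>p \<delta>\<close> under \<mu>. Multiplying \<open>g s\<close> by it does not
        leave \<open>\<aa>\<close>, because annihilators are ideals.\<close>
      define e where "e = g s \<otimes>\<^bsub>T\<^esub> (p \<delta> \<otimes>\<^sub>t \<one>\<^bsub>A\<^esub>) \<oplus>\<^bsub>T\<^esub> e'"
      have cl: "p \<delta> \<otimes>\<^sub>t \<one>\<^bsub>A\<^esub> \<in> carrier T" "e' \<in> carrier T" "g s \<in> carrier T" "p \<delta> \<in> carrier A"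
        using p_closed[OF \<delta>] e'(1) gc[OF s] by (simp_all add: \<aa>_def)
      have "p g = p (g s \<odot>\<^bsub>?Fr\<^esub> \<delta> \<oplus>\<^bsub>?Fr\<^esub> g')" using g_eq by (rule arg_cong)
      also have "\<dots> = \<mu> (g s) \<otimes>\<^bsub>A\<^esub> p \<delta> \<oplus>\<^bsub>A\<^esub> p g'"
        by (simp only: p_add[OF sm g'] p_smult[OF gc[OF s] \<delta>])
      also have "\<dots> = \<mu> e"
        using cl by (simp add: e_def e')
      finally have "\<mu> e = p g" ..
      moreover have "e \<in> \<aa>"
        unfolding \<aa>_def
      proof (intro CollectI conjI ballI impI)
        show "e \<in> carrier T" using cl by (simp add: e_def)
        fix z assume z: "z \<in> carrier T" "\<mu> z = \<zero>\<^bsub>A\<^esub>"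
        have "z \<otimes>\<^bsub>T\<^esub> g s = \<zero>\<^bsub>T\<^esub>" "z \<otimes>\<^bsub>T\<^esub> e' = \<zero>\<^bsub>T\<^esub>"
          using insert.prems(2)[OF s] e'(1) z by (simp_all add: \<aa>_def)
        then show "z \<otimes>\<^bsub>T\<^esub> e = \<zero>\<^bsub>T\<^esub>"
          using z cl by (simp add: e_def T.r_distr flip: T.m_assoc)
      qed
      ultimately show ?thesis by blast
    qed
  qed
  have "finite {s \<in> carrier A. i \<one>\<^bsub>A\<^esub> s \<noteq> \<zero>\<^bsub>T\<^esub>}" using i1 by (simp add: free_module_simps)
  from image[OF this i1 i1_aa] obtain e where e: "e \<in> \<aa>" "\<mu> e = p (i \<one>\<^bsub>A\<^esub>)" by blast
  have "\<mu> e = \<one>\<^bsub>A\<^esub>" using e pi by simp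
  moreover have ec: "e \<in> carrier T" using e by (simp add: \<aa>_def)
  moreover have "(a \<otimes>\<^sub>t \<one>\<^bsub>A\<^esub>) \<otimes>\<^bsub>T\<^esub> e = (\<one>\<^bsub>A\<^esub> \<otimes>\<^sub>t a) \<otimes>\<^bsub>T\<^esub> e" if a: "a \<in> carrier A" for a
  proof -
    let ?l = "a \<otimes>\<^sub>t \<one>\<^bsub>A\<^esub>" and ?r = "\<one>\<^bsub>A\<^esub> \<otimes>\<^sub>t a"
    have lr: "?l \<in> carrier T" "?r \<in> carrier T" using a by auto
    have "\<mu> (?l \<ominus>\<^bsub>T\<^esub> ?r) = \<zero>\<^bsub>A\<^esub>" using a by (simp add: a_minus_def A.r_neg)
    then have "(?l \<ominus>\<^bsub>T\<^esub> ?r) \<otimes>\<^bsub>T\<^esub> e = \<zero>\<^bsub>T\<^esub>"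
      using e(1) lr by (simp add: \<aa>_def)
    moreover have "?l \<otimes>\<^bsub>T\<^esub> e = (?l \<ominus>\<^bsub>T\<^esub> ?r) \<otimes>\<^bsub>T\<^esub> e \<oplus>\<^bsub>T\<^esub> ?r \<otimes>\<^bsub>T\<^esub> e"
      using lr ec by algebra
    ultimately show ?thesis using lr ec by simp
  qed
  ultimately show "\<exists>e\<in>carrier T. ?P e" by blast
next
  let ?E = "enveloping_module A" and ?Fr = "free_module T (carrier A)"
  assume "\<exists>e\<in>carrier T. ?P e"
  then obtain e where e: "e \<in> carrier T" "\<mu> e = \<one>\<^bsub>A\<^esub>"
    and comm: "\<And>a. a \<in> carrier A \<Longrightarrow> (a \<otimes>\<^sub>t \<one>\<^bsub>A\<^esub>) \<otimes>\<^bsub>T\<^esub> e = (\<one>\<^bsub>A\<^esub> \<otimes>\<^sub>t a) \<otimes>\<^bsub>T\<^esub> e" by blast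
  have tens_eq: "a \<otimes>\<^sub>t b = (a \<otimes>\<^sub>t \<one>\<^bsub>A\<^esub>) \<otimes>\<^bsub>T\<^esub> (\<one>\<^bsub>A\<^esub> \<otimes>\<^sub>t b)" if "a \<in> carrier A" "b \<in> carrier A" for a b
    using that by (simp add: tens_mult)
  \<comment> \<open>The section of \<mu> that sends \<one> to e.\<close>
  define \<iota> where "\<iota> a = (a \<otimes>\<^sub>t \<one>\<^bsub>A\<^esub>) \<otimes>\<^bsub>T\<^esub> e" for a
  have \<iota>_closed: "\<iota> a \<in> carrier T" if "a \<in> carrier A" for a
    using that e by (simp add: \<iota>_def)
  have \<iota>_add: "\<iota> (a \<oplus>\<^bsub>A\<^esub> b) = \<iota> a \<oplus>\<^bsub>T\<^esub> \<iota> b" if "a \<in> carrier A" "b \<in> carrier A" for a b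
    using that e by (simp add: \<iota>_def tens_add_left T.l_distr)
  \<comment> \<open>The content is that z e depends on \<mu> z alone. On pure tensors, commutation
    moves the right factor to the left, where both factors multiply; linearity of \<iota> over
    \<open>T\<close> follows.\<close>
  have mult_e: "z \<otimes>\<^bsub>T\<^esub> e = \<iota> (\<mu> z)" if "z \<in> carrier T" for z
    using that
  proof (induction z rule: tensor_ring_induct)
    case (tens a b)
    have "(a \<otimes>\<^sub>t b) \<otimes>\<^bsub>T\<^esub> e = (a \<otimes>\<^sub>t \<one>\<^bsub>A\<^esub>) \<otimes>\<^bsub>T\<^esub> ((b \<otimes>\<^sub>t \<one>\<^bsub>A\<^esub>) \<otimes>\<^bsub>T\<^esub> e)"
      unfolding tens_eq[OF tens] comm[OF tens(2)] using tens e by (simp add: T.m_assoc)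
    also have "\<dots> = \<iota> (a \<otimes>\<^bsub>A\<^esub> b)"
      using tens e by (simp add: \<iota>_def tens_mult flip: T.m_assoc)
    finally show ?case using tens by simp
  next
    case (diff x y)
    have "\<iota> (\<mu> (x \<ominus>\<^bsub>T\<^esub> y)) \<oplus>\<^bsub>T\<^esub> \<iota> (\<mu> y) = \<iota> (\<mu> (x \<ominus>\<^bsub>T\<^esub> y) \<oplus>\<^bsub>A\<^esub> \<mu> y)"
      using diff by (simp add: \<iota>_add)
    also have "\<mu> (x \<ominus>\<^bsub>T\<^esub> y) \<oplus>\<^bsub>A\<^esub> \<mu> y = \<mu> x"
      using diff by (simp add: a_minus_def A.a_assoc A.l_neg)
    finally have "\<iota> (\<mu> (x \<ominus>\<^bsub>T\<^esub> y)) \<oplus>\<^bsub>T\<^esub> \<iota> (\<mu> y) = \<iota> (\<mu> x)" .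
    moreover have "(x \<ominus>\<^bsub>T\<^esub> y) \<otimes>\<^bsub>T\<^esub> e \<oplus>\<^bsub>T\<^esub> y \<otimes>\<^bsub>T\<^esub> e = x \<otimes>\<^bsub>T\<^esub> e"
      using diff(1,2) e(1) by algebra
    ultimately have "(x \<ominus>\<^bsub>T\<^esub> y) \<otimes>\<^bsub>T\<^esub> e \<oplus>\<^bsub>T\<^esub> \<iota> (\<mu> y) = \<iota> (\<mu> (x \<ominus>\<^bsub>T\<^esub> y)) \<oplus>\<^bsub>T\<^esub> \<iota> (\<mu> y)"
      using diff by simp
    then show ?case using diff e \<iota>_closed by (simp add: T.add.right_cancel)
  qed
  have \<iota>_smult: "\<iota> (\<mu> z \<otimes>\<^bsub>A\<^esub> a) = z \<otimes>\<^bsub>T\<^esub> \<iota> a" if "z \<in> carrier T" "a \<in> carrier A" for z a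
  proof -
    have "\<iota> (\<mu> z \<otimes>\<^bsub>A\<^esub> a) = \<iota> (\<mu> (z \<otimes>\<^bsub>T\<^esub> (a \<otimes>\<^sub>t \<one>\<^bsub>A\<^esub>)))" using that by simp
    also have "\<dots> = z \<otimes>\<^bsub>T\<^esub> (a \<otimes>\<^sub>t \<one>\<^bsub>A\<^esub>) \<otimes>\<^bsub>T\<^esub> e" using that by (simp add: mult_e)
    also have "\<dots> = z \<otimes>\<^bsub>T\<^esub> \<iota> a" using that e by (simp add: \<iota>_def T.m_assoc)
    finally show ?thesis .
  qed
  \<comment> \<open>Only the basis vector indexed by \<one> is used: it spans a copy of
    \<open>T\<close> inside the free module, so the section \<iota> and the map \<mu> carry
    over.\<close>
  define i where "i a = (\<lambda>s\<in>carrier A. if s = \<one>\<^bsub>A\<^esub> then \<iota> a else \<zero>\<^bsub>T\<^esub>)" for a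
  define p where "p g = \<mu> (g \<one>\<^bsub>A\<^esub>)" for g
  have "i \<in> module_maps T ?E ?Fr"
    unfolding module_maps_def
    by (auto simp: enveloping_module_simps free_module_simps i_def \<iota>_closed \<iota>_add \<iota>_smult
        intro!: restrict_ext intro: finite_subset[of _ "{\<one>\<^bsub>A\<^esub>}"])
  moreover have "p \<in> module_maps T ?Fr ?E"
  proof -
    have "g \<one>\<^bsub>A\<^esub> \<in> carrier T" if "g \<in> carrier A \<rightarrow>\<^sub>E carrier T" for g
      using that by (rule PiE_mem) simp
    then show ?thesis
      unfolding module_maps_def
      by (auto simp: enveloping_module_simps free_module_simps p_def)
  qed
  moreover have "p (i m) = m" if "m \<in> carrier A" for m
    using that e by (simp add: p_def i_def \<iota>_def)
  ultimately show "separable_algebra R A"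
    unfolding separable_algebra_def projective_module_def
    using A.algebra_axioms module_enveloping by (auto simp: enveloping_module_simps(1))
qed

end


section \<open>Adjoining a root\<close>

text \<open>\<open>root_algebra\<close> copies the ring fields of a quotient into a record with
  scalars, so the ring axioms have to be carried from one record to the other.\<close>

lemma cring_cong:
  assumes "cring Q" "carrier A = carrier Q" "monoid.mult A = monoid.mult Q"
    "\<one>\<^bsub>A\<^esub> = \<one>\<^bsub>Q\<^esub>" "\<zero>\<^bsub>A\<^esub> = \<zero>\<^bsub>Q\<^esub>" "ring.add A = ring.add Q"
  shows "cring A"
proof -
  interpret Q: cring Q by fact
  show ?thesis
  proof (rule cringI)
    show "abelian_group A"
      by (rule abelian_groupI) (auto simp: assms(2-) Q.a_ac intro: Q.l_neg Q.a_inv_closed)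
    show "comm_monoid A"
      by (rule comm_monoidI) (auto simp: assms(2-) Q.m_ac)
  qed (auto simp: assms(2-) Q.l_distr)
qed

lemma (in UP_ring) UP_induct [consumes 1, case_names monom add]:
  assumes p: "p \<in> carrier P"
    and monom: "\<And>r k. r \<in> carrier R \<Longrightarrow> Q (monom P r k)"
    and add: "\<And>p q. p \<in> carrier P \<Longrightarrow> q \<in> carrier P \<Longrightarrow> Q p \<Longrightarrow> Q q \<Longrightarrow> Q (p \<oplus>\<^bsub>P\<^esub> q)"
  shows "Q p"
proof -
  have "Q (\<Oplus>\<^bsub>P\<^esub>i\<in>{..m}. monom P (coeff P p i) i)" for m
  proof (induction m)
    case 0
    show ?case using p by (simp add: monom)
  next
    case (Suc m)
    have "(\<Oplus>\<^bsub>P\<^esub>i\<in>{..Suc m}. monom P (coeff P p i) i)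
        = monom P (coeff P p (Suc m)) (Suc m) \<oplus>\<^bsub>P\<^esub> (\<Oplus>\<^bsub>P\<^esub>i\<in>{..m}. monom P (coeff P p i) i)"
      using p by (intro P.finsum_Suc) simp
    then show ?case using Suc p by (simp add: monom add)
  qed
  then show ?thesis using up_repr[OF p] by metis
qed

text \<open>The sum of all \<open>a\<^sup>i b\<^sup>j\<close> with \<open>i + j = k - 1\<close>, i.e. \<open>(a\<^sup>k - b\<^sup>k) / (a - b)\<close>.\<close>

primrec diff_quot :: "('a, 'b) ring_scheme \<Rightarrow> 'a \<Rightarrow> 'a \<Rightarrow> nat \<Rightarrow> 'a" where
  "diff_quot R a b 0 = \<zero>\<^bsub>R\<^esub>"
| "diff_quot R a b (Suc k) = a \<otimes>\<^bsub>R\<^esub> diff_quot R a b k \<oplus>\<^bsub>R\<^esub> b [^]\<^bsub>R\<^esub> k"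

context cring begin

lemma diff_quot_closed: "a \<in> carrier R \<Longrightarrow> b \<in> carrier R \<Longrightarrow> diff_quot R a b k \<in> carrier R"
  by (induction k) auto

lemma diff_quot_mult:
  assumes "a \<in> carrier R" "b \<in> carrier R"
  shows "(a \<ominus> b) \<otimes> diff_quot R a b k = a [^] k \<ominus> b [^] k"
proof (induction k)
  case 0
  show ?case using assms by (simp add: a_minus_def r_neg)
next
  case (Suc k)
  let ?D = "diff_quot R a b k"
  have D: "?D \<in> carrier R" using assms by (rule diff_quot_closed)
  have pow: "a [^] k \<in> carrier R" "b [^] k \<in> carrier R" using assms by auto
  have "(a \<ominus> b) \<otimes> diff_quot R a b (Suc k) = a \<otimes> ((a \<ominus> b) \<otimes> ?D) \<oplus> (a \<ominus> b) \<otimes> b [^] k"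
    unfolding diff_quot.simps using assms D pow by algebra
  also have "\<dots> = a \<otimes> (a [^] k \<ominus> b [^] k) \<oplus> (a \<ominus> b) \<otimes> b [^] k"
    by (simp only: Suc)
  also have "\<dots> = a [^] k \<otimes> a \<ominus> b [^] k \<otimes> b"
    using assms pow by algebra
  finally show ?case by simp
qed

text \<open>With equal arguments the difference quotient is the derivative of the k-th power. The
  extra factor a avoids the exponent k - 1 and, for the generator of A, turns the power into
  t.\<close>

lemma mult_diff_quot_same:
  assumes "a \<in> carrier R"
  shows "a \<otimes> diff_quot R a a k = add_pow R k \<one> \<otimes> a [^] k"
proof (induction k)
  case 0
  show ?case using assms by simp
next
  case (Suc k)
  let ?D = "diff_quot R a a k"
  have D: "?D \<in> carrier R" using assms by (intro diff_quot_closed)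
  have pow: "a [^] k \<in> carrier R" "add_pow R k \<one> \<in> carrier R" using assms by auto
  have "a \<otimes> diff_quot R a a (Suc k) = a \<otimes> (a \<otimes> ?D) \<oplus> a \<otimes> a [^] k"
    unfolding diff_quot.simps using assms D pow by algebra
  also have "\<dots> = a \<otimes> (add_pow R k \<one> \<otimes> a [^] k) \<oplus> a \<otimes> a [^] k"
    by (simp only: Suc)
  also have "\<dots> = (add_pow R k \<one> \<oplus> \<one>) \<otimes> (a [^] k \<otimes> a)"
    using assms pow by algebra
  finally show ?case by simp
qed

end

text \<open>Used for the multiplication map, which sends both copies of the generator to the same
  element and so produces the derivative.\<close>

lemma (in ring_hom_cring) hom_diff_quot:
  assumes "a \<in> carrier R" "b \<in> carrier R"
  shows "h (diff_quot R a b k) = diff_quot S (h a) (h b) k"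
  by (induction k) (use assms in \<open>auto simp: R.diff_quot_closed ring.hom_nat_pow\<close>)

section \<open>The algebra R[T]/(T^n - t)\<close>

locale root_extension = UP_cring R P for R (structure) and P (structure) +
  fixes n :: nat and t :: 'a
  assumes t: "t \<in> carrier R"
begin

abbreviation I where "I \<equiv> root_ideal R n t"
abbreviation f where "f \<equiv> monom P \<one> n \<ominus>\<^bsub>P\<^esub> monom P t 0"
abbreviation A where "A \<equiv> root_algebra R n t"
definition \<kappa> where "\<kappa> p = I +>\<^bsub>P\<^esub> p"
definition x where "x = \<kappa> (monom P \<one> 1)"

lemma f_closed: "f \<in> carrier P"
  using t by simp

lemma I_eq: "I = genideal P {f}"
  by (simp add: root_ideal_def P_def)

sublocale I: ideal I P
  unfolding I_eq using f_closed by (intro P.genideal_ideal) auto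

lemma A_simps:
  "carrier A = carrier (P Quot I)" "monoid.mult A = monoid.mult (P Quot I)"
  "\<one>\<^bsub>A\<^esub> = \<one>\<^bsub>P Quot I\<^esub>" "\<zero>\<^bsub>A\<^esub> = \<zero>\<^bsub>P Quot I\<^esub>" "ring.add A = ring.add (P Quot I)"
  "r \<odot>\<^bsub>A\<^esub> a = \<kappa> (monom P r 0) \<otimes>\<^bsub>P Quot I\<^esub> a"
  by (simp_all add: root_algebra_def Let_def P_def \<kappa>_def)

lemma A_cring: "cring A"
  by (rule cring_cong[OF I.quotient_is_cring[OF P.cring_axioms] A_simps(1-5)])

sublocale A: cring A by (rule A_cring)

lemma ring_hom_A: "ring_hom A S = ring_hom (P Quot I) S"
  by (simp add: ring_hom_def A_simps)

lemma \<kappa>_hom: "\<kappa> \<in> ring_hom P A"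
  using I.rcos_ring_hom unfolding \<kappa>_def[abs_def] by (simp add: ring_hom_def A_simps)

sublocale \<kappa>: ring_hom_cring P A \<kappa>
  by (rule ring_hom_cring.intro[OF P.cring_axioms A_cring])
    (simp add: ring_hom_cring_axioms_def \<kappa>_hom)

lemma smult_eq: "r \<odot>\<^bsub>A\<^esub> a = \<kappa> (monom P r 0) \<otimes>\<^bsub>A\<^esub> a"
  by (simp add: A_simps)

lemma A_carrierE:
  assumes "a \<in> carrier A"
  obtains p where "p \<in> carrier P" "a = \<kappa> p"
  using assms by (auto simp: A_simps carrier_Quot \<kappa>_def)

lemma A_algebra: "algebra R A"
proof (rule algebraI)
  show "cring R" by (rule R.cring_axioms)
  show "\<one> \<odot>\<^bsub>A\<^esub> a = a" if "a \<in> carrier A" for a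
    using that by (simp add: smult_eq)
  show "(r \<otimes> s) \<odot>\<^bsub>A\<^esub> a = r \<odot>\<^bsub>A\<^esub> (s \<odot>\<^bsub>A\<^esub> a)"
    if "r \<in> carrier R" "s \<in> carrier R" "a \<in> carrier A" for r s a
    using that monom_mult[of r s 0 0] by (simp add: smult_eq A.m_assoc del: monom_mult)
qed (auto simp: smult_eq A_cring A.l_distr A.r_distr A.m_assoc)

sublocale S: tensor_square R A
  by (intro tensor_square.intro tensor_algebras.intro A_algebra)

lemma x_closed: "x \<in> carrier A"
  by (simp add: x_def)

lemma monom_eq: "r \<in> carrier R \<Longrightarrow> monom P r k = monom P r 0 \<otimes>\<^bsub>P\<^esub> monom P \<one> k"
  using monom_mult[of r \<one> 0 k] by (simp del: monom_mult)

lemma \<kappa>_monom_one: "\<kappa> (monom P \<one> k) = x [^]\<^bsub>A\<^esub> k"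
proof (induction k)
  case (Suc k)
  have "\<kappa> (monom P \<one> (Suc k)) = \<kappa> (monom P \<one> k) \<otimes>\<^bsub>A\<^esub> x"
    unfolding monom_one_Suc[of k] x_def by (rule \<kappa>.hom_mult) simp_all
  then show ?case using Suc by simp
qed simp

lemma x_pow: "x [^]\<^bsub>A\<^esub> n = \<kappa> (monom P t 0)"
proof -
  have "f \<in> I" unfolding I_eq using f_closed by (simp add: P.genideal_self')
  then have "\<kappa> (monom P \<one> n) = \<kappa> (monom P t 0)"
    unfolding \<kappa>_def using P.quotient_eq_iff_same_a_r_cos[OF I.ideal_axioms] t by simp
  then show ?thesis by (simp add: \<kappa>_monom_one)
qed

text \<open>The kernel of h is an ideal, so it contains I as soon as it contains the single
  generator.\<close>

lemma
  assumes h: "ring_hom_ring P S h" and "h f = \<zero>\<^bsub>S\<^esub>"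
  shows root_lift_hom: "(\<lambda>X. the_elem (h ` X)) \<in> ring_hom A S"
    and root_lift_coset: "p \<in> carrier P \<Longrightarrow> the_elem (h ` \<kappa> p) = h p"
proof -
  interpret h: ring_hom_ring P S h by fact
  have "f \<in> a_kernel P S h" unfolding a_kernel_def' using f_closed assms(2) by blast
  then have "I \<subseteq> a_kernel P S h"
    unfolding I_eq by (intro P.genideal_minimal h.kernel_is_ideal) simp
  then have ker: "h y = \<zero>\<^bsub>S\<^esub>" if "y \<in> I" for y
    using that unfolding a_kernel_def' by blast
  show "(\<lambda>X. the_elem (h ` X)) \<in> ring_hom A S"
    unfolding ring_hom_A by (rule Quot_lift_hom[OF h I.ideal_axioms ker])
  show "p \<in> carrier P \<Longrightarrow> the_elem (h ` \<kappa> p) = h p"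
    unfolding \<kappa>_def by (rule Quot_lift_coset[OF h I.ideal_axioms ker])
qed

section \<open>Polynomials modulo T^2, and the unit criterion\<close>

lemma coeff_mult_0:
  assumes "p \<in> carrier P" "q \<in> carrier P"
  shows "coeff P (p \<otimes>\<^bsub>P\<^esub> q) 0 = coeff P p 0 \<otimes> coeff P q 0"
  using assms by simp

lemma coeff_mult_1:
  assumes "p \<in> carrier P" "q \<in> carrier P"
  shows "coeff P (p \<otimes>\<^bsub>P\<^esub> q) 1 = coeff P p 1 \<otimes> coeff P q 0 \<oplus> coeff P p 0 \<otimes> coeff P q 1"
  using assms by simp

text \<open>Modulo T^2 the polynomial is the constant -t: for n > 1 the power T^n does not reach the
  two lowest coefficients.\<close>

lemma coeff_f: "n > 1 \<Longrightarrow> coeff P f 0 = \<ominus> t" "n > 1 \<Longrightarrow> coeff P f 1 = \<zero>"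
  using t by (simp_all add: a_minus_def)

lemma const_coeffs:
  assumes "r \<in> carrier R"
  shows "coeff P (monom P r 0) 0 = r" "coeff P (monom P r 0) 1 = \<zero>" "monom P r 0 \<in> carrier P"
  using assms by simp_all

text \<open>Modulo T^2, multiplication by T sees only the constant term of p. In \<open>C\<close>
  this makes the identity and the evaluation at 0 indistinguishable after multiplication by
  T.\<close>

lemma X_mult_coeffs:
  assumes "p \<in> carrier P"
  defines "d \<equiv> monom P \<one> 1 \<otimes>\<^bsub>P\<^esub> p \<ominus>\<^bsub>P\<^esub> monom P \<one> 1 \<otimes>\<^bsub>P\<^esub> monom P (coeff P p 0) 0"
  shows "coeff P d 0 = \<zero>" "coeff P d 1 = \<zero>" "d \<in> carrier P"
proof -
  show "coeff P d 0 = \<zero>"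
    using assms(1) by (simp add: d_def a_minus_def coeff_mult_0 R.r_neg del: coeff_mult)
  have X: "monom P \<one> 1 \<in> carrier P" "coeff P (monom P \<one> 1) 0 = \<zero>" "coeff P (monom P \<one> 1) 1 = \<one>"
    by simp_all
  have c: "monom P (coeff P p 0) 0 \<in> carrier P" using assms(1) by simp
  have "coeff P d 1 = coeff P (monom P \<one> 1 \<otimes>\<^bsub>P\<^esub> p) 1
      \<ominus> coeff P (monom P \<one> 1 \<otimes>\<^bsub>P\<^esub> monom P (coeff P p 0) 0) 1"
    using assms(1) by (simp add: d_def a_minus_def del: coeff_mult)
  also have "\<dots> = \<zero>"
    unfolding coeff_mult_1[OF X(1) assms(1)] coeff_mult_1[OF X(1) c] X(2,3)
    using assms(1) by (simp add: a_minus_def R.r_neg)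
  finally show "coeff P d 1 = \<zero>" .
  show "d \<in> carrier P" using assms(1) by (simp add: d_def)
qed

theorem Units_if_separable:
  assumes "n > 1" "separable_algebra R A"
  shows "t \<in> Units R"
proof -
  obtain e where e: "e \<in> carrier S.T" "S.\<mu> e = \<one>\<^bsub>A\<^esub>"
    and comm: "S.tens x \<one>\<^bsub>A\<^esub> \<otimes>\<^bsub>S.T\<^esub> e = S.tens \<one>\<^bsub>A\<^esub> x \<otimes>\<^bsub>S.T\<^esub> e"
    using assms(2) x_closed unfolding S.separable_iff_idempotent by blast
  interpret tI: ideal "PIdl t" R by (rule R.cgenideal_ideal[OF t])
  \<comment> \<open>This is the ideal (t, T^2), described by coefficients so that membership is
    decided by the two lowest ones.\<close>
  define J where "J = {p \<in> carrier P. coeff P p 0 \<in> PIdl t \<and> coeff P p 1 \<in> PIdl t}"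
  interpret J: ideal J P
  proof (rule idealI)
    show "ring P" by (rule P.ring_axioms)
    show "subgroup J (add_monoid P)"
    proof
      fix p assume "p \<in> J"
      then show "inv\<^bsub>add_monoid P\<^esub> p \<in> J"
        unfolding a_inv_def[symmetric] by (auto simp: J_def tI.a_inv_closed)
    qed (auto simp: J_def tI.a_closed)
    fix p q assume "p \<in> J" "q \<in> carrier P"
    then show "q \<otimes>\<^bsub>P\<^esub> p \<in> J" "p \<otimes>\<^bsub>P\<^esub> q \<in> J"
      by (auto simp: J_def coeff_mult_0 coeff_mult_1[unfolded One_nat_def] tI.a_closed tI.I_l_closed tI.I_r_closed
          simp del: coeff_mult)
  qed
  define C where "C = P Quot J"
  interpret C: cring C unfolding C_def by (rule J.quotient_is_cring) (rule P.cring_axioms)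
  define \<pi> where "\<pi> p = J +>\<^bsub>P\<^esub> p" for p
  interpret \<pi>: ring_hom_cring P C \<pi>
    unfolding C_def \<pi>_def[abs_def] by (rule J.rcos_ring_hom_cring) (rule P.cring_axioms)
  have \<pi>_eq: "\<pi> p = \<pi> q \<longleftrightarrow> p \<ominus>\<^bsub>P\<^esub> q \<in> J" if "p \<in> carrier P" "q \<in> carrier P" for p q
    unfolding \<pi>_def using P.quotient_eq_iff_same_a_r_cos[OF J.ideal_axioms that] by simp
  \<comment> \<open>Evaluation at T = 0, followed by the projection to \<open>C\<close>; it is
    multiplicative because the constant coefficient is.\<close>
  define \<pi>0 where "\<pi>0 p = \<pi> (monom P (coeff P p 0) 0)" for p
  interpret \<pi>0: ring_hom_ring P C \<pi>0
  proof (rule ring_hom_ringI[OF P.ring_axioms C.ring_axioms])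
    fix p q assume pq: "p \<in> carrier P" "q \<in> carrier P"
    have "monom P (coeff P p 0 \<otimes> coeff P q 0) 0 = monom P (coeff P p 0) 0 \<otimes>\<^bsub>P\<^esub> monom P (coeff P q 0) 0"
      using monom_mult[of "coeff P p 0" "coeff P q 0" 0 0] pq by (simp del: monom_mult)
    then show "\<pi>0 (p \<otimes>\<^bsub>P\<^esub> q) = \<pi>0 p \<otimes>\<^bsub>C\<^esub> \<pi>0 q"
      using pq by (simp add: \<pi>0_def del: monom_mult)
  qed (simp_all add: \<pi>0_def)
  have "\<ominus> t \<in> PIdl t" using R.cgenideal_self[OF t] by (rule tI.a_inv_closed)
  then have fJ: "f \<in> J"
    unfolding J_def mem_Collect_eq coeff_f[OF assms(1)] using f_closed tI.zero_closed by blast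
  have \<pi>_zero: "\<pi> p = \<zero>\<^bsub>C\<^esub>" if "p \<in> J" for p
    unfolding \<pi>_def C_def using that by (simp add: FactRing_def J.a_rcos_const)
  have f0: "\<pi>0 f = \<zero>\<^bsub>C\<^esub>"
    unfolding \<pi>0_def
  proof (rule \<pi>_zero)
    show "monom P (coeff P f 0) 0 \<in> J"
      unfolding coeff_f(1)[OF assms(1)] J_def mem_Collect_eq const_coeffs[OF R.a_inv_closed[OF t]]
      using \<open>\<ominus> t \<in> PIdl t\<close> tI.zero_closed const_coeffs(3)[OF R.a_inv_closed[OF t]] by blast
  qed
  note h0 = \<pi>0.ring_hom_ring_axioms f0 and h1 = \<pi>.ring.ring_hom_ring_axioms \<pi>_zero[OF fJ]
  define \<alpha> where "\<alpha> X = the_elem (\<pi>0 ` X)" for X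
  define \<beta> where "\<beta> X = the_elem (\<pi> ` X)" for X
  have \<alpha>: "\<alpha> \<in> ring_hom A C" and \<alpha>_\<kappa>: "\<alpha> (\<kappa> p) = \<pi>0 p" if "p \<in> carrier P" for p
    unfolding \<alpha>_def[abs_def] using root_lift_hom[OF h0] root_lift_coset[OF h0 that] by auto
  have \<beta>: "\<beta> \<in> ring_hom A C" and \<beta>_\<kappa>: "\<beta> (\<kappa> p) = \<pi> p" if "p \<in> carrier P" for p
    unfolding \<beta>_def[abs_def] using root_lift_hom[OF h1] root_lift_coset[OF h1 that] by auto
  \<comment> \<open>The facts that \<alpha> and \<beta> are homomorphisms carry a premise on a
    polynomial which they do not mention; the zero polynomial serves for it.\<close>
  interpret \<alpha>: ring_hom_cring A C \<alpha>
    by (rule ring_hom_cring.intro[OF A_cring C.cring_axioms])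
      (simp add: ring_hom_cring_axioms_def \<alpha>[OF P.zero_closed])
  interpret \<beta>: ring_hom_cring A C \<beta>
    by (rule ring_hom_cring.intro[OF A_cring C.cring_axioms])
      (simp add: ring_hom_cring_axioms_def \<beta>[OF P.zero_closed])
  \<comment> \<open>Evaluation at 0 fixes constants, so both maps agree on the image of R; this is
    all that the lift to the tensor product requires.\<close>
  have const: "\<alpha> (\<kappa> (monom P r 0)) = \<beta> (\<kappa> (monom P r 0))" if "r \<in> carrier R" for r
    using that by (simp add: \<alpha>_\<kappa> \<beta>_\<kappa> \<pi>0_def)
  have balanced: "\<alpha> (r \<odot>\<^bsub>A\<^esub> a) \<otimes>\<^bsub>C\<^esub> \<beta> b = \<alpha> a \<otimes>\<^bsub>C\<^esub> \<beta> (r \<odot>\<^bsub>A\<^esub> b)"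
    if "r \<in> carrier R" "a \<in> carrier A" "b \<in> carrier A" for r a b
    using that by (simp add: smult_eq const C.m_ac)
  define \<Phi> where "\<Phi> = S.tensor_lift C \<alpha> \<beta>"
  interpret \<Phi>: ring_hom_cring S.T C \<Phi>
    by (rule ring_hom_cring.intro[OF S.T.cring_axioms C.cring_axioms])
      (simp add: ring_hom_cring_axioms_def \<Phi>_def S.tensor_lift_hom[OF C.cring_axioms \<alpha>.homh \<beta>.homh balanced])
  have \<Phi>_tens: "\<Phi> (S.tens a b) = \<alpha> a \<otimes>\<^bsub>C\<^esub> \<beta> b" if "a \<in> carrier A" "b \<in> carrier A" for a b
    unfolding \<Phi>_def using S.tensor_lift_tens[OF C.cring_axioms \<alpha>.homh \<beta>.homh balanced that] by simp
  define \<tau> where "\<tau> = \<pi> (monom P \<one> 1)"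
  have \<tau>: "\<tau> \<in> carrier C" by (simp add: \<tau>_def)
  \<comment> \<open>The difference of \<beta> b and \<alpha> b is a multiple of \<tau>, and \<tau>
    squares to zero.\<close>
  have \<tau>_\<alpha>\<beta>: "\<tau> \<otimes>\<^bsub>C\<^esub> \<beta> b = \<tau> \<otimes>\<^bsub>C\<^esub> \<alpha> b" if "b \<in> carrier A" for b
  proof -
    obtain p where p: "p \<in> carrier P" "b = \<kappa> p" using \<open>b \<in> carrier A\<close> by (rule A_carrierE)
    let ?X = "monom P \<one> 1" and ?c = "monom P (coeff P p 0) 0"
    have c: "?c \<in> carrier P" "?X \<in> carrier P" using p by auto
    have "?X \<otimes>\<^bsub>P\<^esub> p \<ominus>\<^bsub>P\<^esub> ?X \<otimes>\<^bsub>P\<^esub> ?c \<in> J"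
      unfolding J_def mem_Collect_eq X_mult_coeffs[OF p(1)]
      using X_mult_coeffs(3)[OF p(1)] tI.zero_closed by blast
    then have "\<pi> (?X \<otimes>\<^bsub>P\<^esub> p) = \<pi> (?X \<otimes>\<^bsub>P\<^esub> ?c)"
      using \<pi>_eq[OF P.m_closed[OF c(2) p(1)] P.m_closed[OF c(2,1)]] by blast
    then show ?thesis
      unfolding \<tau>_def p(2) \<alpha>_\<kappa>[OF p(1)] \<beta>_\<kappa>[OF p(1)] \<pi>0_def
      using \<pi>.hom_mult[OF c(2) p(1)] \<pi>.hom_mult[OF c(2,1)] by argo
  qed
  \<comment> \<open>The congruence modulo \<tau> between \<Phi> and \<alpha> composed with the
    multiplication, in multiplied form. At e it reads \<tau> \<Phi>(e) = \<tau>, since e is mapped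
    to the unit.\<close>
  have \<tau>_\<Phi>: "\<tau> \<otimes>\<^bsub>C\<^esub> \<Phi> z = \<tau> \<otimes>\<^bsub>C\<^esub> \<alpha> (S.\<mu> z)" if "z \<in> carrier S.T" for z
    using that
  proof (induction z rule: S.tensor_ring_induct)
    case (tens a b)
    have "\<tau> \<otimes>\<^bsub>C\<^esub> \<Phi> (S.tens a b) = \<alpha> a \<otimes>\<^bsub>C\<^esub> (\<tau> \<otimes>\<^bsub>C\<^esub> \<beta> b)"
      using tens \<tau> by (simp add: \<Phi>_tens C.m_ac)
    also have "\<dots> = \<tau> \<otimes>\<^bsub>C\<^esub> \<alpha> (S.\<mu> (S.tens a b))"
      using tens \<tau> by (simp add: \<tau>_\<alpha>\<beta> C.m_ac)
    finally show ?case .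
  next
    case (diff y z)
    then show ?case using \<tau> by (simp add: a_minus_def C.r_distr C.r_minus)
  qed
  have "\<alpha> x = \<zero>\<^bsub>C\<^esub>" "\<beta> x = \<tau>"
    by (simp_all add: x_def \<alpha>_\<kappa> \<beta>_\<kappa> \<pi>0_def \<tau>_def)
  then have "\<Phi> (S.tens x \<one>\<^bsub>A\<^esub> \<otimes>\<^bsub>S.T\<^esub> e) = \<zero>\<^bsub>C\<^esub>" "\<Phi> (S.tens \<one>\<^bsub>A\<^esub> x \<otimes>\<^bsub>S.T\<^esub> e) = \<tau> \<otimes>\<^bsub>C\<^esub> \<Phi> e"
    using e x_closed \<tau> by (simp_all add: \<Phi>_tens)
  then have "\<tau> = \<zero>\<^bsub>C\<^esub>"
    using comm \<tau>_\<Phi>[OF e(1)] e(2) \<tau> by simp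
  \<comment> \<open>Vanishing of \<tau> says that the polynomial T lies in J; its linear coefficient
    \<one> is then a multiple of t.\<close>
  then have "\<pi> (monom P \<one> 1) = \<pi> \<zero>\<^bsub>P\<^esub>" unfolding \<tau>_def \<pi>.hom_zero .
  then have "monom P \<one> 1 \<ominus>\<^bsub>P\<^esub> \<zero>\<^bsub>P\<^esub> \<in> J"
    using \<pi>_eq[OF monom_closed[OF R.one_closed] P.zero_closed] by blast
  then have "coeff P (monom P \<one> 1 \<ominus>\<^bsub>P\<^esub> \<zero>\<^bsub>P\<^esub>) 1 \<in> PIdl t" unfolding J_def by blast
  moreover have "coeff P (monom P \<one> 1 \<ominus>\<^bsub>P\<^esub> \<zero>\<^bsub>P\<^esub>) 1 = \<one>" by (simp add: a_minus_def)
  ultimately have "\<one> \<in> PIdl t" by (rule back_subst[of "\<lambda>r. r \<in> PIdl t"])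
  then obtain r where "r \<in> carrier R" "\<one> = r \<otimes> t" unfolding cgenideal_def by blast
  then show ?thesis using t R.m_comm[of r t] unfolding Units_def by auto
qed

theorem separable_if_Units:
  assumes "t \<in> Units R" and u: "u \<in> carrier R" "add_pow R n \<one> \<otimes> u = \<one>"
  shows "separable_algebra R A"
proof -
  obtain v where v: "v \<in> carrier R" "t \<otimes> v = \<one>"
    using assms(1) unfolding Units_def by blast
  let ?l = "\<lambda>a. S.tens a \<one>\<^bsub>A\<^esub>" and ?r = "\<lambda>a. S.tens \<one>\<^bsub>A\<^esub> a"
  define D where "D = diff_quot S.T (?l x) (?r x) n"
  define c where "c r = \<kappa> (monom P r 0)" for r
  have c_closed: "c r \<in> carrier A" if "r \<in> carrier R" for r using that by (simp add: c_def)
  have c_mult: "c (r \<otimes> s) = c r \<otimes>\<^bsub>A\<^esub> c s" if "r \<in> carrier R" "s \<in> carrier R" for r s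
    using that monom_mult[of r s 0 0] by (simp add: c_def del: monom_mult)
  have c_one: "c \<one> = \<one>\<^bsub>A\<^esub>" by (simp add: c_def)
  have c_nat: "c (add_pow R k \<one>) = add_pow A k \<one>\<^bsub>A\<^esub>" for k :: nat
    by (induction k) (simp_all add: c_def)
  \<comment> \<open>The inverse of the derivative n x^(n-1): multiplying that by x gives n t, and u,
    v are the inverses of n and t.\<close>
  define y where "y = c (u \<otimes> v) \<otimes>\<^bsub>A\<^esub> x"
  define e where "e = ?l y \<otimes>\<^bsub>S.T\<^esub> D"
  have lr: "?l a \<in> carrier S.T" "?r a \<in> carrier S.T" if "a \<in> carrier A" for a using that by auto
  have D: "D \<in> carrier S.T" unfolding D_def using x_closed by (intro S.T.diff_quot_closed) auto
  have y: "y \<in> carrier A" unfolding y_def using u v x_closed by (auto intro: c_closed)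
  have e: "e \<in> carrier S.T" unfolding e_def using D y by auto
  have lc: "?l (c r) = ?r (c r)" if "r \<in> carrier R" for r
    using S.tens_smult[of r "\<one>\<^bsub>A\<^esub>" "\<one>\<^bsub>A\<^esub>"] that by (simp add: smult_eq c_def)
  have l_pow: "?l x [^]\<^bsub>S.T\<^esub> k = ?l (x [^]\<^bsub>A\<^esub> k)" and r_pow: "?r x [^]\<^bsub>S.T\<^esub> k = ?r (x [^]\<^bsub>A\<^esub> k)" for k :: nat
    by (induction k) (simp_all add: S.tens_one S.tens_mult x_closed)
  \<comment> \<open>The product telescopes to the difference of the n-th powers. These are the two
    images of t, and a scalar may cross the tensor sign.\<close>
  have "(?l x \<ominus>\<^bsub>S.T\<^esub> ?r x) \<otimes>\<^bsub>S.T\<^esub> D = ?l (c t) \<ominus>\<^bsub>S.T\<^esub> ?r (c t)"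
    unfolding D_def S.T.diff_quot_mult[OF lr[OF x_closed]] l_pow r_pow x_pow c_def ..
  also have "\<dots> = \<zero>\<^bsub>S.T\<^esub>"
    using lr[OF c_closed[OF t]] by (simp add: lc[OF t] a_minus_def S.T.r_neg)
  finally have lrD: "(?l x \<ominus>\<^bsub>S.T\<^esub> ?r x) \<otimes>\<^bsub>S.T\<^esub> D = \<zero>\<^bsub>S.T\<^esub>" .
  have comm_x: "?l x \<otimes>\<^bsub>S.T\<^esub> e = ?r x \<otimes>\<^bsub>S.T\<^esub> e"
  proof -
    have "?l x \<otimes>\<^bsub>S.T\<^esub> e = ?l y \<otimes>\<^bsub>S.T\<^esub> ((?l x \<ominus>\<^bsub>S.T\<^esub> ?r x) \<otimes>\<^bsub>S.T\<^esub> D) \<oplus>\<^bsub>S.T\<^esub> ?r x \<otimes>\<^bsub>S.T\<^esub> e"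
      unfolding e_def using lr(1)[OF y] lr[OF x_closed] D by algebra
    then show ?thesis
      unfolding lrD using lr(1)[OF y] lr[OF x_closed] e by simp
  qed
  \<comment> \<open>Elements with this property include the constants and x and are closed under
    products and sums, so they exhaust A.\<close>
  define comm where "comm a \<longleftrightarrow> ?l a \<otimes>\<^bsub>S.T\<^esub> e = ?r a \<otimes>\<^bsub>S.T\<^esub> e" for a
  have comm_mult: "comm (a \<otimes>\<^bsub>A\<^esub> b)" if "a \<in> carrier A" "b \<in> carrier A" "comm a" "comm b" for a b
  proof -
    have l: "?l (a \<otimes>\<^bsub>A\<^esub> b) = ?l a \<otimes>\<^bsub>S.T\<^esub> ?l b" and r: "?r (a \<otimes>\<^bsub>A\<^esub> b) = ?r b \<otimes>\<^bsub>S.T\<^esub> ?r a"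
      using that by (simp_all add: S.tens_mult A.m_comm)
    have "?l (a \<otimes>\<^bsub>A\<^esub> b) \<otimes>\<^bsub>S.T\<^esub> e = ?l a \<otimes>\<^bsub>S.T\<^esub> (?r b \<otimes>\<^bsub>S.T\<^esub> e)"
      using that e unfolding l comm_def by (simp add: S.T.m_assoc)
    also have "\<dots> = ?r b \<otimes>\<^bsub>S.T\<^esub> (?l a \<otimes>\<^bsub>S.T\<^esub> e)"
      using that e by (simp add: S.T.m_lcomm)
    also have "\<dots> = ?r (a \<otimes>\<^bsub>A\<^esub> b) \<otimes>\<^bsub>S.T\<^esub> e"
      using that e unfolding r comm_def by (simp add: S.T.m_assoc)
    finally show ?thesis unfolding comm_def .
  qed
  have comm_pow: "comm (x [^]\<^bsub>A\<^esub> k)" for k :: nat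
  proof (induction k)
    case 0 show ?case by (simp add: comm_def)
  next
    case (Suc k)
    then show ?case using comm_mult[of "x [^]\<^bsub>A\<^esub> k" x] comm_x x_closed by (simp add: comm_def)
  qed
  have comm_\<kappa>: "comm (\<kappa> p)" if "p \<in> carrier P" for p
    using that
  proof (induction p rule: UP_induct)
    case (monom r k)
    have "\<kappa> (monom P r k) = c r \<otimes>\<^bsub>A\<^esub> x [^]\<^bsub>A\<^esub> k"
      unfolding monom_eq[OF monom, of k] c_def \<kappa>_monom_one[symmetric] using monom by simp
    moreover have "comm (c r)" by (simp add: comm_def lc monom)
    ultimately show ?case using comm_mult comm_pow c_closed[OF monom] x_closed by simp
  next
    case (add p q)
    have l: "?l (\<kappa> (p \<oplus>\<^bsub>P\<^esub> q)) = ?l (\<kappa> p) \<oplus>\<^bsub>S.T\<^esub> ?l (\<kappa> q)"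
      and r: "?r (\<kappa> (p \<oplus>\<^bsub>P\<^esub> q)) = ?r (\<kappa> p) \<oplus>\<^bsub>S.T\<^esub> ?r (\<kappa> q)"
      using add(1,2) by (simp_all add: S.tens_add_left S.tens_add_right)
    show ?case
      using add e unfolding comm_def l r by (simp add: S.T.l_distr)
  qed
  have "S.\<mu> e = y \<otimes>\<^bsub>A\<^esub> diff_quot A x x n"
    unfolding e_def D_def using x_closed y
    by (simp add: S.mu.hom_diff_quot S.T.diff_quot_closed)
  also have "\<dots> = c (u \<otimes> v) \<otimes>\<^bsub>A\<^esub> (add_pow A n \<one>\<^bsub>A\<^esub> \<otimes>\<^bsub>A\<^esub> x [^]\<^bsub>A\<^esub> n)"
    unfolding y_def A.mult_diff_quot_same[OF x_closed, symmetric]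
    using x_closed u v by (simp add: A.m_assoc A.diff_quot_closed c_closed)
  also have "\<dots> = c ((u \<otimes> v) \<otimes> (add_pow R n \<one> \<otimes> t))"
    using u v t by (simp add: c_mult c_nat x_pow flip: c_def)
  also have "(u \<otimes> v) \<otimes> (add_pow R n \<one> \<otimes> t) = (add_pow R n \<one> \<otimes> u) \<otimes> (t \<otimes> v)"
    using u(1) v(1) t by (simp add: R.m_ac)
  finally have "S.\<mu> e = \<one>\<^bsub>A\<^esub>" using u v c_one by simp
  then show ?thesis
    unfolding S.separable_iff_idempotent
    using e comm_\<kappa> by (intro bexI[of _ e]) (auto simp: comm_def elim: A_carrierE)
qed

end


text \<open>Here n is the n-fold sum of the unit. The property passes along ring homomorphisms,
  which is how the condition on the characteristic reaches the completed local rings.\<close>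

definition nat_invertible :: "('a, 'x) ring_scheme \<Rightarrow> nat \<Rightarrow> bool" where
  "nat_invertible R n \<longleftrightarrow> (\<exists>u\<in>carrier R. add_pow R n \<one>\<^bsub>R\<^esub> \<otimes>\<^bsub>R\<^esub> u = \<one>\<^bsub>R\<^esub>)"

theorem root_algebra_separable_iff:
  assumes "cring R" "t \<in> carrier R" "n > 1" "nat_invertible R n"
  shows "separable_algebra R (root_algebra R n t) \<longleftrightarrow> t \<in> Units R"
proof -
  interpret cring R by fact
  interpret root_extension R "UP R" n t
    by unfold_locales (rule assms(2))
  obtain u where "u \<in> carrier R" "add_pow R n \<one>\<^bsub>R\<^esub> \<otimes>\<^bsub>R\<^esub> u = \<one>\<^bsub>R\<^esub>"
    using assms(4) unfolding nat_invertible_def by blast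
  then show ?thesis
    using Units_if_separable[OF assms(3)] separable_if_Units by blast
qed


section \<open>The adele ring\<close>

lemma nat_invertible_hom:
  assumes "ring R" "ring S" "h \<in> ring_hom R S" "nat_invertible R n"
  shows "nat_invertible S n"
proof -
  interpret ring_hom_ring R S h by (rule ring_hom_ringI2[OF assms(1-3)])
  have "h (add_pow R k \<one>\<^bsub>R\<^esub>) = add_pow S k \<one>\<^bsub>S\<^esub>" for k :: nat
    by (induction k) simp_all
  moreover obtain u where "u \<in> carrier R" "add_pow R n \<one>\<^bsub>R\<^esub> \<otimes>\<^bsub>R\<^esub> u = \<one>\<^bsub>R\<^esub>"
    using assms(4) by (auto simp: nat_invertible_def)
  ultimately have "add_pow S n \<one>\<^bsub>S\<^esub> \<otimes>\<^bsub>S\<^esub> h u = \<one>\<^bsub>S\<^esub>" "h u \<in> carrier S"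
    by (metis R.add.nat_pow_closed R.one_closed hom_mult hom_one, simp)
  then show ?thesis by (auto simp: nat_invertible_def)
qed

subsection \<open>Local rings\<close>

lemma homogeneous_const: "homogeneous 0 (Poly_Mapping.single 0 c)"
  by (simp add: homogeneous_def)

lemma mpoly_eval_const: "mpoly_eval (Poly_Mapping.single 0 c) v = c"
  by (simp add: mpoly_eval_single)

lemma homogeneous_add: "homogeneous d p \<Longrightarrow> homogeneous d q \<Longrightarrow> homogeneous d (p + q)"
  using Poly_Mapping.keys_add[of p q] unfolding homogeneous_def by blast

lemma regular_fun_const:
  assumes "X \<subseteq> topspace zariski" "x \<in> X"
  shows "regular_fun_at X x (\<lambda>_. c)"
  unfolding regular_fun_at_def
  using assms homogeneous_const[of c] homogeneous_const[of 1]
  by (intro exI[of _ X] exI[of _ 0] exI[of _ "Poly_Mapping.single 0 c"] exI[of _ "Poly_Mapping.single 0 1"])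
    (simp add: openin_subtopology_refl mpoly_eval_const)

text \<open>On the intersection of both neighbourhoods fractions are combined over the product
  denominator; cross-multiplication leaves the numerator of the sum homogeneous of degree d + d', as
  required.\<close>

lemma
  assumes "regular_fun_at X x f" "regular_fun_at X x g"
  shows regular_fun_add: "regular_fun_at X x (\<lambda>y. f y + g y)"
    and regular_fun_mult: "regular_fun_at X x (\<lambda>y. f y * g y)"
proof -
  obtain U d p q where f: "openin (subtopology zariski X) U" "x \<in> U" "homogeneous d p" "homogeneous d q"
      "\<forall>y\<in>U. \<forall>v\<in>y. mpoly_eval q v \<noteq> 0 \<and> f y = mpoly_eval p v / mpoly_eval q v"
    using assms(1) unfolding regular_fun_at_def by blast
  obtain U' d' p' q' where g: "openin (subtopology zariski X) U'" "x \<in> U'" "homogeneous d' p'" "homogeneous d' q'"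
      "\<forall>y\<in>U'. \<forall>v\<in>y. mpoly_eval q' v \<noteq> 0 \<and> g y = mpoly_eval p' v / mpoly_eval q' v"
    using assms(2) unfolding regular_fun_at_def by blast
  have U: "openin (subtopology zariski X) (U \<inter> U')" "x \<in> U \<inter> U'"
    using f g by auto
  have hom: "homogeneous (d + d') (p * q' + q * p')" "homogeneous (d + d') (q * q')" "homogeneous (d + d') (p * p')"
    using f g by (auto intro: homogeneous_add homogeneous_mult)
  show "regular_fun_at X x (\<lambda>y. f y + g y)"
    unfolding regular_fun_at_def
    by (rule exI[of _ "U \<inter> U'"], rule exI[of _ "d + d'"], rule exI[of _ "p * q' + q * p'"], rule exI[of _ "q * q'"])
      (use U hom f(5) g(5) in \<open>auto simp: mpoly_eval_add mpoly_eval_mult add_frac_eq\<close>)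
  show "regular_fun_at X x (\<lambda>y. f y * g y)"
    unfolding regular_fun_at_def
    by (rule exI[of _ "U \<inter> U'"], rule exI[of _ "d + d'"], rule exI[of _ "p * p'"], rule exI[of _ "q * q'"])
      (use U hom f(5) g(5) in \<open>auto simp: mpoly_eval_mult\<close>)
qed

locale point_on =
  fixes X :: "('i::finite, 'k::field) point set" and x :: "('i, 'k) point"
  assumes X: "X \<subseteq> topspace zariski" and x: "x \<in> X"
begin

abbreviation F where "F \<equiv> regular_fun_ring X x"

lemma F_simps:
  "carrier F = {f. regular_fun_at X x f}" "f \<otimes>\<^bsub>F\<^esub> g = (\<lambda>y. f y * g y)" "\<one>\<^bsub>F\<^esub> = (\<lambda>_. 1)"
  "\<zero>\<^bsub>F\<^esub> = (\<lambda>_. 0)" "f \<oplus>\<^bsub>F\<^esub> g = (\<lambda>y. f y + g y)"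
  by (simp_all add: regular_fun_ring_def)

lemmas const = regular_fun_const[OF X x]

lemma regular_fun_uminus: "regular_fun_at X x f \<Longrightarrow> regular_fun_at X x (\<lambda>y. - f y)"
  using regular_fun_mult[OF const[of "- 1"]] by fastforce

lemma regular_fun_cring: "cring F"
proof (rule cringI)
  show "abelian_group F"
  proof (rule abelian_groupI)
    fix f assume "f \<in> carrier F"
    then show "\<exists>g\<in>carrier F. g \<oplus>\<^bsub>F\<^esub> f = \<zero>\<^bsub>F\<^esub>"
      by (intro bexI[of _ "\<lambda>y. - f y"]) (auto simp: F_simps regular_fun_uminus)
  qed (auto simp: F_simps regular_fun_add const algebra_simps)
  show "comm_monoid F"
    by (rule comm_monoidI) (auto simp: F_simps regular_fun_mult const algebra_simps)
qed (auto simp: F_simps algebra_simps)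

sublocale F: cring F by (rule regular_fun_cring)

lemma F_uminus: "f \<in> carrier F \<Longrightarrow> \<ominus>\<^bsub>F\<^esub> f = (\<lambda>y. - f y)"
  by (rule F.minus_equality) (auto simp: F_simps regular_fun_uminus)

text \<open>The inverse is the constant function 1/n. This is where the nonvanishing of n in the
  base field is turned into an inverse.\<close>

lemma regular_fun_nat_invertible:
  assumes "of_nat n \<noteq> (0 :: 'k)"
  shows "nat_invertible F n"
proof -
  have "add_pow F k \<one>\<^bsub>F\<^esub> = (\<lambda>_. of_nat k)" for k :: nat
    by (induction k) (simp_all add: F_simps algebra_simps)
  then show ?thesis
    unfolding nat_invertible_def using assms
    by (intro bexI[of _ "\<lambda>_. inverse (of_nat n)"]) (auto simp: F_simps const)
qed

lemma locally_zero_ideal: "ideal (locally_zero X x) F"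
proof (rule idealI)
  let ?Z = "locally_zero X x"
  have Z: "f \<in> ?Z \<longleftrightarrow> f \<in> carrier F \<and> (\<exists>U. openin (subtopology zariski X) U \<and> x \<in> U \<and> (\<forall>y\<in>U. f y = 0))" for f
    by (simp add: locally_zero_def)
  show "ring F" by (rule F.ring_axioms)
  have mult: "g \<otimes>\<^bsub>F\<^esub> f \<in> ?Z" if f: "f \<in> ?Z" and g: "g \<in> carrier F" for f g
  proof -
    have "g \<otimes>\<^bsub>F\<^esub> f \<in> carrier F" using that unfolding Z by blast
    moreover obtain U where "openin (subtopology zariski X) U" "x \<in> U" "\<forall>y\<in>U. f y = 0"
      using f unfolding Z by blast
    ultimately show ?thesis unfolding Z by (auto simp: F_simps(2))
  qed
  show "g \<otimes>\<^bsub>F\<^esub> f \<in> ?Z" "f \<otimes>\<^bsub>F\<^esub> g \<in> ?Z" if "f \<in> ?Z" "g \<in> carrier F" for f g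
    using mult[OF that] that F.m_comm[of f g] by (auto simp: Z)
  show "subgroup ?Z (add_monoid F)"
  proof
    show "?Z \<subseteq> carrier (add_monoid F)" by (auto simp: Z)
    show "\<one>\<^bsub>add_monoid F\<^esub> \<in> ?Z"
      using X x by (auto simp: Z F_simps const intro!: exI[of _ X] simp: openin_subtopology_refl)
    fix f assume f: "f \<in> ?Z"
    then have "f \<in> carrier F" by (simp add: Z)
    then have "inv\<^bsub>add_monoid F\<^esub> f = (\<lambda>y. - f y)" "\<ominus>\<^bsub>F\<^esub> f \<in> carrier F"
      unfolding a_inv_def[symmetric] by (simp_all add: F_uminus[symmetric])
    then show "inv\<^bsub>add_monoid F\<^esub> f \<in> ?Z"
      using f F_uminus[OF \<open>f \<in> carrier F\<close>] by (auto simp: Z)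
    fix g assume g: "g \<in> ?Z"
    obtain U V where "openin (subtopology zariski X) U" "x \<in> U" "\<forall>y\<in>U. f y = 0"
      "openin (subtopology zariski X) V" "x \<in> V" "\<forall>y\<in>V. g y = 0"
      using f g unfolding Z by blast
    then have "openin (subtopology zariski X) (U \<inter> V) \<and> x \<in> U \<inter> V \<and> (\<forall>y\<in>U \<inter> V. (f \<oplus>\<^bsub>F\<^esub> g) y = 0)"
      by (auto simp: F_simps(5))
    moreover have "f \<oplus>\<^bsub>F\<^esub> g \<in> carrier F" using f g by (simp add: Z)
    ultimately have "f \<oplus>\<^bsub>F\<^esub> g \<in> ?Z" unfolding Z by blast
    then show "f \<otimes>\<^bsub>add_monoid F\<^esub> g \<in> ?Z" by simp
  qed
qed

sublocale Z: ideal "locally_zero X x" F by (rule locally_zero_ideal)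

lemma local_ring_cring: "cring (local_ring X x)"
  unfolding local_ring_def by (rule Z.quotient_is_cring) (rule F.cring_axioms)

lemma local_ring_nat_invertible:
  assumes "of_nat n \<noteq> (0 :: 'k)"
  shows "nat_invertible (local_ring X x) n"
proof (rule nat_invertible_hom[OF F.ring_axioms _ _ regular_fun_nat_invertible[OF assms]])
  show "ring (local_ring X x)" using local_ring_cring by (rule cring.axioms)
  show "(\<lambda>f. locally_zero X x +>\<^bsub>F\<^esub> f) \<in> ring_hom F (local_ring X x)"
    unfolding local_ring_def by (rule Z.rcos_ring_hom)
qed

lemma vanishing_ideal: "ideal {f \<in> carrier F. f x = 0} F"
proof (rule idealI)
  show "ring F" by (rule F.ring_axioms)
  show "subgroup {f \<in> carrier F. f x = 0} (add_monoid F)"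
  proof
    fix f assume "f \<in> {f \<in> carrier F. f x = 0}"
    then show "inv\<^bsub>add_monoid F\<^esub> f \<in> {f \<in> carrier F. f x = 0}"
      unfolding a_inv_def[symmetric] using F.a_inv_closed[of f] by (simp add: F_uminus)
  next
    fix f g assume "f \<in> {f \<in> carrier F. f x = 0}" "g \<in> {f \<in> carrier F. f x = 0}"
    then show "f \<otimes>\<^bsub>add_monoid F\<^esub> g \<in> {f \<in> carrier F. f x = 0}"
      using F.a_closed[of f g] by (simp add: F_simps(5))
  qed (auto simp: F_simps const)
  fix f g assume "f \<in> {f \<in> carrier F. f x = 0}" "g \<in> carrier F"
  then show "g \<otimes>\<^bsub>F\<^esub> f \<in> {f \<in> carrier F. f x = 0}" "f \<otimes>\<^bsub>F\<^esub> g \<in> {f \<in> carrier F. f x = 0}"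
    using F.m_closed[of f g] F.m_closed[of g f] by (simp_all add: F_simps(2))
qed

text \<open>By definition some representative of the germ vanishes at x. Taking that one as coset
  representative exhibits the set as the image of an ideal of functions, hence as an ideal; the
  completion needs this.\<close>

lemma local_max_ideal_eq:
  "local_max_ideal X x = (+>\<^bsub>F\<^esub>) (locally_zero X x) ` {f \<in> carrier F. f x = 0}"
proof
  show "local_max_ideal X x \<subseteq> (+>\<^bsub>F\<^esub>) (locally_zero X x) ` {f \<in> carrier F. f x = 0}"
  proof
    fix a assume "a \<in> local_max_ideal X x"
    then obtain g f where g: "g \<in> carrier F" "a = locally_zero X x +>\<^bsub>F\<^esub> g" and f: "f \<in> a" "f x = 0"
      by (auto simp: local_max_ideal_def local_ring_def carrier_Quot)
    have fc: "f \<in> carrier F"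
      using f g Z.a_subset F.a_r_coset_subset_G[of "locally_zero X x" g] by blast
    have "locally_zero X x +>\<^bsub>F\<^esub> g = locally_zero X x +>\<^bsub>F\<^esub> f"
      using f(1) g(1) unfolding g(2) by (rule F.a_repr_independence[OF _ _ Z.a_subgroup])
    then show "a \<in> (+>\<^bsub>F\<^esub>) (locally_zero X x) ` {f \<in> carrier F. f x = 0}"
      using f(2) g(2) fc by blast
  qed
  show "(+>\<^bsub>F\<^esub>) (locally_zero X x) ` {f \<in> carrier F. f x = 0} \<subseteq> local_max_ideal X x"
    using Z.a_rcos_self by (auto simp: local_max_ideal_def local_ring_def carrier_Quot)
qed

lemma local_max_ideal: "ideal (local_max_ideal X x) (local_ring X x)"
  unfolding local_max_ideal_eq local_ring_def
  by (rule F.ring_ideal_imp_quot_ideal[OF locally_zero_ideal vanishing_ideal])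

end

subsection \<open>Completions\<close>

locale adic = cring R + I: ideal I R for R (structure) and I
begin

abbreviation Ik where "Ik k \<equiv> ideal_pow R I k"
abbreviation Rk where "Rk k \<equiv> R Quot Ik k"
abbreviation C where "C \<equiv> adic_completion R I"

lemma Ik_ideal: "ideal (Ik k) R"
  by (induction k) (simp_all add: oneideal ideal_prod_is_ideal I.ideal_axioms)

lemma Ik_Suc: "Ik (Suc k) \<subseteq> Ik k"
  using ideal_prod_inter[OF I.ideal_axioms Ik_ideal] by auto

lemma Rk_cring: "cring (Rk k)"
  by (rule ideal.quotient_is_cring[OF Ik_ideal cring_axioms])

lemma Rk_hom: "(\<lambda>a. Ik k +> a) \<in> ring_hom R (Rk k)"
  by (rule ideal.rcos_ring_hom[OF Ik_ideal])

lemma C_simps: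
  "carrier C = {\<alpha>. \<forall>k. \<alpha> k \<in> carrier (Rk k) \<and> \<alpha> (Suc k) \<subseteq> \<alpha> k}"
  "\<alpha> \<otimes>\<^bsub>C\<^esub> \<beta> = (\<lambda>k. \<alpha> k \<otimes>\<^bsub>Rk k\<^esub> \<beta> k)" "\<one>\<^bsub>C\<^esub> = (\<lambda>k. \<one>\<^bsub>Rk k\<^esub>)"
  "\<zero>\<^bsub>C\<^esub> = (\<lambda>k. \<zero>\<^bsub>Rk k\<^esub>)" "\<alpha> \<oplus>\<^bsub>C\<^esub> \<beta> = (\<lambda>k. \<alpha> k \<oplus>\<^bsub>Rk k\<^esub> \<beta> k)"
  by (simp_all add: adic_completion_def)

lemma coset_mono: "Ik (Suc k) +> a \<subseteq> Ik k +> a"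
  using Ik_Suc[of k] by (auto simp: a_r_coset_def')

text \<open>Compatibility is inclusion of cosets, so a representative at level k + 1 also represents
  level k. Sharing one representative reduces closure under an operation to the fact that both
  projections are homomorphisms.\<close>

lemma C_repr:
  assumes "\<alpha> \<in> carrier C"
  obtains a where "a \<in> carrier R" "\<alpha> k = Ik k +> a" "\<alpha> (Suc k) = Ik (Suc k) +> a"
proof -
  have \<alpha>: "\<alpha> k \<in> carrier (Rk k)" "\<alpha> (Suc k) \<in> carrier (Rk (Suc k))" "\<alpha> (Suc k) \<subseteq> \<alpha> k"
    using assms unfolding C_simps by blast+
  obtain a where a: "a \<in> carrier R" "\<alpha> (Suc k) = Ik (Suc k) +> a"
    using \<alpha>(2) unfolding carrier_Quot by blast
  obtain b where b: "b \<in> carrier R" "\<alpha> k = Ik k +> b"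
    using \<alpha>(1) unfolding carrier_Quot by blast
  interpret Ik: ideal "Ik k" R by (rule Ik_ideal)
  interpret Ik': ideal "Ik (Suc k)" R by (rule Ik_ideal)
  have "a \<in> Ik k +> b" using Ik'.a_rcos_self[OF a(1)] a(2) b(2) \<alpha>(3) by blast
  then have "Ik k +> b = Ik k +> a" using b(1) by (rule a_repr_independence[OF _ _ Ik.a_subgroup])
  then show ?thesis using that a b by simp
qed

text \<open>The representative may vary with k; only two consecutive levels have to share one, which
  is what \<open>C_repr\<close> supplies.\<close>

lemma C_memI:
  assumes "\<And>k. \<exists>a\<in>carrier R. \<alpha> k = Ik k +> a \<and> \<alpha> (Suc k) = Ik (Suc k) +> a"
  shows "\<alpha> \<in> carrier C"
proof -
  have "\<alpha> k \<in> carrier (Rk k) \<and> \<alpha> (Suc k) \<subseteq> \<alpha> k" for k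
    using assms[of k] coset_mono[of k] unfolding carrier_Quot by blast
  then show ?thesis unfolding C_simps by blast
qed

lemma C_coset: "a \<in> carrier R \<Longrightarrow> (\<lambda>k. Ik k +> a) \<in> carrier C"
  by (rule C_memI) blast

lemma C_mult_closed:
  assumes "\<alpha> \<in> carrier C" "\<beta> \<in> carrier C"
  shows "\<alpha> \<otimes>\<^bsub>C\<^esub> \<beta> \<in> carrier C"
proof (rule C_memI)
  fix k
  obtain a where a: "a \<in> carrier R" "\<alpha> k = Ik k +> a" "\<alpha> (Suc k) = Ik (Suc k) +> a"
    using assms(1) by (rule C_repr)
  obtain b where b: "b \<in> carrier R" "\<beta> k = Ik k +> b" "\<beta> (Suc k) = Ik (Suc k) +> b"
    using assms(2) by (rule C_repr)
  show "\<exists>c\<in>carrier R. (\<alpha> \<otimes>\<^bsub>C\<^esub> \<beta>) k = Ik k +> c \<and> (\<alpha> \<otimes>\<^bsub>C\<^esub> \<beta>) (Suc k) = Ik (Suc k) +> c"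
    unfolding C_simps a b
    by (intro bexI[of _ "a \<otimes> b"] conjI ring_hom_mult[OF Rk_hom, symmetric] m_closed a b)
qed

lemma C_add_closed:
  assumes "\<alpha> \<in> carrier C" "\<beta> \<in> carrier C"
  shows "\<alpha> \<oplus>\<^bsub>C\<^esub> \<beta> \<in> carrier C"
proof (rule C_memI)
  fix k
  obtain a where a: "a \<in> carrier R" "\<alpha> k = Ik k +> a" "\<alpha> (Suc k) = Ik (Suc k) +> a"
    using assms(1) by (rule C_repr)
  obtain b where b: "b \<in> carrier R" "\<beta> k = Ik k +> b" "\<beta> (Suc k) = Ik (Suc k) +> b"
    using assms(2) by (rule C_repr)
  show "\<exists>c\<in>carrier R. (\<alpha> \<oplus>\<^bsub>C\<^esub> \<beta>) k = Ik k +> c \<and> (\<alpha> \<oplus>\<^bsub>C\<^esub> \<beta>) (Suc k) = Ik (Suc k) +> c"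
    unfolding C_simps a b
    by (intro bexI[of _ "a \<oplus> b"] conjI ring_hom_add[OF Rk_hom, symmetric] a_closed a b)
qed

lemma C_one: "\<one>\<^bsub>C\<^esub> = (\<lambda>k. Ik k +> \<one>)"
  unfolding C_simps by (rule ext) (rule ring_hom_one[OF Rk_hom, symmetric])

lemma C_zero: "\<zero>\<^bsub>C\<^esub> = (\<lambda>k. Ik k +> \<zero>)"
proof -
  have "\<zero>\<^bsub>Rk k\<^esub> = Ik k +> \<zero>" for k
    using ring_hom_zero[OF Rk_hom ring_axioms cring.axioms(1)[OF Rk_cring], of k] by simp
  then show ?thesis unfolding C_simps by blast
qed

lemma C_uminus_closed:
  assumes "\<alpha> \<in> carrier C"
  shows "(\<lambda>k. \<ominus>\<^bsub>Rk k\<^esub> \<alpha> k) \<in> carrier C"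
proof (rule C_memI)
  fix k
  obtain a where a: "a \<in> carrier R" "\<alpha> k = Ik k +> a" "\<alpha> (Suc k) = Ik (Suc k) +> a"
    using assms by (rule C_repr)
  have m: "Ik k +> (\<ominus> a) = \<ominus>\<^bsub>Rk k\<^esub> (Ik k +> a)" for k
  proof -
    interpret h: ring_hom_ring R "Rk k" "\<lambda>a. Ik k +> a"
      by (rule ideal.rcos_ring_hom_ring[OF Ik_ideal])
    show ?thesis using a(1) by (rule h.hom_a_inv)
  qed
  show "\<exists>c\<in>carrier R. \<ominus>\<^bsub>Rk k\<^esub> \<alpha> k = Ik k +> c \<and> \<ominus>\<^bsub>Rk (Suc k)\<^esub> \<alpha> (Suc k) = Ik (Suc k) +> c"
    unfolding a by (intro bexI[of _ "\<ominus> a"] conjI m[symmetric] a_inv_closed a)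
qed

lemma completion_cring: "cring C"
proof -
  have mem: "\<alpha> k \<in> carrier (Rk k)" if "\<alpha> \<in> carrier C" for \<alpha> k
    using that unfolding C_simps by blast
  note Rk = Rk_cring[THEN cring.axioms(1)]
  show ?thesis
  proof (rule cringI)
    show "abelian_group C"
    proof (rule abelian_groupI)
      show "\<zero>\<^bsub>C\<^esub> \<in> carrier C" unfolding C_zero by (rule C_coset) simp
    next
      fix \<alpha> \<beta> \<gamma> assume a: "\<alpha> \<in> carrier C" "\<beta> \<in> carrier C" "\<gamma> \<in> carrier C"
      note m = a[THEN mem]
      show "(\<alpha> \<oplus>\<^bsub>C\<^esub> \<beta>) \<oplus>\<^bsub>C\<^esub> \<gamma> = \<alpha> \<oplus>\<^bsub>C\<^esub> (\<beta> \<oplus>\<^bsub>C\<^esub> \<gamma>)"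
        unfolding C_simps using m by (intro ext abelian_monoid.a_assoc[OF abelian_group.axioms(1)[OF ring.is_abelian_group[OF Rk]]])
    next
      fix \<alpha> \<beta> assume a: "\<alpha> \<in> carrier C" "\<beta> \<in> carrier C"
      note m = a[THEN mem]
      show "\<alpha> \<oplus>\<^bsub>C\<^esub> \<beta> = \<beta> \<oplus>\<^bsub>C\<^esub> \<alpha>"
        unfolding C_simps using m by (intro ext abelian_monoid.a_comm[OF abelian_group.axioms(1)[OF ring.is_abelian_group[OF Rk]]])
    next
      fix \<alpha> assume a: "\<alpha> \<in> carrier C"
      note m = mem[OF a]
      show "\<zero>\<^bsub>C\<^esub> \<oplus>\<^bsub>C\<^esub> \<alpha> = \<alpha>"
        unfolding C_simps using m by (intro ext abelian_monoid.l_zero[OF abelian_group.axioms(1)[OF ring.is_abelian_group[OF Rk]]])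
      show "\<exists>\<beta>\<in>carrier C. \<beta> \<oplus>\<^bsub>C\<^esub> \<alpha> = \<zero>\<^bsub>C\<^esub>"
        by (rule bexI[OF _ C_uminus_closed[OF a]])
          (unfold C_simps, intro ext abelian_group.l_neg[OF ring.is_abelian_group[OF Rk]] m)
    qed (rule C_add_closed)
    show "comm_monoid C"
    proof (rule comm_monoidI)
      show "\<one>\<^bsub>C\<^esub> \<in> carrier C" unfolding C_one by (rule C_coset) simp
    next
      fix \<alpha> \<beta> \<gamma> assume a: "\<alpha> \<in> carrier C" "\<beta> \<in> carrier C" "\<gamma> \<in> carrier C"
      note m = a[THEN mem]
      show "(\<alpha> \<otimes>\<^bsub>C\<^esub> \<beta>) \<otimes>\<^bsub>C\<^esub> \<gamma> = \<alpha> \<otimes>\<^bsub>C\<^esub> (\<beta> \<otimes>\<^bsub>C\<^esub> \<gamma>)"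
        unfolding C_simps using m by (intro ext monoid.m_assoc[OF ring.is_monoid[OF Rk]])
    next
      fix \<alpha> \<beta> assume a: "\<alpha> \<in> carrier C" "\<beta> \<in> carrier C"
      note m = a[THEN mem]
      show "\<alpha> \<otimes>\<^bsub>C\<^esub> \<beta> = \<beta> \<otimes>\<^bsub>C\<^esub> \<alpha>"
        unfolding C_simps using m by (intro ext comm_monoid.m_comm[OF cring.axioms(2)[OF Rk_cring]])
    next
      fix \<alpha> assume a: "\<alpha> \<in> carrier C"
      note m = mem[OF a]
      show "\<one>\<^bsub>C\<^esub> \<otimes>\<^bsub>C\<^esub> \<alpha> = \<alpha>"
        unfolding C_simps using m by (intro ext monoid.l_one[OF ring.is_monoid[OF Rk]])
    qed (rule C_mult_closed)
    fix \<alpha> \<beta> \<gamma> assume a: "\<alpha> \<in> carrier C" "\<beta> \<in> carrier C" "\<gamma> \<in> carrier C"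
    note m = a[THEN mem]
    show "(\<alpha> \<oplus>\<^bsub>C\<^esub> \<beta>) \<otimes>\<^bsub>C\<^esub> \<gamma> = \<alpha> \<otimes>\<^bsub>C\<^esub> \<gamma> \<oplus>\<^bsub>C\<^esub> \<beta> \<otimes>\<^bsub>C\<^esub> \<gamma>"
      unfolding C_simps using m by (intro ext ringE(3)[OF Rk])
  qed
qed

lemma completion_hom: "(\<lambda>a k. Ik k +> a) \<in> ring_hom R C"
  by (rule ring_hom_memI)
    (simp_all only: C_coset C_one C_simps(2,5) ring_hom_mult[OF Rk_hom] ring_hom_add[OF Rk_hom])

end

subsection \<open>Fractions\<close>

locale ring_of_fractions = cring R for R (structure)
begin

abbreviation S where "S \<equiv> non_zero_divisors R"
abbreviation K where "K \<equiv> fraction_ring R"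

lemma S_closed: "s \<in> S \<Longrightarrow> s \<in> carrier R"
  by (simp add: non_zero_divisors_def)

lemma S_cancel:
  assumes "s \<in> S" "a \<in> carrier R" "b \<in> carrier R" "a \<otimes> s = b \<otimes> s"
  shows "a = b"
proof -
  have s: "s \<in> carrier R" using assms(1) by (rule S_closed)
  have "(a \<ominus> b) \<otimes> s = a \<otimes> s \<ominus> b \<otimes> s" using s assms(2,3) by algebra
  also have "\<dots> = \<zero>" using s assms(2-4) by (simp add: a_minus_def r_neg)
  finally have "a \<ominus> b = \<zero>" using assms(1-3) by (simp add: non_zero_divisors_def)
  moreover have "a = (a \<ominus> b) \<oplus> b" using assms(2,3) by algebra
  ultimately show ?thesis using assms(2,3) by simp
qed

lemma S_one: "\<one> \<in> S"
  by (simp add: non_zero_divisors_def)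

lemma S_mult:
  assumes "s \<in> S" "u \<in> S"
  shows "s \<otimes> u \<in> S"
proof -
  have su: "s \<in> carrier R" "u \<in> carrier R" using assms by (simp_all add: S_closed)
  have "a = \<zero>" if "a \<in> carrier R" "a \<otimes> (s \<otimes> u) = \<zero>" for a
  proof -
    have "(a \<otimes> s) \<otimes> u = \<zero>" using that su by (simp add: m_assoc)
    then have "a \<otimes> s = \<zero>" using assms(2) that su by (simp add: non_zero_divisors_def)
    then show ?thesis using assms(1) that by (simp add: non_zero_divisors_def)
  qed
  then show ?thesis using su by (simp add: non_zero_divisors_def)
qed

lemma fraction_self: "a \<in> carrier R \<Longrightarrow> s \<in> S \<Longrightarrow> (a, s) \<in> fraction R a s"
  by (simp add: fraction_def)

lemma fraction_memD: "(b, u) \<in> fraction R a s \<Longrightarrow> b \<in> carrier R \<and> u \<in> S \<and> a \<otimes> u = b \<otimes> s"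
  by (simp add: fraction_def)

text \<open>Transitivity of the equivalence of fractions: after cross-multiplication a common factor
  s remains, which cancels because it is not a zero divisor.\<close>

lemma fraction_subset:
  assumes "a \<in> carrier R" "b \<in> carrier R" "s \<in> S" "u \<in> S" "a \<otimes> u = b \<otimes> s"
  shows "fraction R a s \<subseteq> fraction R b u"
proof clarify
  fix c w assume "(c, w) \<in> fraction R a s"
  then have c: "c \<in> carrier R" "w \<in> S" "a \<otimes> w = c \<otimes> s" by (auto dest: fraction_memD)
  note cl = assms(1,2) c(1) assms(3,4)[THEN S_closed] c(2)[THEN S_closed]
  have "(b \<otimes> w) \<otimes> s = (b \<otimes> s) \<otimes> w" using cl by algebra
  also have "\<dots> = (a \<otimes> w) \<otimes> u" unfolding assms(5)[symmetric] using cl by algebra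
  also have "\<dots> = (c \<otimes> u) \<otimes> s" unfolding c(3) using cl by algebra
  finally have "b \<otimes> w = c \<otimes> u" using S_cancel[OF assms(3)] cl by simp
  then show "(c, w) \<in> fraction R b u" using c by (simp add: fraction_def)
qed

lemma fraction_eqI:
  assumes "a \<in> carrier R" "b \<in> carrier R" "s \<in> S" "u \<in> S" "a \<otimes> u = b \<otimes> s"
  shows "fraction R a s = fraction R b u"
  using fraction_subset[OF assms] fraction_subset[OF assms(2,1,4,3) assms(5)[symmetric]] by blast

text \<open>The operation is a union over all pairs of representatives. All members of this union
  coincide, and \<open>fraction_self\<close> shows that there is one, so the union is a single
  class.\<close>

lemma fraction_mult:
  assumes "a \<in> carrier R" "b \<in> carrier R" "s \<in> S" "u \<in> S"
  shows "fraction R a s \<otimes>\<^bsub>K\<^esub> fraction R b u = fraction R (a \<otimes> b) (s \<otimes> u)"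
proof -
  have eq: "fraction R (a' \<otimes> b') (s' \<otimes> u') = fraction R (a \<otimes> b) (s \<otimes> u)"
    if "(a', s') \<in> fraction R a s" "(b', u') \<in> fraction R b u" for a' s' b' u'
  proof -
    have a': "a' \<in> carrier R" "s' \<in> S" "a \<otimes> s' = a' \<otimes> s" and b': "b' \<in> carrier R" "u' \<in> S" "b \<otimes> u' = b' \<otimes> u"
      using that by (auto dest: fraction_memD)
    note cl = assms(1,2) a'(1) b'(1) assms(3,4)[THEN S_closed] a'(2)[THEN S_closed] b'(2)[THEN S_closed]
    have "(a' \<otimes> b') \<otimes> (s \<otimes> u) = (a' \<otimes> s) \<otimes> (b' \<otimes> u)" using cl by algebra
    also have "\<dots> = (a \<otimes> b) \<otimes> (s' \<otimes> u')" unfolding a'(3)[symmetric] b'(3)[symmetric] using cl by algebra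
    finally show ?thesis using cl a' b' assms by (intro fraction_eqI S_mult m_closed)
  qed
  have "fraction R a s \<otimes>\<^bsub>K\<^esub> fraction R b u
      = (\<Union>(a', s')\<in>fraction R a s. \<Union>(b', u')\<in>fraction R b u. fraction R (a' \<otimes> b') (s' \<otimes> u'))"
    by (simp add: fraction_ring_def)
  also have "\<dots> = fraction R (a \<otimes> b) (s \<otimes> u)"
    using eq fraction_self[OF assms(1,3)] fraction_self[OF assms(2,4)] by (intro equalityI) blast+
  finally show ?thesis .
qed

lemma fraction_add:
  assumes "a \<in> carrier R" "b \<in> carrier R" "s \<in> S" "u \<in> S"
  shows "fraction R a s \<oplus>\<^bsub>K\<^esub> fraction R b u = fraction R (a \<otimes> u \<oplus> b \<otimes> s) (s \<otimes> u)"
proof -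
  have eq: "fraction R (a' \<otimes> u' \<oplus> b' \<otimes> s') (s' \<otimes> u') = fraction R (a \<otimes> u \<oplus> b \<otimes> s) (s \<otimes> u)"
    if "(a', s') \<in> fraction R a s" "(b', u') \<in> fraction R b u" for a' s' b' u'
  proof -
    have a': "a' \<in> carrier R" "s' \<in> S" "a \<otimes> s' = a' \<otimes> s" and b': "b' \<in> carrier R" "u' \<in> S" "b \<otimes> u' = b' \<otimes> u"
      using that by (auto dest: fraction_memD)
    note cl = assms(1,2) a'(1) b'(1) assms(3,4)[THEN S_closed] a'(2)[THEN S_closed] b'(2)[THEN S_closed]
    have "(a' \<otimes> u' \<oplus> b' \<otimes> s') \<otimes> (s \<otimes> u) = (a' \<otimes> s) \<otimes> (u \<otimes> u') \<oplus> (b' \<otimes> u) \<otimes> (s \<otimes> s')" using cl by algebra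
    also have "\<dots> = (a \<otimes> u \<oplus> b \<otimes> s) \<otimes> (s' \<otimes> u')" unfolding a'(3)[symmetric] b'(3)[symmetric] using cl by algebra
    finally show ?thesis using cl a' b' assms by (intro fraction_eqI S_mult m_closed a_closed)
  qed
  have "fraction R a s \<oplus>\<^bsub>K\<^esub> fraction R b u
      = (\<Union>(a', s')\<in>fraction R a s. \<Union>(b', u')\<in>fraction R b u. fraction R (a' \<otimes> u' \<oplus> b' \<otimes> s') (s' \<otimes> u'))"
    by (simp add: fraction_ring_def)
  also have "\<dots> = fraction R (a \<otimes> u \<oplus> b \<otimes> s) (s \<otimes> u)"
    using eq fraction_self[OF assms(1,3)] fraction_self[OF assms(2,4)] by (intro equalityI) blast+
  finally show ?thesis .
qed

lemma fraction_closed: "a \<in> carrier R \<Longrightarrow> s \<in> S \<Longrightarrow> fraction R a s \<in> carrier K"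
  unfolding fraction_ring_def by auto

lemma fractionE:
  assumes "z \<in> carrier K"
  obtains a s where "a \<in> carrier R" "s \<in> S" "z = fraction R a s"
  using assms unfolding fraction_ring_def by auto

lemma K_one: "\<one>\<^bsub>K\<^esub> = fraction R \<one> \<one>" and K_zero: "\<zero>\<^bsub>K\<^esub> = fraction R \<zero> \<one>"
  by (simp_all add: fraction_ring_def)

lemma fraction_ring_cring: "cring K"
proof (rule cringI)
  show "abelian_group K"
  proof (rule abelian_groupI)
    show "\<zero>\<^bsub>K\<^esub> \<in> carrier K" unfolding K_zero by (intro fraction_closed S_one zero_closed)
  next
    fix x y assume "x \<in> carrier K" "y \<in> carrier K"
    then obtain a s b u where x: "a \<in> carrier R" "s \<in> S" "x = fraction R a s" and y: "b \<in> carrier R" "u \<in> S" "y = fraction R b u"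
      by (metis fractionE)
    note cl = x(1) y(1) x(2)[THEN S_closed] y(2)[THEN S_closed]
    show "x \<oplus>\<^bsub>K\<^esub> y \<in> carrier K"
      unfolding x(3) y(3) fraction_add[OF x(1) y(1) x(2) y(2)] using cl x y
      by (intro fraction_closed S_mult) simp_all
    have "a \<otimes> u \<oplus> b \<otimes> s = b \<otimes> s \<oplus> a \<otimes> u" "s \<otimes> u = u \<otimes> s" using cl by algebra+
    then show "x \<oplus>\<^bsub>K\<^esub> y = y \<oplus>\<^bsub>K\<^esub> x"
      unfolding x(3) y(3) fraction_add[OF x(1) y(1) x(2) y(2)] fraction_add[OF y(1) x(1) y(2) x(2)] by simp
    fix z assume "z \<in> carrier K"
    then obtain c w where z: "c \<in> carrier R" "w \<in> S" "z = fraction R c w" by (rule fractionE)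
    note cl = cl z(1) z(2)[THEN S_closed]
    have ss: "s \<otimes> u \<in> S" "u \<otimes> w \<in> S" and cc: "a \<otimes> u \<oplus> b \<otimes> s \<in> carrier R" "b \<otimes> w \<oplus> c \<otimes> u \<in> carrier R"
      using x y z cl by (auto intro: S_mult)
    have "(a \<otimes> u \<oplus> b \<otimes> s) \<otimes> w \<oplus> c \<otimes> (s \<otimes> u) = a \<otimes> (u \<otimes> w) \<oplus> (b \<otimes> w \<oplus> c \<otimes> u) \<otimes> s"
      "s \<otimes> u \<otimes> w = s \<otimes> (u \<otimes> w)" using cl by algebra+
    then show "(x \<oplus>\<^bsub>K\<^esub> y) \<oplus>\<^bsub>K\<^esub> z = x \<oplus>\<^bsub>K\<^esub> (y \<oplus>\<^bsub>K\<^esub> z)"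
      unfolding x(3) y(3) z(3) fraction_add[OF x(1) y(1) x(2) y(2)] fraction_add[OF y(1) z(1) y(2) z(2)]
        fraction_add[OF cc(1) z(1) ss(1) z(2)] fraction_add[OF x(1) cc(2) x(2) ss(2)] by simp
  next
    fix x assume "x \<in> carrier K"
    then obtain a s where x: "a \<in> carrier R" "s \<in> S" "x = fraction R a s" by (rule fractionE)
    note cl = x(1) x(2)[THEN S_closed]
    show "\<zero>\<^bsub>K\<^esub> \<oplus>\<^bsub>K\<^esub> x = x"
      unfolding x(3) K_zero fraction_add[OF zero_closed x(1) S_one x(2)] using cl by simp
    have "fraction R (\<ominus> a) s \<oplus>\<^bsub>K\<^esub> x = fraction R (\<ominus> a \<otimes> s \<oplus> a \<otimes> s) (s \<otimes> s)"
      unfolding x(3) by (rule fraction_add[OF a_inv_closed[OF x(1)] x(1) x(2) x(2)])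
    also have "\<dots> = \<zero>\<^bsub>K\<^esub>"
      unfolding K_zero by (rule fraction_eqI) (use cl x in \<open>simp_all add: S_one S_mult l_minus l_neg\<close>)
    finally show "\<exists>y\<in>carrier K. y \<oplus>\<^bsub>K\<^esub> x = \<zero>\<^bsub>K\<^esub>"
      using fraction_closed[OF a_inv_closed[OF x(1)] x(2)] by blast
  qed
  show "comm_monoid K"
  proof (rule comm_monoidI)
    show "\<one>\<^bsub>K\<^esub> \<in> carrier K" unfolding K_one by (intro fraction_closed S_one one_closed)
  next
    fix x y assume "x \<in> carrier K" "y \<in> carrier K"
    then obtain a s b u where x: "a \<in> carrier R" "s \<in> S" "x = fraction R a s" and y: "b \<in> carrier R" "u \<in> S" "y = fraction R b u"
      by (metis fractionE)
    note cl = x(1) y(1) x(2)[THEN S_closed] y(2)[THEN S_closed]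
    show "x \<otimes>\<^bsub>K\<^esub> y \<in> carrier K"
      unfolding x(3) y(3) fraction_mult[OF x(1) y(1) x(2) y(2)] using cl x y
      by (intro fraction_closed S_mult) simp_all
    show "x \<otimes>\<^bsub>K\<^esub> y = y \<otimes>\<^bsub>K\<^esub> x"
      unfolding x(3) y(3) fraction_mult[OF x(1) y(1) x(2) y(2)] fraction_mult[OF y(1) x(1) y(2) x(2)]
      using cl by (simp add: m_comm)
    fix z assume "z \<in> carrier K"
    then obtain c w where z: "c \<in> carrier R" "w \<in> S" "z = fraction R c w" by (rule fractionE)
    note cl = cl z(1) z(2)[THEN S_closed]
    show "(x \<otimes>\<^bsub>K\<^esub> y) \<otimes>\<^bsub>K\<^esub> z = x \<otimes>\<^bsub>K\<^esub> (y \<otimes>\<^bsub>K\<^esub> z)"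
      unfolding x(3) y(3) z(3) fraction_mult[OF x(1) y(1) x(2) y(2)] fraction_mult[OF y(1) z(1) y(2) z(2)]
        fraction_mult[OF m_closed[OF x(1) y(1)] z(1) S_mult[OF x(2) y(2)] z(2)]
        fraction_mult[OF x(1) m_closed[OF y(1) z(1)] x(2) S_mult[OF y(2) z(2)]]
      using cl by (simp add: m_assoc)
  next
    fix x assume "x \<in> carrier K"
    then obtain a s where x: "a \<in> carrier R" "s \<in> S" "x = fraction R a s" by (rule fractionE)
    show "\<one>\<^bsub>K\<^esub> \<otimes>\<^bsub>K\<^esub> x = x"
      unfolding x(3) K_one fraction_mult[OF one_closed x(1) S_one x(2)] using x S_closed by simp
  qed
  fix x y z assume "x \<in> carrier K" "y \<in> carrier K" "z \<in> carrier K"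
  then obtain a s b u c w where x: "a \<in> carrier R" "s \<in> S" "x = fraction R a s"
    and y: "b \<in> carrier R" "u \<in> S" "y = fraction R b u" and z: "c \<in> carrier R" "w \<in> S" "z = fraction R c w"
    by (metis fractionE)
  note cl = x(1) y(1) z(1) x(2)[THEN S_closed] y(2)[THEN S_closed] z(2)[THEN S_closed]
  have cc: "a \<otimes> u \<oplus> b \<otimes> s \<in> carrier R" using cl by simp
  have "(x \<oplus>\<^bsub>K\<^esub> y) \<otimes>\<^bsub>K\<^esub> z = fraction R ((a \<otimes> u \<oplus> b \<otimes> s) \<otimes> c) ((s \<otimes> u) \<otimes> w)"
    unfolding x(3) y(3) z(3) fraction_add[OF x(1) y(1) x(2) y(2)]
      fraction_mult[OF cc z(1) S_mult[OF x(2) y(2)] z(2)] ..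
  \<comment> \<open>Numerator and denominator are both expanded by the factor w, so the classes
    agree although the representatives differ.\<close>
  also have "\<dots> = fraction R ((a \<otimes> c) \<otimes> (u \<otimes> w) \<oplus> (b \<otimes> c) \<otimes> (s \<otimes> w)) ((s \<otimes> w) \<otimes> (u \<otimes> w))"
  proof (rule fraction_eqI)
    show "((a \<otimes> u \<oplus> b \<otimes> s) \<otimes> c) \<otimes> ((s \<otimes> w) \<otimes> (u \<otimes> w))
        = ((a \<otimes> c) \<otimes> (u \<otimes> w) \<oplus> (b \<otimes> c) \<otimes> (s \<otimes> w)) \<otimes> ((s \<otimes> u) \<otimes> w)"
      using cl by algebra
  qed (use cl x y z in \<open>simp_all add: S_mult\<close>)
  also have "\<dots> = x \<otimes>\<^bsub>K\<^esub> z \<oplus>\<^bsub>K\<^esub> y \<otimes>\<^bsub>K\<^esub> z"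
    unfolding x(3) y(3) z(3) fraction_mult[OF x(1) z(1) x(2) z(2)] fraction_mult[OF y(1) z(1) y(2) z(2)]
      fraction_add[OF m_closed[OF x(1) z(1)] m_closed[OF y(1) z(1)] S_mult[OF x(2) z(2)] S_mult[OF y(2) z(2)]] ..
  finally show "(x \<oplus>\<^bsub>K\<^esub> y) \<otimes>\<^bsub>K\<^esub> z = x \<otimes>\<^bsub>K\<^esub> z \<oplus>\<^bsub>K\<^esub> y \<otimes>\<^bsub>K\<^esub> z" .
qed

lemma fraction_hom: "(\<lambda>a. fraction R a \<one>) \<in> ring_hom R K"
  by (rule ring_hom_memI)
    (simp_all add: fraction_closed S_one K_one fraction_mult fraction_add)

end

subsection \<open>Adeles\<close>

text \<open>The image of a homomorphism is a subring. Applied to the map from the completed local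
  ring to its fractions, this makes \<open>local_integers\<close> closed under all
  operations.\<close>

lemma
  assumes "cring R" "cring S" "h \<in> ring_hom R S"
  shows hom_image_add: "a \<in> h ` carrier R \<Longrightarrow> b \<in> h ` carrier R \<Longrightarrow> a \<oplus>\<^bsub>S\<^esub> b \<in> h ` carrier R"
    and hom_image_mult: "a \<in> h ` carrier R \<Longrightarrow> b \<in> h ` carrier R \<Longrightarrow> a \<otimes>\<^bsub>S\<^esub> b \<in> h ` carrier R"
    and hom_image_one: "\<one>\<^bsub>S\<^esub> \<in> h ` carrier R"
    and hom_image_zero: "\<zero>\<^bsub>S\<^esub> \<in> h ` carrier R"
    and hom_image_uminus: "a \<in> h ` carrier R \<Longrightarrow> \<ominus>\<^bsub>S\<^esub> a \<in> h ` carrier R"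
proof -
  interpret R: cring R by fact
  interpret S: cring S by fact
  interpret h: ring_hom_ring R S h by (rule ring_hom_ringI2[OF R.ring_axioms S.ring_axioms assms(3)])
  show "a \<in> h ` carrier R \<Longrightarrow> b \<in> h ` carrier R \<Longrightarrow> a \<oplus>\<^bsub>S\<^esub> b \<in> h ` carrier R"
    by (auto simp flip: h.hom_add)
  show "a \<in> h ` carrier R \<Longrightarrow> b \<in> h ` carrier R \<Longrightarrow> a \<otimes>\<^bsub>S\<^esub> b \<in> h ` carrier R"
    by (auto simp flip: h.hom_mult)
  show "\<one>\<^bsub>S\<^esub> \<in> h ` carrier R" using h.hom_one by (metis R.one_closed image_eqI)
  show "\<zero>\<^bsub>S\<^esub> \<in> h ` carrier R" using h.hom_zero by (metis R.zero_closed image_eqI)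
  show "a \<in> h ` carrier R \<Longrightarrow> \<ominus>\<^bsub>S\<^esub> a \<in> h ` carrier R"
    by (auto simp flip: h.hom_a_inv)
qed

locale curve_points =
  fixes X :: "('i::finite, 'k::field) point set"
  assumes X: "X \<subseteq> topspace zariski"
begin

abbreviation K where "K x \<equiv> local_field X x"
abbreviation \<O> where "\<O> x \<equiv> local_integers X x"
abbreviation AX where "AX \<equiv> adele_ring X"

lemma completed_cring:
  assumes "x \<in> X"
  shows "cring (completed_local_ring X x)"
proof -
  interpret point_on X x using X assms by unfold_locales
  interpret adic "local_ring X x" "local_max_ideal X x"
    by (intro adic.intro local_ring_cring local_max_ideal)
  show ?thesis unfolding completed_local_ring_def by (rule completion_cring)
qed

lemma completed_nat_invertible:
  assumes "x \<in> X" "of_nat n \<noteq> (0 :: 'k)"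
  shows "nat_invertible (completed_local_ring X x) n"
proof -
  interpret point_on X x using X assms(1) by unfold_locales
  interpret ad: adic "local_ring X x" "local_max_ideal X x"
    by (intro adic.intro local_ring_cring local_max_ideal)
  show ?thesis unfolding completed_local_ring_def
    by (rule nat_invertible_hom[OF ad.ring_axioms cring.axioms(1)[OF ad.completion_cring]
          ad.completion_hom local_ring_nat_invertible[OF assms(2)]])
qed

lemma K_cring: "x \<in> X \<Longrightarrow> cring (K x)"
  unfolding local_field_def by (intro ring_of_fractions.fraction_ring_cring ring_of_fractions.intro completed_cring)

lemma O_hom: "x \<in> X \<Longrightarrow> (\<lambda>a. fraction (completed_local_ring X x) a \<one>\<^bsub>completed_local_ring X x\<^esub>)
    \<in> ring_hom (completed_local_ring X x) (K x)"
  unfolding local_field_def by (intro ring_of_fractions.fraction_hom ring_of_fractions.intro completed_cring)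

lemma AX_simps:
  "\<alpha> \<otimes>\<^bsub>AX\<^esub> \<beta> = (\<lambda>x\<in>X. \<alpha> x \<otimes>\<^bsub>K x\<^esub> \<beta> x)" "\<one>\<^bsub>AX\<^esub> = (\<lambda>x\<in>X. \<one>\<^bsub>K x\<^esub>)"
  "\<zero>\<^bsub>AX\<^esub> = (\<lambda>x\<in>X. \<zero>\<^bsub>K x\<^esub>)" "\<alpha> \<oplus>\<^bsub>AX\<^esub> \<beta> = (\<lambda>x\<in>X. \<alpha> x \<oplus>\<^bsub>K x\<^esub> \<beta> x)"
  by (simp_all add: adele_ring_def)

lemma AX_closed: "\<alpha> \<in> carrier AX \<Longrightarrow> x \<in> X \<Longrightarrow> \<alpha> x \<in> carrier (K x)"
  by (auto simp: adele_ring_def)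

lemma AX_ext: "\<alpha> \<in> carrier AX \<Longrightarrow> \<alpha> \<in> extensional X"
  by (auto simp: adele_ring_def PiE_def)

lemma AX_integral: "\<alpha> \<in> carrier AX \<Longrightarrow> finite {x \<in> X. \<alpha> x \<notin> \<O> x}"
  by (simp add: adele_ring_def)

lemma AX_memI:
  assumes "\<And>x. x \<in> X \<Longrightarrow> f x \<in> carrier (K x)" "finite {x \<in> X. f x \<notin> \<O> x}"
  shows "(\<lambda>x\<in>X. f x) \<in> carrier AX"
proof -
  have "{x \<in> X. (\<lambda>x\<in>X. f x) x \<notin> \<O> x} = {x \<in> X. f x \<notin> \<O> x}" by auto
  then show ?thesis using assms by (simp add: adele_ring_def)
qed

text \<open>An operation that preserves integrality can produce a non-integral value only at a point
  where one argument is non-integral, and a union of two finite sets is finite. Sums, products and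
  negatives are all covered.\<close>

lemma AX_closed2:
  assumes "\<alpha> \<in> carrier AX" "\<beta> \<in> carrier AX"
    and "\<And>x a b. x \<in> X \<Longrightarrow> a \<in> carrier (K x) \<Longrightarrow> b \<in> carrier (K x) \<Longrightarrow> f x a b \<in> carrier (K x)"
    and "\<And>x a b. x \<in> X \<Longrightarrow> a \<in> \<O> x \<Longrightarrow> b \<in> \<O> x \<Longrightarrow> f x a b \<in> \<O> x"
  shows "(\<lambda>x\<in>X. f x (\<alpha> x) (\<beta> x)) \<in> carrier AX"
proof (rule AX_memI)
  show "f x (\<alpha> x) (\<beta> x) \<in> carrier (K x)" if "x \<in> X" for x
    using assms(1-3) that by (simp add: AX_closed)
  have "{x \<in> X. f x (\<alpha> x) (\<beta> x) \<notin> \<O> x} \<subseteq> {x \<in> X. \<alpha> x \<notin> \<O> x} \<union> {x \<in> X. \<beta> x \<notin> \<O> x}"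
    using assms(4) by blast
  then show "finite {x \<in> X. f x (\<alpha> x) (\<beta> x) \<notin> \<O> x}"
    using AX_integral[OF assms(1)] AX_integral[OF assms(2)] by (meson finite_UnI finite_subset)
qed

lemma adele_cring: "cring AX"
proof -
  note im = hom_image_add hom_image_mult hom_image_one hom_image_zero hom_image_uminus
  note integers = im[OF completed_cring K_cring O_hom, folded local_integers_def]
  note Kr = K_cring[THEN cring.axioms(1)]
  note Ka = ring.is_abelian_group[OF Kr]
  note Kam = abelian_group.axioms(1)[OF Ka]
  note Km = ring.is_monoid[OF Kr]
  show ?thesis
  proof (rule cringI)
    show "abelian_group AX"
    proof (rule abelian_groupI)
      fix \<alpha> \<beta> assume ab: "\<alpha> \<in> carrier AX" "\<beta> \<in> carrier AX"
      show "\<alpha> \<oplus>\<^bsub>AX\<^esub> \<beta> \<in> carrier AX"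
        unfolding AX_simps
        by (rule AX_closed2[OF ab]) (auto intro: abelian_monoid.a_closed[OF Kam] integers)
      show "\<alpha> \<oplus>\<^bsub>AX\<^esub> \<beta> = \<beta> \<oplus>\<^bsub>AX\<^esub> \<alpha>"
        unfolding AX_simps
        by (rule restrict_ext) (intro abelian_monoid.a_comm[OF Kam] AX_closed ab)
      fix \<gamma> assume c: "\<gamma> \<in> carrier AX"
      show "(\<alpha> \<oplus>\<^bsub>AX\<^esub> \<beta>) \<oplus>\<^bsub>AX\<^esub> \<gamma> = \<alpha> \<oplus>\<^bsub>AX\<^esub> (\<beta> \<oplus>\<^bsub>AX\<^esub> \<gamma>)"
        unfolding AX_simps
        by (rule restrict_ext)
          (simp only: restrict_apply if_True, intro abelian_monoid.a_assoc[OF Kam] AX_closed ab c)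
    next
      show "\<zero>\<^bsub>AX\<^esub> \<in> carrier AX"
        unfolding AX_simps
      proof (rule AX_memI)
        have "{x \<in> X. \<zero>\<^bsub>K x\<^esub> \<notin> \<O> x} = {}" using integers(4) by blast
        then show "finite {x \<in> X. \<zero>\<^bsub>K x\<^esub> \<notin> \<O> x}" by (simp only: finite.emptyI)
      qed (rule abelian_monoid.zero_closed[OF Kam])
    next
      fix \<alpha> assume a: "\<alpha> \<in> carrier AX"
      show "\<zero>\<^bsub>AX\<^esub> \<oplus>\<^bsub>AX\<^esub> \<alpha> = \<alpha>"
        unfolding AX_simps
        by (rule extensionalityI[OF restrict_extensional AX_ext[OF a]])
          (simp add: abelian_monoid.l_zero[OF Kam] AX_closed[OF a])
      have "(\<lambda>x\<in>X. \<ominus>\<^bsub>K x\<^esub> \<alpha> x) \<in> carrier AX"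
        \<comment> \<open>Negation is treated as a binary operation with the same adele in both
          places.\<close>
        by (rule AX_closed2[OF a a]) (auto intro: abelian_group.a_inv_closed[OF Ka] integers)
      moreover have "(\<lambda>x\<in>X. \<ominus>\<^bsub>K x\<^esub> \<alpha> x) \<oplus>\<^bsub>AX\<^esub> \<alpha> = \<zero>\<^bsub>AX\<^esub>"
        unfolding AX_simps
        by (rule restrict_ext) (simp add: abelian_group.l_neg[OF Ka] AX_closed[OF a])
      ultimately show "\<exists>\<beta>\<in>carrier AX. \<beta> \<oplus>\<^bsub>AX\<^esub> \<alpha> = \<zero>\<^bsub>AX\<^esub>" by blast
    qed
    show "comm_monoid AX"
    proof (rule comm_monoidI)
      fix \<alpha> \<beta> assume ab: "\<alpha> \<in> carrier AX" "\<beta> \<in> carrier AX"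
      show "\<alpha> \<otimes>\<^bsub>AX\<^esub> \<beta> \<in> carrier AX"
        unfolding AX_simps
        by (rule AX_closed2[OF ab]) (auto intro: monoid.m_closed[OF Km] integers)
      show "\<alpha> \<otimes>\<^bsub>AX\<^esub> \<beta> = \<beta> \<otimes>\<^bsub>AX\<^esub> \<alpha>"
        unfolding AX_simps
        by (rule restrict_ext) (intro comm_monoid.m_comm[OF cring.axioms(2)[OF K_cring]] AX_closed ab)
      fix \<gamma> assume c: "\<gamma> \<in> carrier AX"
      show "(\<alpha> \<otimes>\<^bsub>AX\<^esub> \<beta>) \<otimes>\<^bsub>AX\<^esub> \<gamma> = \<alpha> \<otimes>\<^bsub>AX\<^esub> (\<beta> \<otimes>\<^bsub>AX\<^esub> \<gamma>)"
        unfolding AX_simps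
        by (rule restrict_ext)
          (simp only: restrict_apply if_True, intro monoid.m_assoc[OF Km] AX_closed ab c)
    next
      show "\<one>\<^bsub>AX\<^esub> \<in> carrier AX"
        unfolding AX_simps
      proof (rule AX_memI)
        have "{x \<in> X. \<one>\<^bsub>K x\<^esub> \<notin> \<O> x} = {}" using integers(3) by blast
        then show "finite {x \<in> X. \<one>\<^bsub>K x\<^esub> \<notin> \<O> x}" by (simp only: finite.emptyI)
      qed (rule monoid.one_closed[OF Km])
    next
      fix \<alpha> assume a: "\<alpha> \<in> carrier AX"
      show "\<one>\<^bsub>AX\<^esub> \<otimes>\<^bsub>AX\<^esub> \<alpha> = \<alpha>"
        unfolding AX_simps
        by (rule extensionalityI[OF restrict_extensional AX_ext[OF a]])
          (simp add: monoid.l_one[OF Km] AX_closed[OF a])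
    qed
    fix \<alpha> \<beta> \<gamma> assume abc: "\<alpha> \<in> carrier AX" "\<beta> \<in> carrier AX" "\<gamma> \<in> carrier AX"
    show "(\<alpha> \<oplus>\<^bsub>AX\<^esub> \<beta>) \<otimes>\<^bsub>AX\<^esub> \<gamma> = \<alpha> \<otimes>\<^bsub>AX\<^esub> \<gamma> \<oplus>\<^bsub>AX\<^esub> \<beta> \<otimes>\<^bsub>AX\<^esub> \<gamma>"
      unfolding AX_simps
      by (rule restrict_ext)
        (simp only: restrict_apply if_True, intro ringE(3)[OF Kr] AX_closed abc)
  qed
qed

text \<open>The inverses are chosen in the completed local rings and not merely in their fraction
  fields. The family is therefore integral at every point and is an adele.\<close>

lemma adele_nat_invertible:
  assumes "of_nat n \<noteq> (0 :: 'k)"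
  shows "nat_invertible AX n"
proof -
  let ?C = "completed_local_ring X"
  let ?h = "\<lambda>x a. fraction (?C x) a \<one>\<^bsub>?C x\<^esub>"
  have "\<exists>u\<in>carrier (?C x). add_pow (?C x) n \<one>\<^bsub>?C x\<^esub> \<otimes>\<^bsub>?C x\<^esub> u = \<one>\<^bsub>?C x\<^esub>" if "x \<in> X" for x
    using completed_nat_invertible[OF that assms] by (simp add: nat_invertible_def)
  then obtain u where u: "\<And>x. x \<in> X \<Longrightarrow> u x \<in> carrier (?C x)"
    "\<And>x. x \<in> X \<Longrightarrow> add_pow (?C x) n \<one>\<^bsub>?C x\<^esub> \<otimes>\<^bsub>?C x\<^esub> u x = \<one>\<^bsub>?C x\<^esub>" by metis
  have pow: "add_pow AX k \<one>\<^bsub>AX\<^esub> = (\<lambda>x\<in>X. ?h x (add_pow (?C x) k \<one>\<^bsub>?C x\<^esub>))" for k :: nat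
  proof (induction k)
    case 0
    have "\<zero>\<^bsub>K x\<^esub> = ?h x \<zero>\<^bsub>?C x\<^esub>" for x
      by (simp add: local_field_def fraction_ring_def)
    then show ?case by (simp add: add_pow_def nat_pow_def AX_simps)
  next
    case (Suc k)
    have "?h x (add_pow (?C x) k \<one>\<^bsub>?C x\<^esub>) \<oplus>\<^bsub>K x\<^esub> \<one>\<^bsub>K x\<^esub> = ?h x (add_pow (?C x) (Suc k) \<one>\<^bsub>?C x\<^esub>)"
      if x: "x \<in> X" for x
    proof -
      interpret C: cring "?C x" by (rule completed_cring[OF x])
      show ?thesis
        unfolding C.add.nat_pow_Suc ring_hom_one[OF O_hom[OF x], symmetric]
        by (rule ring_hom_add[OF O_hom[OF x], symmetric]) simp_all
    qed
    note hSuc = this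
    have "add_pow AX (Suc k) \<one>\<^bsub>AX\<^esub> = add_pow AX k \<one>\<^bsub>AX\<^esub> \<oplus>\<^bsub>AX\<^esub> \<one>\<^bsub>AX\<^esub>"
      by (simp add: add_pow_def nat_pow_def)
    also have "\<dots> = (\<lambda>x\<in>X. ?h x (add_pow (?C x) (Suc k) \<one>\<^bsub>?C x\<^esub>))"
      unfolding Suc unfolding AX_simps
      by (rule restrict_ext) (simp only: restrict_apply if_True hSuc)
    finally show ?case .
  qed
  have "(\<lambda>x\<in>X. ?h x (u x)) \<in> carrier AX"
  proof (rule AX_memI)
    show "?h x (u x) \<in> carrier (K x)" if "x \<in> X" for x
      using ring_hom_closed[OF O_hom[OF that] u(1)[OF that]] .
    have "{x \<in> X. ?h x (u x) \<notin> \<O> x} = {}" using u(1) by (auto simp: local_integers_def)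
    then show "finite {x \<in> X. ?h x (u x) \<notin> \<O> x}" by (simp only: finite.emptyI)
  qed
  moreover have "add_pow AX n \<one>\<^bsub>AX\<^esub> \<otimes>\<^bsub>AX\<^esub> (\<lambda>x\<in>X. ?h x (u x)) = \<one>\<^bsub>AX\<^esub>"
    unfolding pow unfolding AX_simps
  proof (rule restrict_ext)
    fix x assume x: "x \<in> X"
    interpret C: cring "?C x" by (rule completed_cring[OF x])
    have "?h x (add_pow (?C x) n \<one>\<^bsub>?C x\<^esub>) \<otimes>\<^bsub>K x\<^esub> ?h x (u x)
        = ?h x (add_pow (?C x) n \<one>\<^bsub>?C x\<^esub> \<otimes>\<^bsub>?C x\<^esub> u x)"
      by (rule ring_hom_mult[OF O_hom[OF x], symmetric]) (simp_all add: u(1) x)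
    also have "\<dots> = \<one>\<^bsub>K x\<^esub>"
      unfolding u(2)[OF x] by (rule ring_hom_one[OF O_hom[OF x]])
    finally have "?h x (add_pow (?C x) n \<one>\<^bsub>?C x\<^esub>) \<otimes>\<^bsub>K x\<^esub> ?h x (u x) = \<one>\<^bsub>K x\<^esub>" .
    then show "(\<lambda>x\<in>X. ?h x (add_pow (?C x) n \<one>\<^bsub>?C x\<^esub>)) x \<otimes>\<^bsub>K x\<^esub> (\<lambda>x\<in>X. ?h x (u x)) x = \<one>\<^bsub>K x\<^esub>"
      using x by simp
  qed
  ultimately show ?thesis unfolding nat_invertible_def by blast
qed

end


section \<open>Separability over the adele ring\<close>

theorem proposition2p10:
  fixes X :: "('i::finite, 'k::alg_closed_field) point set"
    and n :: nat
    and t :: "('i, 'k) adele"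
  assumes "projective_curve X"
    and "nonsingular X"
    and "n > 1"
    and "CHAR('k) = 0 \<or> coprime n CHAR('k)"
    and "parameter_vector X n t"
  shows "separable_algebra (adele_ring X) (root_algebra (adele_ring X) n t) \<longleftrightarrow> t \<in> ideles X"
proof -
  have "closedin zariski X"
    using assms(1) by (simp add: projective_curve_def irreducible_closed_def)
  then interpret curve_points X
    by unfold_locales (rule closedin_subset)
  have "of_nat n \<noteq> (0 :: 'k)"
  proof
    assume "of_nat n = (0 :: 'k)"
    \<comment> \<open>In characteristic 0 this divisibility would give n = 0, against n > 1;
      otherwise coprimality leaves only 1 as characteristic, which no field has.\<close>
    then have "CHAR('k) dvd n" by (simp add: of_nat_eq_0_iff_char_dvd)
    then have "CHAR('k) = 1"
      using assms(3,4) by (metis coprime_common_divisor_nat dvd_0_left_iff dvd_refl not_one_less_zero)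
    then show False using CHAR_not_1[where 'a = 'k] by simp
  qed
  then have n: "nat_invertible AX n" by (rule adele_nat_invertible)
  have t: "t \<in> carrier AX" using assms(5) by (simp add: parameter_vector_def)
  show ?thesis
    unfolding ideles_def by (rule root_algebra_separable_iff[OF adele_cring t assms(3) n])
qed

end
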